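(* Let $d\ge 1$, let $A\in GL_d(\mathbb{Q})$ have no (complex) eigenvalue of norm $1$, and let $G=\mathbb{Z}\ltimes_A H$, where $H\subset\mathbb{Q}^d$ is a subgroup with $A(H)=H$ and $\mathrm{rank}_{\mathbb{Q}}(H)=d$. Then every representation $\phi:G\to\mathrm{Diff}^1_+([0,1])$ whose image group admits no global fixed point in $(0,1)$ is topologically conjugate to a representation into the affine group; that is, there exist a homomorphism $\psi:G\to\mathrm{Aff}_+(\mathbb{R})$ and a homeomorphism $\varphi:(0,1)\to\mathbb{R}$ such that $\varphi\circ\phi(g)=\psi(g)\circ\varphi$ on $(0,1)$ for all $g\in G$.
   Context: The $\mathbb{Q}$-rank of $H$, $\mathrm{rank}_{\mathbb{Q}}(H)$, is the smallest $d'$ such that $H$ embeds into $\mathbb{Q}^{d'}$. $\mathbb{Z}\ltimes_A H$ is the semidirect product in which the generator $a$ of $\mathbb{Z}$ acts on $H$ by $a\,b\,a^{-1}=A(b)$, $b\in H$. $\mathrm{Diff}^1_+([0,1])$ is the group of orientation-preserving $C^1$ diffeomorphisms of $[0,1]$; $\mathrm{Aff}_+(\mathbb{R})$ is the group of maps $x\mapsto\lambda x+t$ with $\lambda>0$, $t\in\mathbb{R}$. A global fixed point is a point fixed by every element of the group. *)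

theory Defs
  imports "HOL-Analysis.Analysis" "HOL-Algebra.Bij" "Jordan_Normal_Form.Char_Poly"
begin

section \<open>Subgroups of rational vector spaces\<close>

abbreviation Q_vec :: "nat \<Rightarrow> rat Matrix.vec monoid" where
  "Q_vec d \<equiv> monoid_vec TYPE(rat) d"

text \<open>The rank is meant for groups that embed into some \<open>Q_vec d\<close>; otherwise the
  value of \<^const>\<open>Least\<close> is unspecified.\<close>

definition Q_rank :: "('a, 'b) monoid_scheme \<Rightarrow> nat" where
  "Q_rank K = (LEAST d. mon K (Q_vec d) \<noteq> {})"

definition GL_Q :: "nat \<Rightarrow> rat mat monoid" where
  "GL_Q d = units_of (ring_mat TYPE(rat) d ())"

text \<open>The pair \<open>(m, b)\<close> stands for the element \<open>b a\<^sup>m\<close>, so that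
  \<open>b a\<^sup>m b' a\<^sup>n = (b + A\<^sup>m b') a\<^sup>m\<^sup>+\<^sup>n\<close>.\<close>

definition Z_semidirect :: "nat \<Rightarrow> rat mat \<Rightarrow> rat Matrix.vec set \<Rightarrow> (int \<times> rat Matrix.vec) monoid" where
  "Z_semidirect d A H =
    \<lparr>carrier = UNIV \<times> H,
     mult = (\<lambda>(m, b) (n, b'). (m + n, b + (A [^]\<^bsub>GL_Q d\<^esub> m) *\<^sub>v b')),
     one = (0, 0\<^sub>v d)\<rparr>"


section \<open>Groups of diffeomorphisms and affine maps\<close>

text \<open>Unlike \<^const>\<open>C1_differentiable_on\<close>, derivatives are taken relative to the set,
  hence one-sided at the endpoints of a closed interval.\<close>

definition C1_within :: "(real \<Rightarrow> real) \<Rightarrow> real set \<Rightarrow> bool" where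
  "C1_within f S \<longleftrightarrow>
    (\<exists>f'. continuous_on S f' \<and> (\<forall>x\<in>S. (f has_real_derivative f' x) (at x within S)))"

definition Diff1_plus :: "real set \<Rightarrow> (real \<Rightarrow> real) monoid" where
  "Diff1_plus S = (BijGroup S)
    \<lparr>carrier := {f \<in> Bij S. C1_within f S \<and> C1_within (inv_into S f) S \<and> strict_mono_on S f}\<rparr>"

definition Aff_plus :: "(real \<Rightarrow> real) monoid" where
  "Aff_plus = (BijGroup UNIV)
    \<lparr>carrier := {f. \<exists>l t. l > 0 \<and> f = (\<lambda>x. l * x + t)}\<rparr>"

end

theory Submission
  imports Defs "HOL-Library.Function_Algebras"
begin

text \<open>Write \<open>f\<close> for the image of the generator of \<open>\<int>\<close> and \<open>b\<close> for that of an element of \<open>H\<close>.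
  Since \<open>b \<mapsto> ln b'(p)\<close> is an \<open>A\<close>-invariant functional on \<open>H\<close> at each end point \<open>p\<close>,
  hyperbolicity gives \<open>b'(p) = 1\<close>, so near \<open>p\<close> displacements \<open>b x - x\<close> are almost additive in \<open>b\<close>.
  The order \<open>b x \<le> c x\<close> on \<open>H\<close> yields, as in Hoelder's theorem, a functional \<open>l\<close> with
  \<open>l b > 0 \<Longrightarrow> b x > x\<close>. If \<open>f\<^sup>n x\<close> tends to \<open>p\<close>, then the displacements at \<open>f\<^sup>n x\<close> become
  proportional to \<open>l \<circ> A\<^sup>-\<^sup>n\<close>, and the displacement, divided by the norm of \<open>l \<circ> A\<^sup>-\<^sup>n\<close>, shrinks from
  \<open>n\<close> to \<open>n + 1\<close> by the factor \<open>f'(p)\<close> up to \<open>1 + o(1)\<close>, just as the length of \<open>f\<^sup>n I\<close> for an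
  interval \<open>I\<close> around \<open>x\<close>. This comparison is used twice.

  If \<open>H\<close> has a fixed point in \<open>(0,1)\<close> but acts nontrivially, then \<open>x\<close> lies in an interval \<open>I\<close> with
  end points fixed by \<open>H\<close>, displacements are bounded by lengths, and \<open>l \<circ> A\<^sup>n\<close> grows
  subexponentially in both directions. As \<open>l (A\<^sup>n b)\<close> satisfies the linear recurrence given by the
  characteristic polynomial of \<open>A\<close>, this forces \<open>l = 0\<close>. Hence \<open>H\<close> acts trivially and \<open>f\<close> is
  conjugate to a translation.

  If \<open>H\<close> has no fixed point in \<open>(0,1)\<close>, then \<open>l\<close> is independent of \<open>x\<close>, hence \<open>l \<circ> A = m l\<close> with
  \<open>m \<noteq> 1\<close>, and \<open>h y = sup {l b | b x\<^sub>0 \<le> y}\<close> semiconjugates the action to an affine one. If \<open>h\<close> were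
  constant on an interval \<open>I\<close>, then elements moving \<open>f\<^sup>n I\<close> would move it off itself, so displacements
  would be at least its length, whereas \<open>l \<circ> A\<^sup>-\<^sup>n\<close> decays exponentially in the direction where
  \<open>m > 1\<close>.\<close>


section \<open>Linear recurrences and the Cayley--Hamilton relation\<close>

text \<open>The polynomial \<open>p\<close> evaluated at the shift of sequences. The index type is
  left open, since both one-sided and two-sided sequences occur.\<close>

definition shift_op :: "'a::comm_semiring_0 poly \<Rightarrow> ('i::comm_semiring_1 \<Rightarrow> 'a) \<Rightarrow> 'i \<Rightarrow> 'a" where
  "shift_op p s n = (\<Sum>i\<le>degree p. coeff p i * s (n + of_nat i))"

lemma shift_op_altdef:
  assumes "degree p \<le> N"
  shows "shift_op p s n = (\<Sum>i\<le>N. coeff p i * s (n + of_nat i))"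
  unfolding shift_op_def using assms
  by (intro sum.mono_neutral_left) (auto simp: coeff_eq_0)

lemma shift_op_0 [simp]: "shift_op 0 s n = 0"
  by (simp add: shift_op_def)

lemma shift_op_pCons: "shift_op (pCons a q) s n = a * s n + shift_op q s (n + 1)"
proof -
  have "shift_op (pCons a q) s n = (\<Sum>i\<le>Suc (degree q). coeff (pCons a q) i * s (n + of_nat i))"
    by (rule shift_op_altdef) (rule degree_pCons_le)
  also have "\<dots> = a * s n + (\<Sum>i\<le>degree q. coeff q i * s (n + of_nat (Suc i)))"
    by (subst sum.atMost_Suc_shift) simp
  finally show ?thesis by (simp add: shift_op_def ac_simps)
qed

lemma shift_op_add: "shift_op (p + q) s n = shift_op p s n + shift_op q s n"
proof -
  let ?N = "max (degree p) (degree q)"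
  have "degree (p + q) \<le> ?N" by (rule degree_add_le_max)
  then show ?thesis
    by (simp add: shift_op_altdef[of _ ?N] sum.distrib algebra_simps)
qed

lemma shift_op_smult: "shift_op (Polynomial.smult a p) s n = a * shift_op p s n"
  by (simp add: shift_op_altdef[OF Polynomial.degree_smult_le] shift_op_altdef[of p "degree p"]
      sum_distrib_left mult.assoc del: Polynomial.degree_smult_eq)

text \<open>Polynomials act on sequences as a ring, so factorizations of \<open>p\<close> and matrix
  identities over polynomials can be applied to recurrences.\<close>

lemma shift_op_mult: "shift_op (p * q) s n = shift_op p (shift_op q s) n"
proof (induction p arbitrary: n)
  case 0
  then show ?case by simp
next
  case (pCons a p)
  show ?case
    by (simp add: shift_op_add shift_op_smult shift_op_pCons pCons.IH)
qed

lemma shift_op_zero_seq: "(\<And>m. s m = 0) \<Longrightarrow> shift_op p s n = 0"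
  by (simp add: shift_op_def)

lemma shift_op_seq_sum: "shift_op p (\<lambda>m. \<Sum>j\<in>J. t j m) n = (\<Sum>j\<in>J. shift_op p (t j) n)"
  unfolding shift_op_def sum_distrib_left by (rule sum.swap)

lemma shift_op_poly_sum: "finite J \<Longrightarrow> shift_op (\<Sum>j\<in>J. q j) s n = (\<Sum>j\<in>J. shift_op (q j) s n)"
  by (induction J rule: finite_induct) (simp_all add: shift_op_add)

text \<open>Growth is bounded in both directions, since roots outside the unit circle are excluded
  by the future and roots inside it by the past.\<close>

definition subexp :: "(int \<Rightarrow> complex) \<Rightarrow> bool" where
  "subexp s \<longleftrightarrow> (\<forall>\<mu>>1. \<exists>C. \<forall>n. cmod (s n) \<le> C * \<mu> ^ nat \<bar>n\<bar>)"

lemma subexp_shift_op: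
  assumes "subexp s"
  shows "subexp (shift_op p s)"
  unfolding subexp_def
proof (intro allI impI)
  fix \<mu> :: real assume \<mu>: "\<mu> > 1"
  then obtain C where C: "\<And>n. cmod (s n) \<le> C * \<mu> ^ nat \<bar>n\<bar>"
    using assms unfolding subexp_def by blast
  have C0: "C \<ge> 0" using C[of 0] by (simp add: order_trans[OF norm_ge_zero])
  let ?K = "\<Sum>i\<le>degree p. cmod (coeff p i) * (C * \<mu> ^ i)"
  have "cmod (shift_op p s n) \<le> ?K * \<mu> ^ nat \<bar>n\<bar>" for n
  proof -
    have "cmod (shift_op p s n) \<le> (\<Sum>i\<le>degree p. cmod (coeff p i) * cmod (s (n + of_nat i)))"
      unfolding shift_op_def by (rule order_trans[OF norm_sum]) (simp add: norm_mult)
    also have "\<dots> \<le> (\<Sum>i\<le>degree p. cmod (coeff p i) * (C * \<mu> ^ (i + nat \<bar>n\<bar>)))"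
    proof (intro sum_mono mult_left_mono)
      fix i
      have "C * \<mu> ^ nat \<bar>n + of_nat i\<bar> \<le> C * \<mu> ^ (i + nat \<bar>n\<bar>)"
        using \<mu> C0 by (intro mult_left_mono power_increasing) auto
      then show "cmod (s (n + of_nat i)) \<le> C * \<mu> ^ (i + nat \<bar>n\<bar>)"
        using C order_trans by blast
    qed auto
    also have "\<dots> = ?K * \<mu> ^ nat \<bar>n\<bar>"
      by (simp add: sum_distrib_right power_add mult.assoc)
    finally show ?thesis .
  qed
  then show "\<exists>C. \<forall>n. cmod (shift_op p s n) \<le> C * \<mu> ^ nat \<bar>n\<bar>" by blast
qed

text \<open>A nonzero geometric sequence grows exponentially, forwards if \<open>cmod k > 1\<close>
  and backwards if \<open>cmod k < 1\<close>.\<close>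

lemma subexp_geometric_eq_0:
  assumes "subexp t" and rec: "\<And>n. t (n + 1) = k * t n" and k: "cmod k \<noteq> 1"
  shows "t m = 0"
proof -
  have pow: "t (m + int n) = k ^ n * t m" for n m
  proof (induction n)
    case (Suc n)
    have "t (m + int (Suc n)) = t ((m + int n) + 1)" by (simp add: ac_simps)
    then show ?case unfolding rec Suc by simp
  qed simp
  consider "cmod k > 1" | "cmod k < 1" using k by linarith
  then show ?thesis
  proof cases
    case 1
    then obtain \<mu> where \<mu>: "1 < \<mu>" "\<mu> < cmod k" using dense by blast
    obtain C where C: "\<And>n. cmod (t n) \<le> C * \<mu> ^ nat \<bar>n\<bar>"
      using \<open>subexp t\<close> \<mu> unfolding subexp_def by blast
    have C0: "C \<ge> 0" using C[of 0] by (simp add: order_trans[OF norm_ge_zero])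
    have "cmod (t m) \<le> C * \<mu> ^ nat \<bar>m\<bar> * (\<mu> / cmod k) ^ n" for n
    proof -
      have "cmod k ^ n * cmod (t m) = cmod (t (m + int n))"
        by (simp add: pow norm_mult norm_power)
      also have "\<dots> \<le> C * \<mu> ^ nat \<bar>m + int n\<bar>" by (rule C)
      also have "\<dots> \<le> C * \<mu> ^ (nat \<bar>m\<bar> + n)"
        using \<mu> C0 by (intro mult_left_mono power_increasing) auto
      finally have "cmod k ^ n * cmod (t m) \<le> C * \<mu> ^ (nat \<bar>m\<bar> + n)" .
      moreover have "cmod k ^ n > 0" using \<mu> by (intro zero_less_power) linarith
      ultimately show ?thesis
        by (simp add: power_divide power_add pos_le_divide_eq mult_ac)
    qed
    moreover have "\<mu> / cmod k < 1" using \<mu> by (subst divide_less_eq_1_pos) linarith+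
    then have "(\<lambda>n. C * \<mu> ^ nat \<bar>m\<bar> * (\<mu> / cmod k) ^ n) \<longlonglongrightarrow> C * \<mu> ^ nat \<bar>m\<bar> * 0"
      using \<mu> by (intro tendsto_intros LIMSEQ_realpow_zero) auto
    ultimately have "cmod (t m) \<le> 0"
      by (intro LIMSEQ_le_const) (auto)
    then show ?thesis by simp
  next
    case 2
    \<comment> \<open>The witness \<open>2 / (1 + cmod k)\<close> is the inverse of the mean of 1
      and \<open>cmod k\<close>.\<close>
    obtain \<mu> where \<mu>: "1 < \<mu>" "cmod k * \<mu> < 1"
    proof -
      show ?thesis
        by (rule that[of "2 / (1 + cmod k)"]) (use 2 norm_ge_zero[of k] in \<open>auto simp: field_simps add_pos_nonneg\<close>)
    qed
    obtain C where C: "\<And>n. cmod (t n) \<le> C * \<mu> ^ nat \<bar>n\<bar>"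
      using \<open>subexp t\<close> \<mu> unfolding subexp_def by blast
    have C0: "C \<ge> 0" using C[of 0] by (simp add: order_trans[OF norm_ge_zero])
    have "cmod (t m) \<le> C * \<mu> ^ nat \<bar>m\<bar> * (cmod k * \<mu>) ^ n" for n
    proof -
      have "cmod (t m) = cmod k ^ n * cmod (t (m - int n))"
        using pow[of "m - int n" n] by (simp add: norm_mult norm_power)
      also have "\<dots> \<le> cmod k ^ n * (C * \<mu> ^ nat \<bar>m - int n\<bar>)"
        by (intro mult_left_mono C) auto
      also have "\<dots> \<le> cmod k ^ n * (C * \<mu> ^ (nat \<bar>m\<bar> + n))"
        using \<mu> C0 by (intro mult_left_mono power_increasing) auto
      finally show ?thesis
        by (simp add: power_mult_distrib power_add mult_ac)
    qed
    moreover have "(\<lambda>n. C * \<mu> ^ nat \<bar>m\<bar> * (cmod k * \<mu>) ^ n) \<longlonglongrightarrow> C * \<mu> ^ nat \<bar>m\<bar> * 0"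
      using \<mu> by (intro tendsto_intros LIMSEQ_realpow_zero) auto
    ultimately have "cmod (t m) \<le> 0"
      by (intro LIMSEQ_le_const) (auto)
    then show ?thesis by simp
  qed
qed

text \<open>Splitting off a root \<open>k\<close> as \<open>p = [:-k, 1:] * q\<close> makes
  \<open>shift_op q s\<close> geometric with ratio \<open>k\<close>, hence zero, and the induction
  hypothesis applies to \<open>q\<close>.\<close>

lemma subexp_hyperbolic_recurrence_eq_0:
  fixes p :: "complex poly"
  assumes "p \<noteq> 0" and "\<And>k. poly p k = 0 \<Longrightarrow> cmod k \<noteq> 1"
    and "subexp s" and "\<And>n. shift_op p s n = 0"
  shows "s n = 0"
  using assms
proof (induction "degree p" arbitrary: p n)
  case 0
  then obtain c where "p = [:c:]" by (metis degree_eq_zeroE)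
  with 0 show ?case using "0.prems"(4)[of n] by (simp add: shift_op_pCons)
next
  case (Suc d)
  then obtain k where k: "poly p k = 0"
    by (metis fundamental_theorem_of_algebra_alt degree_pCons_0 nat.distinct(1))
  then obtain q where q: "p = [:-k, 1:] * q"
    by (metis poly_eq_0_iff_dvd dvdE)
  with Suc.prems(1) have "q \<noteq> 0" by auto
  then have "degree p = Suc (degree q)" unfolding q by (subst degree_mult_eq) auto
  then have "d = degree q" using Suc.hyps(2) by simp
  have "shift_op q s m = 0" for m
  proof (rule subexp_geometric_eq_0)
    show "subexp (shift_op q s)" by (rule subexp_shift_op) fact
    show "shift_op q s (m + 1) = k * shift_op q s m" for m
      using Suc.prems(4)[of m] unfolding q shift_op_mult
      by (simp add: shift_op_pCons)
    show "cmod k \<noteq> 1" using Suc.prems(2) k by blast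
  qed
  then show ?case
    using Suc.hyps(1)[OF \<open>d = degree q\<close> \<open>q \<noteq> 0\<close> _ \<open>subexp s\<close>] Suc.prems(2)
    unfolding q by auto
qed

text \<open>The recurrence says that \<open>X - A\<close>, with \<open>X\<close> acting as the
  shift, annihilates the vector of sequences. Multiplying by the adjugate replaces the matrix by its
  determinant, the characteristic polynomial.\<close>

lemma cayley_hamilton_sequence:
  fixes A :: "'a::field mat" and u :: "nat \<Rightarrow> nat \<Rightarrow> 'a"
  assumes A: "A \<in> carrier_mat d d"
    and rec: "\<And>i n. i < d \<Longrightarrow> u i (n + 1) = (\<Sum>j<d. A $$ (i, j) * u j n)"
    and k: "k < d"
  shows "shift_op (char_poly A) (u k) n = 0"
proof -
  let ?M = "char_poly_matrix A"
  have M: "?M \<in> carrier_mat d d" using A by simp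
  have adj: "adj_mat ?M \<in> carrier_mat d d" "adj_mat ?M * ?M = det ?M \<cdot>\<^sub>m 1\<^sub>m d"
    using adj_mat[OF M] by auto
  have row: "(\<Sum>j<d. shift_op (?M $$ (i, j)) (u j) n) = 0" if i: "i < d" for i n
  proof -
    have "shift_op (?M $$ (i, j)) (u j) n = (if i = j then u i (n + 1) else 0) - A $$ (i, j) * u j n"
      if j: "j < d" for j
      using i j A by (auto simp: char_poly_matrix_def shift_op_pCons one_pCons)
    then have "(\<Sum>j<d. shift_op (?M $$ (i, j)) (u j) n)
        = (\<Sum>j<d. (if i = j then u i (n + 1) else 0) - A $$ (i, j) * u j n)"
      by (intro sum.cong) auto
    also have "\<dots> = 0" using i rec[OF i, of n] by (simp add: sum_subtractf)
    finally show ?thesis .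
  qed
  \<comment> \<open>Row \<open>k\<close> of the identity between the adjugate, the matrix and its
    determinant.\<close>
  have ent: "(\<Sum>i<d. adj_mat ?M $$ (k, i) * ?M $$ (i, j)) = (if j = k then char_poly A else 0)"
    if "j < d" for j
  proof -
    have "(\<Sum>i<d. adj_mat ?M $$ (k, i) * ?M $$ (i, j)) = (adj_mat ?M * ?M) $$ (k, j)"
      using adj(1) M k that by (auto simp: scalar_prod_def lessThan_atLeast0)
    also have "\<dots> = (if j = k then char_poly A else 0)"
      unfolding adj(2) using k that by (auto simp: char_poly_def)
    finally show ?thesis .
  qed
  have "shift_op (char_poly A) (u k) n
      = (\<Sum>j<d. shift_op (\<Sum>i<d. adj_mat ?M $$ (k, i) * ?M $$ (i, j)) (u j) n)"
    using k by (subst sum.cong[OF refl, of _ _ "\<lambda>j. if j = k then shift_op (char_poly A) (u k) n else 0"])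
      (auto simp: ent)
  also have "\<dots> = (\<Sum>j<d. \<Sum>i<d. shift_op (adj_mat ?M $$ (k, i)) (shift_op (?M $$ (i, j)) (u j)) n)"
    by (simp add: shift_op_poly_sum shift_op_mult)
  also have "\<dots> = (\<Sum>i<d. shift_op (adj_mat ?M $$ (k, i)) (\<lambda>m. \<Sum>j<d. shift_op (?M $$ (i, j)) (u j) m) n)"
    by (subst sum.swap) (simp add: shift_op_seq_sum)
  also have "\<dots> = 0"
    by (simp add: row shift_op_zero_seq)
  finally show ?thesis .
qed


section \<open>Functionals on groups of finite rank\<close>

definition additive_on :: "'h::plus set \<Rightarrow> ('h \<Rightarrow> real) \<Rightarrow> bool" where
  "additive_on H l \<longleftrightarrow> (\<forall>b\<in>H. \<forall>c\<in>H. l (b + c) = l b + l c)"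

text \<open>The ring structure on the type only serves to write integer multiples as
  \<open>of_int k * b\<close>.\<close>

locale add_subgroup =
  fixes H :: "'h::comm_ring_1 set"
  assumes zero_in [simp, intro]: "0 \<in> H"
    and diff_in [intro]: "\<And>b c. b \<in> H \<Longrightarrow> c \<in> H \<Longrightarrow> b - c \<in> H"
begin

lemma uminus_in [intro]: "b \<in> H \<Longrightarrow> - b \<in> H"
  using diff_in[of 0 b] by simp

lemma plus_in [intro]: "b \<in> H \<Longrightarrow> c \<in> H \<Longrightarrow> b + c \<in> H"
  using diff_in[of b "- c"] by auto

lemma of_int_mult_in [intro]: "b \<in> H \<Longrightarrow> of_int k * b \<in> H"
proof (induction k rule: int_induct[where k = 0])
  case (step1 i)
  then show ?case using plus_in[of "of_int i * b" b] by (simp add: algebra_simps)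
next
  case (step2 i)
  then show ?case using diff_in[of "of_int i * b" b] by (simp add: algebra_simps)
qed simp

context
  fixes l assumes l: "additive_on H l"
begin

lemma additive_plus: "b \<in> H \<Longrightarrow> c \<in> H \<Longrightarrow> l (b + c) = l b + l c"
  using l unfolding additive_on_def by blast

lemma additive_zero: "l 0 = 0"
  using additive_plus[of 0 0] by simp

lemma additive_uminus: "b \<in> H \<Longrightarrow> l (- b) = - l b"
  using additive_plus[of b "- b"] additive_zero uminus_in by simp

lemma additive_diff: "b \<in> H \<Longrightarrow> c \<in> H \<Longrightarrow> l (b - c) = l b - l c"
  using additive_plus[of b "- c"] additive_uminus uminus_in by simp

lemma additive_of_int_mult: "b \<in> H \<Longrightarrow> l (of_int k * b) = of_int k * l b"
proof (induction k rule: int_induct[where k = 0])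
  case (step1 i)
  then show ?case using additive_plus[of "of_int i * b" b] of_int_mult_in[of b i] by (simp add: algebra_simps)
next
  case (step2 i)
  then show ?case using additive_diff[of "of_int i * b" b] of_int_mult_in[of b i] by (simp add: algebra_simps)
qed (simp add: additive_zero)

end

text \<open>If \<open>t b < l b * t e\<close>, a suitable integer combination of \<open>b\<close>
  and \<open>e\<close> has positive \<open>l\<close> but negative \<open>t\<close>. Applying the
  resulting inequality to \<open>b\<close> and to \<open>- b\<close> gives equality.\<close>

lemma functional_unique:
  assumes l: "additive_on H l" and t: "additive_on H t" and e: "e \<in> H" "l e = 1"
    and pos: "\<And>b. b \<in> H \<Longrightarrow> l b > 0 \<Longrightarrow> t b \<ge> 0"
    and b: "b \<in> H"
  shows "t b = l b * t e"
proof -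
  have ge: "t b \<ge> l b * t e" if b: "b \<in> H" for b
  proof (rule ccontr)
    assume "\<not> t b \<ge> l b * t e"
    then have pos': "0 < l b * t e - t b" by simp
    moreover have te: "t e \<ge> 0" using pos[OF e(1)] e(2) by simp
    ultimately obtain n where "t e < real n * (l b * t e - t b)"
      using reals_Archimedean3 by blast
    also have "\<dots> \<le> real (Suc n) * (l b * t e - t b)"
      using pos' by (intro mult_right_mono) auto
    finally have n: "real (Suc n) * (l b * t e - t b) > t e" .
    \<comment> \<open>The largest integer strictly below \<open>real (Suc n) * l b\<close>, so that
      \<open>l ?x\<close> is positive and at most 1.\<close>
    define p where "p = \<lceil>real (Suc n) * l b\<rceil> - 1"
    have p: "real_of_int p < real (Suc n) * l b" "real_of_int p \<ge> real (Suc n) * l b - 1"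
      unfolding p_def by linarith+
    let ?x = "of_int (int (Suc n)) * b - of_int p * e"
    have "l ?x = real (Suc n) * l b - p"
      using b e additive_diff[OF l, of "of_int (int (Suc n)) * b" "of_int p * e"]
        additive_of_int_mult[OF l, of b "int (Suc n)"] additive_of_int_mult[OF l, of e p]
        of_int_mult_in[of b "int (Suc n)"] of_int_mult_in[of e p]
      by simp
    then have "t ?x \<ge> 0" using p b e by (intro pos diff_in of_int_mult_in) auto
    moreover have "t ?x = real (Suc n) * t b - p * t e"
      using b e additive_diff[OF t, of "of_int (int (Suc n)) * b" "of_int p * e"]
        additive_of_int_mult[OF t, of b "int (Suc n)"] additive_of_int_mult[OF t, of e p]
        of_int_mult_in[of b "int (Suc n)"] of_int_mult_in[of e p]
      by simp
    moreover have "p * t e \<ge> (real (Suc n) * l b - 1) * t e"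
      using p(2) te by (intro mult_right_mono)
    ultimately show False using n by (simp add: algebra_simps)
  qed
  from ge[OF b] ge[OF uminus_in[OF b]] show ?thesis
    using additive_uminus[OF l b] additive_uminus[OF t b] by simp
qed

text \<open>Hoelder's embedding of an Archimedean ordered group, for the total preorder on \<open>H\<close> with
  nonnegative cone \<open>N\<close> and order unit \<open>e\<close>.\<close>

lemma hoelder_functional:
  assumes Nadd: "\<And>b c. b \<in> H \<Longrightarrow> c \<in> H \<Longrightarrow> N b \<Longrightarrow> N c \<Longrightarrow> N (b + c)"
    and tot: "\<And>b. b \<in> H \<Longrightarrow> N b \<or> N (- b)"
    and e: "e \<in> H" "\<not> N (- e)"
    and unit: "\<And>b. b \<in> H \<Longrightarrow> \<exists>K::int. N (of_int K * e - b)"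
  obtains l where "additive_on H l" "l e = 1" "\<And>b. b \<in> H \<Longrightarrow> N (- b) \<Longrightarrow> l b \<le> 0"
proof -
  have N0: "N 0" using tot[OF zero_in] by simp
  have Ne: "N e" using tot e by blast
  have Nmult: "N (of_int k * b)" if "k \<ge> 0" "N b" "b \<in> H" for k b
    using that(1)
  proof (induction k rule: int_ge_induct)
    case (step i)
    then show ?case using Nadd[of "of_int i * b" b] that of_int_mult_in[of b i] by (simp add: algebra_simps)
  qed (simp add: N0)
  have nonneg: "m \<ge> 0" if "N (of_int m * e)" for m
  proof (rule ccontr)
    assume "\<not> m \<ge> 0"
    then have "N (of_int (- m - 1) * e)" by (intro Nmult Ne e) auto
    then have "N (of_int m * e + of_int (- m - 1) * e)" using that e by (intro Nadd of_int_mult_in)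
    moreover have "of_int m * e + of_int (- m - 1) * e = - e" by (simp add: algebra_simps)
    ultimately show False using e by simp
  qed
  \<comment> \<open>The fractions \<open>p / q\<close> for which \<open>p\<close> times
    \<open>e\<close> is at most \<open>q\<close> times \<open>b\<close> in the preorder: the lower
    cut that defines \<open>l b\<close>.\<close>
  define X where "X b = {real_of_int p / real_of_int q |p q. q > 0 \<and> N (of_int q * b - of_int p * e)}" for b
  define l where "l b = Sup (X b)" for b
  \<comment> \<open>Cross-multiplying cancels \<open>b\<close> and leaves a multiple of
    \<open>e\<close>, whose sign is known.\<close>
  have compare: "real_of_int p' / real_of_int q' \<le> real_of_int p / real_of_int q"
    if "N (of_int q' * b - of_int p' * e)" "N (of_int p * e - of_int q * b)" "q > 0" "q' > 0" "b \<in> H"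
    for p p' q q' b
  proof -
    have "N (of_int q * (of_int q' * b - of_int p' * e) + of_int q' * (of_int p * e - of_int q * b))"
      using that e by (intro Nadd Nmult) auto
    moreover have "of_int q * (of_int q' * b - of_int p' * e) + of_int q' * (of_int p * e - of_int q * b)
        = of_int (q' * p - q * p') * e"
      by (simp add: algebra_simps)
    ultimately have "q' * p - q * p' \<ge> 0" using nonneg by metis
    then have "real_of_int (q * p') \<le> real_of_int (q' * p)" by (subst of_int_le_iff) simp
    then show ?thesis using that by (simp add: field_simps)
  qed
  have ne: "X b \<noteq> {}" if b: "b \<in> H" for b
  proof -
    obtain K where "N (of_int K * e - (- b))" using unit[of "- b"] b by blast
    then have "N (of_int 1 * b - of_int (- K) * e)" by (simp add: algebra_simps)
    then have "real_of_int (- K) / real_of_int 1 \<in> X b"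
      unfolding X_def mem_Collect_eq by (intro exI[of _ "- K"] exI[of _ 1]) simp
    then show ?thesis by blast
  qed
  have bdd: "bdd_above (X b)" if b: "b \<in> H" for b
  proof -
    obtain K where K: "N (of_int K * e - of_int 1 * b)" using unit[of b] b by auto
    show ?thesis
      by (rule bdd_aboveI[of _ "real_of_int K / real_of_int 1"])
        (auto simp: X_def simp del: of_int_1 intro!: compare[OF _ K] b)
  qed
  have lower: "real_of_int p / real_of_int q \<le> l b" if "N (of_int q * b - of_int p * e)" "q > 0" "b \<in> H" for p q b
    unfolding l_def using that by (intro cSup_upper bdd) (auto simp: X_def)
  have upper: "l b \<le> real_of_int p / real_of_int q" if "N (of_int p * e - of_int q * b)" "q > 0" "b \<in> H" for p q b
    unfolding l_def using that by (intro cSup_least ne) (auto simp: X_def intro: compare)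
  have swap: "N (of_int q * b - of_int p * e) \<or> N (of_int p * e - of_int q * b)" if "b \<in> H" for p q b
    using tot[of "of_int q * b - of_int p * e"] that e by auto
  \<comment> \<open>The integers next to \<open>q * l b\<close>, strictly below and strictly above
    it, so that the cut decides both comparisons.\<close>
  have approx: "\<exists>p p'. N (of_int q * b - of_int p * e) \<and> N (of_int p' * e - of_int q * b) \<and>
      real_of_int p \<ge> q * l b - 1 \<and> real_of_int p' \<le> q * l b + 1" if "q > 0" "b \<in> H" for q :: int and b
  proof (intro exI conjI)
    let ?p = "\<lceil>q * l b\<rceil> - 1" and ?p' = "\<lfloor>q * l b\<rfloor> + 1"
    have p: "real_of_int ?p < q * l b" "real_of_int ?p' > q * l b" by linarith+
    show "N (of_int q * b - of_int ?p * e)"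
      using swap[OF that(2), of q ?p] upper[OF _ that, of ?p] p(1) that
      by (force simp: pos_le_divide_eq mult.commute)
    show "N (of_int ?p' * e - of_int q * b)"
      using swap[OF that(2), of q ?p'] lower[OF _ that, of ?p'] p(2) that
      by (force simp: pos_divide_le_eq mult.commute)
  qed linarith+
  have add: "l (b + c) = l b + l c" if b: "b \<in> H" and c: "c \<in> H" for b c
  proof -
    \<comment> \<open>Two roundings by at most 1 each, divided by the denominator
      \<open>Suc n\<close>.\<close>
    have "\<bar>l (b + c) - (l b + l c)\<bar> \<le> 2 / real (Suc n)" for n
    proof -
      let ?q = "int (Suc n)"
      obtain p p' where p: "N (of_int ?q * b - of_int p * e)" "N (of_int p' * e - of_int ?q * b)"
        "real_of_int p \<ge> ?q * l b - 1" "real_of_int p' \<le> ?q * l b + 1"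
        using approx[of ?q b] b by auto
      obtain r r' where r: "N (of_int ?q * c - of_int r * e)" "N (of_int r' * e - of_int ?q * c)"
        "real_of_int r \<ge> ?q * l c - 1" "real_of_int r' \<le> ?q * l c + 1"
        using approx[of ?q c] c by auto
      have "N ((of_int ?q * b - of_int p * e) + (of_int ?q * c - of_int r * e))"
        by (intro Nadd p r diff_in of_int_mult_in b c e)
      then have "N (of_int ?q * (b + c) - of_int (p + r) * e)"
        by (simp add: algebra_simps)
      then have 1: "real_of_int (p + r) / real_of_int ?q \<le> l (b + c)" using b c by (intro lower) auto
      have "N ((of_int p' * e - of_int ?q * b) + (of_int r' * e - of_int ?q * c))"
        by (intro Nadd p r diff_in of_int_mult_in b c e)
      then have "N (of_int (p' + r') * e - of_int ?q * (b + c))"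
        by (simp add: algebra_simps)
      then have 2: "l (b + c) \<le> real_of_int (p' + r') / real_of_int ?q" using b c by (intro upper) auto
      show ?thesis using 1 2 p(3,4) r(3,4) by (simp add: abs_le_iff field_simps)
    qed
    moreover have "(\<lambda>n. 2 / real (Suc n)) \<longlonglongrightarrow> 0"
      by (rule LIMSEQ_Suc) (rule lim_const_over_n)
    ultimately have "\<bar>l (b + c) - (l b + l c)\<bar> \<le> 0"
      by (intro LIMSEQ_le_const) auto
    then show ?thesis by simp
  qed
  show thesis
  proof
    show "additive_on H l" using add unfolding additive_on_def by blast
    show "l e = 1" using lower[of 1 e 1] upper[of 1 1 e] e N0 by simp
    show "l b \<le> 0" if "b \<in> H" "N (- b)" for b using upper[of 0 1 b] that by simp
  qed
qed

end

text \<open>The last assumption says that \<open>H\<close> is a torsion group modulo the subgroup generated by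
  \<open>S\<close>, so that \<open>H\<close> has rank at most \<open>card S\<close>.\<close>

locale finite_rank_group = add_subgroup H for H :: "'h::comm_ring_1 set" +
  fixes S :: "'h set"
  assumes finite_S: "finite S" and S_sub: "S \<subseteq> H"
    and isolated: "\<And>T. T \<subseteq> H \<Longrightarrow> S \<subseteq> T \<Longrightarrow> add_subgroup T \<Longrightarrow>
      (\<And>b k. b \<in> H \<Longrightarrow> k > 0 \<Longrightarrow> of_int k * b \<in> T \<Longrightarrow> b \<in> T) \<Longrightarrow> H \<subseteq> T"
begin

text \<open>The elements of \<open>H\<close> satisfying \<open>P\<close> form a subgroup closed
  under taking roots, which contains \<open>S\<close> and hence all of \<open>H\<close>.\<close>

lemma isolated_induct [consumes 1, case_names gen zero diff root]:
  assumes "b \<in> H" and gen: "\<And>s. s \<in> S \<Longrightarrow> P s" and zero: "P 0"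
    and diff: "\<And>b c. b \<in> H \<Longrightarrow> c \<in> H \<Longrightarrow> P b \<Longrightarrow> P c \<Longrightarrow> P (b - c)"
    and root: "\<And>b k. b \<in> H \<Longrightarrow> k > 0 \<Longrightarrow> P (of_int k * b) \<Longrightarrow> P b"
  shows "P b"
proof -
  have "H \<subseteq> {b \<in> H. P b}"
  proof (rule isolated)
    show "add_subgroup {b \<in> H. P b}"
      by standard (use zero diff in auto)
    show "S \<subseteq> {b \<in> H. P b}" using gen S_sub by blast
    show "b \<in> {b \<in> H. P b}" if "b \<in> H" "k > 0" "of_int k * b \<in> {b \<in> H. P b}" for b k
      using root[OF that(1,2)] that by blast
  qed blast
  then show ?thesis using \<open>b \<in> H\<close> by blast
qed

text \<open>The constant depends on \<open>b\<close> only. This uniformity makes the maximum over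
  \<open>S\<close> a norm on functionals and lets one bound serve for a whole sequence of
  them.\<close>

lemma functional_bound:
  assumes "b \<in> H"
  shows "\<exists>C\<ge>0. \<forall>l M. additive_on H l \<longrightarrow> M \<ge> 0 \<longrightarrow> (\<forall>s\<in>S. \<bar>l s\<bar> \<le> M) \<longrightarrow> \<bar>l b\<bar> \<le> C * M"
  using assms
proof (induction rule: isolated_induct)
  case (gen s)
  then show ?case by (intro exI[of _ 1]) auto
next
  case zero
  then show ?case by (intro exI[of _ 0]) (auto simp: additive_zero)
next
  case (diff b c)
  then obtain C C' where "C \<ge> 0" "C' \<ge> 0"
    and C: "\<And>l M. additive_on H l \<Longrightarrow> M \<ge> 0 \<Longrightarrow> (\<forall>s\<in>S. \<bar>l s\<bar> \<le> M) \<Longrightarrow> \<bar>l b\<bar> \<le> C * M"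
      "\<And>l M. additive_on H l \<Longrightarrow> M \<ge> 0 \<Longrightarrow> (\<forall>s\<in>S. \<bar>l s\<bar> \<le> M) \<Longrightarrow> \<bar>l c\<bar> \<le> C' * M"
    by auto
  show ?case
  proof (intro exI[of _ "C + C'"] conjI allI impI)
    fix l M assume *: "additive_on H l" "M \<ge> 0" "\<forall>s\<in>S. \<bar>l s\<bar> \<le> M"
    show "\<bar>l (b - c)\<bar> \<le> (C + C') * M"
      using C(1)[OF *] C(2)[OF *] additive_diff[OF *(1) diff(1,2)] by (simp add: algebra_simps)
  qed (use \<open>C \<ge> 0\<close> \<open>C' \<ge> 0\<close> in auto)
next
  case (root b k)
  then obtain C where "C \<ge> 0"
    and C: "\<And>l M. additive_on H l \<Longrightarrow> M \<ge> 0 \<Longrightarrow> (\<forall>s\<in>S. \<bar>l s\<bar> \<le> M) \<Longrightarrow> \<bar>l (of_int k * b)\<bar> \<le> C * M"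
    by auto
  show ?case
  proof (intro exI[of _ C] conjI allI impI)
    fix l M assume *: "additive_on H l" "M \<ge> 0" "\<forall>s\<in>S. \<bar>l s\<bar> \<le> M"
    have "1 * \<bar>l b\<bar> \<le> of_int k * \<bar>l b\<bar>"
      using \<open>k > 0\<close> by (intro mult_right_mono) auto
    also have "\<dots> = \<bar>l (of_int k * b)\<bar>"
      using additive_of_int_mult[OF *(1) root(1), of k] \<open>k > 0\<close> by (simp add: abs_mult)
    finally show "\<bar>l b\<bar> \<le> C * M" using C[OF *] by simp
  qed fact
qed

lemma functional_eq_0:
  assumes "additive_on H l" "\<And>s. s \<in> S \<Longrightarrow> l s = 0" "b \<in> H"
  shows "l b = 0"
  using functional_bound[OF assms(3)] assms(1,2) by (metis abs_eq_0_iff abs_le_zero_iff mult_zero_right order_refl)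

end

section \<open>Actions normalized by a hyperbolic automorphism\<close>

text \<open>Both points vary, as is needed for comparing lengths of small intervals near
  \<open>p\<close> that need not contain \<open>p\<close>.\<close>

definition strict_deriv :: "(real \<Rightarrow> real) \<Rightarrow> real \<Rightarrow> real \<Rightarrow> bool" where
  "strict_deriv F p k \<longleftrightarrow> (\<forall>\<epsilon>>0. \<exists>\<delta>>0. \<forall>y\<in>{0..1}. \<forall>z\<in>{0..1}.
     \<bar>y - p\<bar> < \<delta> \<longrightarrow> \<bar>z - p\<bar> < \<delta> \<longrightarrow> \<bar>F y - F z - k * (y - z)\<bar> \<le> \<epsilon> * \<bar>y - z\<bar>)"

text \<open>Mean value theorem, with the derivative within \<open>\<epsilon>\<close> of
  \<open>k\<close> near \<open>p\<close> by continuity.\<close>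

lemma C1_within_strict_deriv:
  assumes "C1_within F {0..1}" and p: "p \<in> {0..1}"
    and k: "(F has_real_derivative k) (at p within {0..1})"
  shows "strict_deriv F p k"
proof -
  obtain F' where cont: "continuous_on {0..1} F'"
    and F': "\<And>x. x \<in> {0..1} \<Longrightarrow> (F has_real_derivative F' x) (at x within {0..1})"
    using assms(1) unfolding C1_within_def by blast
  have "at p within {0..1::real} \<noteq> bot" using p by (auto simp: trivial_limit_within)
  then have "F' p = k" using has_field_derivative_unique[OF F'[OF p] k] by simp
  show ?thesis unfolding strict_deriv_def
  proof (intro allI impI)
    fix \<epsilon> :: real assume "\<epsilon> > 0"
    then obtain \<delta> where \<delta>: "\<delta> > 0" "\<And>y. y \<in> {0..1} \<Longrightarrow> \<bar>y - p\<bar> < \<delta> \<Longrightarrow> \<bar>F' y - k\<bar> < \<epsilon>"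
      using cont p \<open>F' p = k\<close> unfolding continuous_on_iff dist_real_def by metis
    have *: "\<bar>F y - F z - k * (y - z)\<bar> \<le> \<epsilon> * \<bar>y - z\<bar>"
      if "y \<in> {0..1}" "z \<in> {0..1}" "\<bar>y - p\<bar> < \<delta>" "\<bar>z - p\<bar> < \<delta>" "z < y" for y z
    proof -
      have "\<exists>t\<in>{z<..<y}. F y - F z = (\<lambda>h. h * F' t) (y - z)"
      proof (rule mvt_simple)
        fix t assume "z \<le> t" "t \<le> y"
        then have "(F has_real_derivative F' t) (at t within {z..y})"
          using that by (intro has_field_derivative_subset[OF F']) auto
        then show "(F has_derivative (\<lambda>h. h * F' t)) (at t within {z..y})"
          by (simp add: has_field_derivative_def mult_commute_abs)
      qed fact
      then obtain t where t: "z < t" "t < y" "F y - F z = (y - z) * F' t" by auto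
      have "\<bar>F' t - k\<bar> < \<epsilon>" using t that by (intro \<delta>) auto
      then have "\<bar>F' t - k\<bar> * \<bar>y - z\<bar> \<le> \<epsilon> * \<bar>y - z\<bar>" by (intro mult_right_mono) auto
      then show ?thesis unfolding t by (simp add: abs_mult[symmetric] algebra_simps)
    qed
    have "\<bar>F y - F z - k * (y - z)\<bar> \<le> \<epsilon> * \<bar>y - z\<bar>"
      if "y \<in> {0..1}" "z \<in> {0..1}" "\<bar>y - p\<bar> < \<delta>" "\<bar>z - p\<bar> < \<delta>" for y z
      using *[of y z] *[of z y] that by (cases y z rule: linorder_cases) (auto simp: algebra_simps abs_minus_commute)
    then show "\<exists>\<delta>>0. \<forall>y\<in>{0..1}. \<forall>z\<in>{0..1}. \<bar>y - p\<bar> < \<delta> \<longrightarrow> \<bar>z - p\<bar> < \<delta> \<longrightarrow>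
        \<bar>F y - F z - k * (y - z)\<bar> \<le> \<epsilon> * \<bar>y - z\<bar>"
      using \<delta>(1) by blast
  qed
qed

lemma strict_deriv_sequentially:
  assumes "strict_deriv F p k" "y \<longlonglongrightarrow> p" "z \<longlonglongrightarrow> p"
    and "\<And>n. y n \<in> {0..1}" "\<And>n. z n \<in> {0..1}" and "\<epsilon> > 0"
  shows "\<forall>\<^sub>F n in sequentially. \<bar>F (y n) - F (z n) - k * (y n - z n)\<bar> \<le> \<epsilon> * \<bar>y n - z n\<bar>"
proof -
  obtain \<delta> where \<delta>: "\<delta> > 0" "\<forall>y\<in>{0..1}. \<forall>z\<in>{0..1}.
     \<bar>y - p\<bar> < \<delta> \<longrightarrow> \<bar>z - p\<bar> < \<delta> \<longrightarrow> \<bar>F y - F z - k * (y - z)\<bar> \<le> \<epsilon> * \<bar>y - z\<bar>"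
    using assms unfolding strict_deriv_def by blast
  have "\<forall>\<^sub>F n in sequentially. dist (y n) p < \<delta>" "\<forall>\<^sub>F n in sequentially. dist (z n) p < \<delta>"
    using assms \<delta>(1) by (auto intro: tendstoD)
  then show ?thesis
    by eventually_elim (use \<delta>(2) assms in \<open>auto simp: dist_real_def\<close>)
qed

text \<open>From some index \<open>N\<close> on, each step multiplies by less than
  \<open>\<mu>\<close>. The sum of the terms up to \<open>N\<close> is a constant that covers the
  initial segment and starts the induction.\<close>

lemma subexponential_of_ratio_tendsto_1:
  fixes R :: "nat \<Rightarrow> real"
  assumes pos: "\<And>n. R n > 0" and lim: "(\<lambda>n. R (Suc n) / R n) \<longlonglongrightarrow> 1" and \<mu>: "\<mu> > 1"
  shows "\<exists>C. \<forall>n. R n \<le> C * \<mu> ^ n"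
proof -
  obtain N where N: "\<And>n. n \<ge> N \<Longrightarrow> R (Suc n) / R n < \<mu>"
    using order_tendstoD(2)[OF lim \<mu>] unfolding eventually_sequentially by blast
  let ?C = "\<Sum>i\<le>N. R i"
  have small: "R n \<le> ?C * \<mu> ^ n" if "n \<le> N" for n
  proof -
    have "R n \<le> ?C" using that pos by (intro member_le_sum) (auto intro: less_imp_le)
    also have "\<dots> = ?C * 1" by simp
    also have "\<dots> \<le> ?C * \<mu> ^ n"
      using \<mu> pos by (intro mult_left_mono sum_nonneg) (auto intro: less_imp_le)
    finally show ?thesis .
  qed
  have "R n \<le> ?C * \<mu> ^ n" if "n \<ge> N" for n
    using that
  proof (induction n rule: dec_induct)
    case base
    then show ?case by (rule small) simp
  next
    case (step n)
    have "R (Suc n) \<le> \<mu> * R n" using N[OF step(1)] pos[of n] by (simp add: pos_divide_less_eq)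
    also have "\<dots> \<le> \<mu> * (?C * \<mu> ^ n)" using step \<mu> by (intro mult_left_mono) auto
    finally show ?case by (simp add: mult_ac)
  qed
  with small show ?thesis by (metis nat_le_linear)
qed

text \<open>The sum over the finite set dominates every choice of indices. This is applied to
  generators that vary with \<open>n\<close>.\<close>

lemma tendsto_0_finite_choice:
  fixes F :: "'b \<Rightarrow> nat \<Rightarrow> real"
  assumes "finite T" "\<And>t. t \<in> T \<Longrightarrow> F t \<longlonglongrightarrow> 0" "\<And>n. e n \<in> T"
  shows "(\<lambda>n. F (e n) n) \<longlonglongrightarrow> 0"
proof (rule Lim_null_comparison)
  show "\<forall>\<^sub>F n in sequentially. norm (F (e n) n) \<le> (\<Sum>t\<in>T. \<bar>F t n\<bar>)"
    using assms(1,3) by (intro always_eventually allI) (auto intro: member_le_sum)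
  have "(\<lambda>n. \<Sum>t\<in>T. \<bar>F t n\<bar>) \<longlonglongrightarrow> (\<Sum>t\<in>T. \<bar>0\<bar>)"
    using assms(2) by (intro tendsto_sum tendsto_rabs)
  then show "(\<lambda>n. \<Sum>t\<in>T. \<bar>F t n\<bar>) \<longlonglongrightarrow> 0" by simp
qed

lemma tendsto_0_of_le_bounded:
  fixes F d :: "nat \<Rightarrow> real"
  assumes "\<And>\<epsilon>. \<epsilon> > 0 \<Longrightarrow> \<forall>\<^sub>F n in sequentially. \<bar>F n\<bar> \<le> \<epsilon> * \<bar>d n\<bar>"
    and "\<forall>\<^sub>F n in sequentially. \<bar>d n\<bar> \<le> C"
  shows "F \<longlonglongrightarrow> 0"
proof (rule tendstoI)
  fix e :: real assume "e > 0"
  let ?\<epsilon> = "e / (2 * (\<bar>C\<bar> + 1))"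
  have "?\<epsilon> > 0" using \<open>e > 0\<close> by simp
  then have "\<forall>\<^sub>F n in sequentially. \<bar>F n\<bar> \<le> ?\<epsilon> * \<bar>d n\<bar>" by (rule assms(1))
  with assms(2) show "\<forall>\<^sub>F n in sequentially. dist (F n) 0 < e"
  proof eventually_elim
    case (elim n)
    have "?\<epsilon> * \<bar>d n\<bar> \<le> ?\<epsilon> * (\<bar>C\<bar> + 1)"
      using elim \<open>?\<epsilon> > 0\<close> by (intro mult_left_mono) auto
    also have "\<dots> = e / 2" by (simp add: field_simps)
    finally have "\<bar>F n\<bar> \<le> e / 2" using elim(2) by linarith
    then show ?case using \<open>e > 0\<close> by simp
  qed
qed

section \<open>One-sided derivatives on the unit interval\<close>

lemma derivative_at_endpoint:
  assumes "C1_within F {0..1}" "p = 0 \<or> p = 1"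
  obtains k where "(F has_real_derivative k) (at p within {0..1})"
proof -
  have "p \<in> {0..1}" using assms(2) by auto
  then show thesis using assms(1) that unfolding C1_within_def by blast
qed

lemma has_derivative_comp_Icc:
  assumes "(F has_real_derivative k) (at p within {0..1})" "(G has_real_derivative m) (at p within {0..1})"
    and "G p = p" "\<And>x. x \<in> {0..1} \<Longrightarrow> G x \<in> {0..1}"
  shows "((\<lambda>x. F (G x)) has_real_derivative k * m) (at p within {0..1})"
proof -
  have "(F has_real_derivative k) (at (G p) within G ` {0..1})"
    using assms(1,3,4) by (auto intro: has_field_derivative_subset)
  from DERIV_image_chain[OF this assms(2)] show ?thesis by (simp add: o_def)
qed

text \<open>The chain rule at a fixed point \<open>p\<close> of \<open>G\<close>; derivatives within
  the interval are unique because \<open>p\<close> is not isolated in it.\<close>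

lemma derivative_comp_unique:
  assumes "(F has_real_derivative k) (at p within {0..1})" "(G has_real_derivative m) (at p within {0..1})"
    and "G p = p" "\<And>x. x \<in> {0..1} \<Longrightarrow> G x \<in> {0..1}" "\<And>x. x \<in> {0..1} \<Longrightarrow> F (G x) = K x"
    and "(K has_real_derivative c) (at p within {0..1})" "p \<in> {0..1}"
  shows "c = k * m"
proof -
  have "((\<lambda>x. F (G x)) has_real_derivative k * m) (at p within {0..1})"
    by (rule has_derivative_comp_Icc) fact+
  then have "(K has_real_derivative k * m) (at p within {0..1})"
    by (rule has_field_derivative_transform_within[where d = 1])
      (use assms(5,7) in \<open>auto simp del: atLeastAtMost_iff\<close>)
  moreover have "at p within {0..1::real} \<noteq> bot" using assms(7) by (auto simp: trivial_limit_within)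
  ultimately show ?thesis using has_field_derivative_unique[OF assms(6)] by blast
qed

lemma derivative_nonneg_of_strict_mono:
  assumes "(F has_real_derivative k) (at p within {0..1})" "strict_mono_on {0..1} F" "p \<in> {0..1}"
  shows "k \<ge> 0"
proof -
  have lim: "((\<lambda>y. (F y - F p) / (y - p)) \<longlongrightarrow> k) (at p within {0..1})"
    using assms(1) by (simp add: has_field_derivative_iff)
  have nb: "at p within {0..1::real} \<noteq> bot" using assms(3) by (auto simp: trivial_limit_within)
  have ev: "\<forall>\<^sub>F y in at p within {0..1}. (F y - F p) / (y - p) \<ge> 0"
    unfolding eventually_at_filter
  proof (intro always_eventually allI impI)
    fix y assume "y \<noteq> p" "y \<in> {0..1}"
    then show "(F y - F p) / (y - p) \<ge> 0"
      using strict_mono_onD[OF assms(2), of y p] strict_mono_onD[OF assms(2), of p y] assms(3)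
      by (cases "y < p") (auto simp: divide_simps)
  qed
  show ?thesis by (rule tendsto_lowerbound[OF lim ev nb])
qed

lemma C1_within_tendsto:
  assumes "C1_within F {0..1}" "y \<longlonglongrightarrow> p" "\<And>n. y n \<in> {0..1}" "p \<in> {0..1}"
  shows "(\<lambda>n. F (y n)) \<longlonglongrightarrow> F p"
proof -
  have "continuous_on {0..1} F"
    using assms(1) unfolding C1_within_def by (metis DERIV_continuous_on)
  then show ?thesis
    by (rule continuous_on_tendsto_compose[OF _ assms(2,4)])
      (intro always_eventually allI assms(3))
qed

text \<open>The inverses \<open>\<beta>\<close> and \<open>g\<close> are parameters, so that
  reversing time is an exchange of arguments. The eigenvalue condition enters only through
  \<open>hyperbolic\<close>: a functional whose values along an orbit of \<open>\<alpha>\<close> are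
  subexponential in both directions vanishes at the starting point.\<close>

locale hyperbolic_action = finite_rank_group H S for H S :: "'h::comm_ring_1 set" +
  fixes \<alpha> \<beta> :: "'h \<Rightarrow> 'h" and \<rho> :: "'h \<Rightarrow> real \<Rightarrow> real" and f g :: "real \<Rightarrow> real"
  assumes alpha_in [intro]: "\<And>b. b \<in> H \<Longrightarrow> \<alpha> b \<in> H"
    and beta_in [intro]: "\<And>b. b \<in> H \<Longrightarrow> \<beta> b \<in> H"
    and alpha_beta: "\<And>b. b \<in> H \<Longrightarrow> \<alpha> (\<beta> b) = b"
    and beta_alpha: "\<And>b. b \<in> H \<Longrightarrow> \<beta> (\<alpha> b) = b"
    and alpha_add: "\<And>b c. b \<in> H \<Longrightarrow> c \<in> H \<Longrightarrow> \<alpha> (b + c) = \<alpha> b + \<alpha> c"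
    and hyperbolic: "\<And>l b. additive_on H l \<Longrightarrow> b \<in> H \<Longrightarrow>
      (\<And>\<mu>. \<mu> > 1 \<Longrightarrow> \<exists>C. \<forall>n. \<bar>l ((\<alpha> ^^ n) b)\<bar> \<le> C * \<mu> ^ n) \<Longrightarrow>
      (\<And>\<mu>. \<mu> > 1 \<Longrightarrow> \<exists>C. \<forall>n. \<bar>l ((\<beta> ^^ n) b)\<bar> \<le> C * \<mu> ^ n) \<Longrightarrow> l b = 0"
    and rho_in [intro]: "\<And>b x. b \<in> H \<Longrightarrow> x \<in> {0..1} \<Longrightarrow> \<rho> b x \<in> {0..1}"
    and rho_mono: "\<And>b. b \<in> H \<Longrightarrow> strict_mono_on {0..1} (\<rho> b)"
    and rho_add: "\<And>b c x. b \<in> H \<Longrightarrow> c \<in> H \<Longrightarrow> x \<in> {0..1} \<Longrightarrow> \<rho> (b + c) x = \<rho> b (\<rho> c x)"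
    and rho_zero: "\<And>x. x \<in> {0..1} \<Longrightarrow> \<rho> 0 x = x"
    and rho_C1: "\<And>b. b \<in> H \<Longrightarrow> C1_within (\<rho> b) {0..1}"
    and f_in [intro]: "\<And>x. x \<in> {0..1} \<Longrightarrow> f x \<in> {0..1}"
    and g_in [intro]: "\<And>x. x \<in> {0..1} \<Longrightarrow> g x \<in> {0..1}"
    and f_g: "\<And>x. x \<in> {0..1} \<Longrightarrow> f (g x) = x"
    and g_f: "\<And>x. x \<in> {0..1} \<Longrightarrow> g (f x) = x"
    and f_mono: "strict_mono_on {0..1} f"
    and g_mono: "strict_mono_on {0..1} g"
    and f_C1: "C1_within f {0..1}"
    and g_C1: "C1_within g {0..1}"
    and f_rho: "\<And>b x. b \<in> H \<Longrightarrow> x \<in> {0..1} \<Longrightarrow> f (\<rho> b x) = \<rho> (\<alpha> b) (f x)"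
begin

lemma g_rho: "b \<in> H \<Longrightarrow> x \<in> {0..1} \<Longrightarrow> g (\<rho> b x) = \<rho> (\<beta> b) (g x)"
  using f_rho[of "\<beta> b" "g x"] by (metis alpha_beta beta_in f_g g_f g_in rho_in)

lemma beta_add: "b \<in> H \<Longrightarrow> c \<in> H \<Longrightarrow> \<beta> (b + c) = \<beta> b + \<beta> c"
  by (metis alpha_add alpha_beta beta_alpha beta_in plus_in)

text \<open>Time reversal: every result about forward orbits of \<open>f\<close> applies to those of
  \<open>g\<close>.\<close>

lemma swap: "hyperbolic_action H S \<beta> \<alpha> \<rho> g f"
  by unfold_locales
    (auto intro: hyperbolic simp: alpha_beta beta_alpha beta_add rho_mono rho_add rho_zero rho_C1
      f_g g_f f_mono g_mono f_C1 g_C1 g_rho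
      simp del: atLeastAtMost_iff)

lemma alpha_pow_in [intro]: "b \<in> H \<Longrightarrow> (\<alpha> ^^ n) b \<in> H"
  by (induction n) auto

lemma beta_pow_in [intro]: "b \<in> H \<Longrightarrow> (\<beta> ^^ n) b \<in> H"
  by (induction n) auto

lemma f_pow_in [intro]: "x \<in> {0..1} \<Longrightarrow> (f ^^ n) x \<in> {0..1}"
  by (induction n) (auto simp del: atLeastAtMost_iff)

lemma f_less_iff: "x \<in> {0..1} \<Longrightarrow> y \<in> {0..1} \<Longrightarrow> f x < f y \<longleftrightarrow> x < y"
  using f_mono by (rule strict_mono_on_less)

lemma f_pow_less_iff: "x \<in> {0..1} \<Longrightarrow> y \<in> {0..1} \<Longrightarrow> (f ^^ n) x < (f ^^ n) y \<longleftrightarrow> x < y"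
  by (induction n) (auto simp: f_less_iff[OF f_pow_in f_pow_in])

lemma f_pow_le_iff: "x \<in> {0..1} \<Longrightarrow> y \<in> {0..1} \<Longrightarrow> (f ^^ n) x \<le> (f ^^ n) y \<longleftrightarrow> x \<le> y"
  using f_pow_less_iff[of y x n] by (simp add: not_less[symmetric])

lemma rho_less_iff: "b \<in> H \<Longrightarrow> x \<in> {0..1} \<Longrightarrow> y \<in> {0..1} \<Longrightarrow> \<rho> b x < \<rho> b y \<longleftrightarrow> x < y"
  using rho_mono by (rule strict_mono_on_less)

lemma rho_le_iff: "b \<in> H \<Longrightarrow> x \<in> {0..1} \<Longrightarrow> y \<in> {0..1} \<Longrightarrow> \<rho> b x \<le> \<rho> b y \<longleftrightarrow> x \<le> y"
  using rho_less_iff[of b y x] by (simp add: not_less[symmetric])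

lemma f_endpoint: "p = 0 \<or> p = 1 \<Longrightarrow> f p = p"
  using f_less_iff[of "g 0" 0] f_less_iff[of 1 "g 1"] g_in[of 0] g_in[of 1] f_g[of 0] f_g[of 1]
    f_in[of 0] f_in[of 1] by (smt (verit) atLeastAtMost_iff f_less_iff)

lemma rho_uminus: "b \<in> H \<Longrightarrow> x \<in> {0..1} \<Longrightarrow> \<rho> (- b) (\<rho> b x) = x"
  using rho_add[of "- b" b x] rho_zero by (simp add: uminus_in)

lemma rho_uminus': "b \<in> H \<Longrightarrow> x \<in> {0..1} \<Longrightarrow> \<rho> b (\<rho> (- b) x) = x"
  using rho_uminus[of "- b" x] by (simp add: uminus_in)

lemma rho_endpoint: assumes "p = 0 \<or> p = 1" "b \<in> H" shows "\<rho> b p = p"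
  using rho_less_iff[of b "\<rho> (- b) 0" 0] rho_less_iff[of b 1 "\<rho> (- b) 1"] assms
    rho_in[of "- b" 0] rho_in[of "- b" 1] rho_uminus'[of b 0] rho_uminus'[of b 1]
    rho_in[of b 0] rho_in[of b 1] uminus_in[of b] by auto

text \<open>Moving \<open>b\<close> past one application of \<open>f\<close> replaces it by
  \<open>\<beta> b\<close>, so displacements at \<open>(f ^^ n) x\<close> reduce to displacements at
  \<open>x\<close>.\<close>

lemma rho_f_pow: "b \<in> H \<Longrightarrow> x \<in> {0..1} \<Longrightarrow> \<rho> b ((f ^^ n) x) = (f ^^ n) (\<rho> ((\<beta> ^^ n) b) x)"
proof (induction n arbitrary: b)
  case (Suc n)
  then have "\<rho> b ((f ^^ Suc n) x) = \<rho> (\<alpha> (\<beta> b)) (f ((f ^^ n) x))"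
    by (simp add: alpha_beta)
  also have "\<dots> = f (\<rho> (\<beta> b) ((f ^^ n) x))"
    using Suc by (intro f_rho[symmetric] f_pow_in beta_in)
  also have "\<dots> = f ((f ^^ n) (\<rho> ((\<beta> ^^ n) (\<beta> b)) x))"
    using Suc by (simp add: beta_in)
  finally show ?case by (simp add: funpow_swap1)
qed simp

lemma additive_on_beta_pow:
  assumes "additive_on H l" shows "additive_on H (\<lambda>b. l ((\<beta> ^^ n) b))"
proof -
  have "(\<beta> ^^ n) (b + c) = (\<beta> ^^ n) b + (\<beta> ^^ n) c" if "b \<in> H" "c \<in> H" for b c
    by (induction n) (use that in \<open>auto simp: beta_add beta_pow_in\<close>)
  then show ?thesis using assms unfolding additive_on_def by (auto simp: beta_pow_in)
qed

lemma f_derivative_at_endpoint: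
  assumes p: "p = 0 \<or> p = 1"
  obtains k where "k > 0" "(f has_real_derivative k) (at p within {0..1})"
proof -
  have p': "p \<in> {0..1}" using p by auto
  obtain k where k: "(f has_real_derivative k) (at p within {0..1})"
    using derivative_at_endpoint[OF f_C1 p] .
  obtain m where m: "(g has_real_derivative m) (at p within {0..1})"
    using derivative_at_endpoint[OF g_C1 p] .
  have "1 = m * k"
    by (rule derivative_comp_unique[OF m k f_endpoint[OF p] _ _ DERIV_ident p'])
      (auto simp: g_f simp del: atLeastAtMost_iff)
  moreover have "k \<ge> 0" by (rule derivative_nonneg_of_strict_mono[OF k f_mono p'])
  ultimately have "k > 0" by (cases "k = 0") auto
  then show thesis using k that by blast
qed

text \<open>The logarithm of the derivative at an end point is an \<open>\<alpha>\<close>-invariant functional, hence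
  zero by hyperbolicity.\<close>

lemma rho_derivative_at_endpoint:
  assumes p: "p = 0 \<or> p = 1" and b: "b \<in> H"
  shows "(\<rho> b has_real_derivative 1) (at p within {0..1})"
proof -
  have p': "p \<in> {0..1}" using p by auto
  have "\<forall>b\<in>H. \<exists>k. (\<rho> b has_real_derivative k) (at p within {0..1})"
    using derivative_at_endpoint[OF rho_C1 p] by metis
  then obtain D where D: "\<And>b. b \<in> H \<Longrightarrow> (\<rho> b has_real_derivative D b) (at p within {0..1})"
    by metis
  obtain k where k: "k > 0" "(f has_real_derivative k) (at p within {0..1})"
    using f_derivative_at_endpoint[OF p] .
  have mult: "D (b + c) = D b * D c" if "b \<in> H" "c \<in> H" for b c
    by (rule derivative_comp_unique[OF D D rho_endpoint[OF p] _ _ D p']) 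
      (use that in \<open>auto simp: rho_add simp del: atLeastAtMost_iff\<close>)
  have D0: "D 0 = 1"
    by (rule derivative_comp_unique[OF DERIV_ident DERIV_ident refl _ _ D p', simplified]) (auto simp: rho_zero)
  have nz: "D b > 0" if "b \<in> H" for b
  proof -
    have "D b * D (- b) = 1" using mult[of b "- b"] that D0 by auto
    moreover have "D b \<ge> 0" by (rule derivative_nonneg_of_strict_mono[OF D rho_mono p']) fact+
    ultimately show ?thesis by (cases "D b = 0") auto
  qed
  \<comment> \<open>Differentiate the relation \<open>f_rho\<close> at \<open>p\<close> and cancel
    the positive factor \<open>k\<close>.\<close>
  have alpha: "D (\<alpha> b) = D b" if b: "b \<in> H" for b
  proof -
    have "((\<lambda>x. f (\<rho> b x)) has_real_derivative k * D b) (at p within {0..1})"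
      by (rule has_derivative_comp_Icc[OF k(2) D[OF b] rho_endpoint[OF p b] rho_in[OF b]])
    then have "k * D b = D (\<alpha> b) * k"
      by (intro derivative_comp_unique[OF D k(2) f_endpoint[OF p] _ _ _ p'])
        (use b in \<open>auto simp: f_rho simp del: atLeastAtMost_iff\<close>)
    then show ?thesis using k(1) by simp
  qed
  have alphan: "D ((\<alpha> ^^ n) b) = D b" for n
    by (induction n) (use b in \<open>auto simp: alpha alpha_pow_in\<close>)
  have beta: "D (\<beta> b) = D b" if "b \<in> H" for b
    using alpha[of "\<beta> b"] alpha_beta that by (simp add: beta_in)
  have betan: "D ((\<beta> ^^ n) b) = D b" for n
    by (induction n) (use b in \<open>auto simp: beta beta_pow_in\<close>)
  have "ln (D b) = 0"
  proof (rule hyperbolic[of "\<lambda>b. ln (D b)" b])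
    show "additive_on H (\<lambda>b. ln (D b))"
      unfolding additive_on_def using mult nz by (simp add: ln_mult_pos)
    have *: "\<bar>ln (D b)\<bar> \<le> \<bar>ln (D b)\<bar> * \<mu> ^ n" if "\<mu> > 1" for \<mu> :: real and n
    proof -
      have "\<bar>ln (D b)\<bar> * 1 \<le> \<bar>ln (D b)\<bar> * \<mu> ^ n"
        using that by (intro mult_left_mono one_le_power) auto
      then show ?thesis by simp
    qed
    show "\<exists>C. \<forall>n. \<bar>ln (D ((\<alpha> ^^ n) b))\<bar> \<le> C * \<mu> ^ n" if "\<mu> > 1" for \<mu>
      unfolding alphan using *[OF that] by blast
    show "\<exists>C. \<forall>n. \<bar>ln (D ((\<beta> ^^ n) b))\<bar> \<le> C * \<mu> ^ n" if "\<mu> > 1" for \<mu>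
      unfolding betan using *[OF that] by blast
  qed (rule b)
  then have "D b = 1" using nz[OF b] by simp
  then show ?thesis using D[OF b] by simp
qed

lemma rho_strict_deriv: "p = 0 \<or> p = 1 \<Longrightarrow> b \<in> H \<Longrightarrow> strict_deriv (\<rho> b) p 1"
  using C1_within_strict_deriv[OF rho_C1 _ rho_derivative_at_endpoint] by auto


end

section \<open>Displacements along an orbit converging to an end point\<close>

text \<open>The induction step, upwards here and downwards in the next lemma, of an estimate for
  displacements of multiples; the error is split into halves.\<close>

lemma abs_add_halves:
  fixes x a d e i t :: real
  assumes "\<bar>x - a - d\<bar> \<le> e / 2 * t" "\<bar>a - i * d\<bar> \<le> e / 2 * t"
  shows "\<bar>x - (i + 1) * d\<bar> \<le> e * t"
proof -
  have "\<bar>x - (i + 1) * d\<bar> \<le> \<bar>x - a - d\<bar> + \<bar>a - i * d\<bar>"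
    using abs_triangle_ineq[of "x - a - d" "a - i * d"] by (simp add: algebra_simps)
  also have "\<dots> \<le> e / 2 * t + e / 2 * t" using assms by (rule add_mono)
  finally show ?thesis by simp
qed

lemma abs_diff_halves:
  fixes x a d e i t :: real
  assumes "\<bar>a - x - d\<bar> \<le> e / 2 * t" "\<bar>a - i * d\<bar> \<le> e / 2 * t"
  shows "\<bar>x - (i - 1) * d\<bar> \<le> e * t"
proof -
  have "\<bar>x - (i - 1) * d\<bar> \<le> \<bar>a - x - d\<bar> + \<bar>a - i * d\<bar>"
    using abs_triangle_ineq4[of "a - i * d" "a - x - d"] by (simp add: algebra_simps)
  also have "\<dots> \<le> e / 2 * t + e / 2 * t" using assms by (rule add_mono)
  finally show ?thesis by simp
qed

text \<open>The functional determines the direction in which \<open>x\<close> moves wherever it is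
  nonzero; nothing is assumed on its kernel.\<close>

locale approaching_orbit = hyperbolic_action H S \<alpha> \<beta> \<rho> f g
  for H S :: "'h::comm_ring_1 set" and \<alpha> \<beta> \<rho> f g +
  fixes x p :: real and l :: "'h \<Rightarrow> real"
  assumes x_in: "x \<in> {0..1}" and endpoint: "p = 0 \<or> p = 1"
    and orbit_tendsto: "(\<lambda>n. (f ^^ n) x) \<longlonglongrightarrow> p"
    and l_additive: "additive_on H l"
    and l_pos: "\<And>b. b \<in> H \<Longrightarrow> l b > 0 \<Longrightarrow> \<rho> b x > x"
    and l_nonzero: "\<exists>b\<in>H. l b \<noteq> 0"
begin

definition orb :: "nat \<Rightarrow> real" where "orb n = (f ^^ n) x"
text \<open>The functional governing displacements at \<open>orb n\<close>, where \<open>b\<close>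
  acts as \<open>(\<beta> ^^ n) b\<close> does at \<open>x\<close>.\<close>

definition lf :: "nat \<Rightarrow> 'h \<Rightarrow> real" where "lf n b = l ((\<beta> ^^ n) b)"
definition disp :: "nat \<Rightarrow> 'h \<Rightarrow> real" where "disp n b = \<rho> b (orb n) - orb n"
text \<open>Closed under negation, so that the largest absolute value of a functional on
  \<open>S\<close> is attained as a value.\<close>

definition gens :: "'h set" where "gens = S \<union> uminus ` S"
text \<open>The norm of \<open>lf n\<close>, measured on \<open>S\<close>.\<close>

definition mx :: "nat \<Rightarrow> real" where "mx n = Max ((\<lambda>s. \<bar>lf n s\<bar>) ` S)"

lemma p_in: "p \<in> {0..1}"
  using endpoint by auto

lemma orb_in: "orb n \<in> {0..1}"
  unfolding orb_def by (intro f_pow_in x_in)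

lemma orb_lim: "orb \<longlonglongrightarrow> p"
  using orbit_tendsto unfolding orb_def .

lemma lf_additive: "additive_on H (lf n)"
  unfolding lf_def by (intro additive_on_beta_pow l_additive)

lemma lf_Suc: "lf (Suc n) b = lf n (\<beta> b)"
  by (simp add: lf_def funpow_swap1)

lemma lf_alpha: "b \<in> H \<Longrightarrow> lf (Suc n) (\<alpha> b) = lf n b"
  by (simp add: lf_Suc beta_alpha)

lemma disp_eq: "b \<in> H \<Longrightarrow> disp n b = (f ^^ n) (\<rho> ((\<beta> ^^ n) b) x) - (f ^^ n) x"
  unfolding disp_def orb_def by (simp add: rho_f_pow x_in del: atLeastAtMost_iff)

lemma disp_pos: "b \<in> H \<Longrightarrow> lf n b > 0 \<Longrightarrow> disp n b > 0"
  using l_pos[of "(\<beta> ^^ n) b"]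
  by (simp add: disp_eq lf_def f_pow_less_iff x_in rho_in beta_pow_in del: atLeastAtMost_iff)

text \<open>Writing \<open>b = c + (b - c)\<close>, the element \<open>b - c\<close> moves
  \<open>orb n\<close> to the right, and \<open>\<rho> c\<close> preserves the order.\<close>

lemma disp_less:
  assumes "b \<in> H" "c \<in> H" "lf n c < lf n b"
  shows "disp n c < disp n b"
proof -
  have "lf n (b - c) > 0" using assms additive_diff[OF lf_additive] by simp
  then have "orb n < \<rho> (b - c) (orb n)"
    using disp_pos[of "b - c" n] assms by (simp add: disp_def diff_in)
  then have "\<rho> c (orb n) < \<rho> c (\<rho> (b - c) (orb n))"
    using assms orb_in by (subst rho_less_iff) (auto simp del: atLeastAtMost_iff)
  also have "\<dots> = \<rho> b (orb n)"
    using rho_add[of c "b - c" "orb n"] assms orb_in by (simp add: diff_in)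
  finally show ?thesis by (simp add: disp_def)
qed

lemma S_nonempty: "S \<noteq> {}"
  using functional_eq_0[OF l_additive] l_nonzero by blast

lemma lf_le_mx: "s \<in> S \<Longrightarrow> \<bar>lf n s\<bar> \<le> mx n"
  unfolding mx_def using finite_S by (intro Max_ge) auto

lemma mx_nonneg: "mx n \<ge> 0"
  using S_nonempty lf_le_mx[of _ n] by (meson abs_ge_zero all_not_in_conv order_trans)

lemma lf_nonzero: "\<exists>b\<in>H. lf n b \<noteq> 0"
proof (induction n)
  case 0
  then show ?case using l_nonzero by (simp add: lf_def)
next
  case (Suc n)
  then show ?case using lf_alpha alpha_in by metis
qed

lemma mx_pos: "mx n > 0"
proof (rule ccontr)
  assume "\<not> mx n > 0"
  then have "mx n = 0" using mx_nonneg[of n] by simp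
  then have "lf n s = 0" if "s \<in> S" for s using lf_le_mx[OF that, of n] by simp
  then show False using functional_eq_0[OF lf_additive] lf_nonzero by blast
qed

lemma gens_sub: "gens \<subseteq> H"
  using S_sub unfolding gens_def by auto

lemma finite_gens: "finite gens"
  using finite_S unfolding gens_def by simp

lemma ex_maximal: "\<exists>e\<in>gens. lf n e = mx n"
proof -
  have "mx n \<in> (\<lambda>s. \<bar>lf n s\<bar>) ` S"
    unfolding mx_def using finite_S S_nonempty by (intro Max_in) auto
  then obtain s where s: "s \<in> S" "mx n = \<bar>lf n s\<bar>" by auto
  then have "lf n (- s) = - lf n s" using additive_uminus[OF lf_additive] S_sub by blast
  then show ?thesis using s unfolding gens_def by (cases "lf n s \<ge> 0") auto
qed

text \<open>A signed generator realizing the norm. It may vary with \<open>n\<close>, but stays in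
  the finite set \<open>gens\<close>.\<close>

definition lead :: "nat \<Rightarrow> 'h" where "lead n = (SOME e. e \<in> gens \<and> lf n e = mx n)"

lemma lead: "lead n \<in> gens" "lf n (lead n) = mx n"
  using someI_ex[of "\<lambda>e. e \<in> gens \<and> lf n e = mx n"] ex_maximal[of n] unfolding lead_def by auto

lemma lead_in: "lead n \<in> H"
  using lead gens_sub by blast

text \<open>The unit of length at time \<open>n\<close>. It need not be the largest displacement of
  a generator if several of them realize \<open>mx n\<close>.\<close>

definition mxdisp :: "nat \<Rightarrow> real" where "mxdisp n = disp n (lead n)"

lemma mxdisp_pos: "mxdisp n > 0"
  unfolding mxdisp_def using lead_in lead(2) mx_pos by (intro disp_pos) auto

lemma lf_bound:
  assumes "b \<in> H"
  obtains C where "C \<ge> 0" "\<And>n. \<bar>lf n b\<bar> \<le> C * mx n"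
  using functional_bound[OF assms] lf_additive lf_le_mx mx_nonneg by meson

lemma rho_orb_lim: "b \<in> H \<Longrightarrow> (\<lambda>n. \<rho> b (orb n)) \<longlonglongrightarrow> p"
  using C1_within_tendsto[OF rho_C1 orb_lim orb_in p_in] rho_endpoint[OF endpoint] by simp

text \<open>As \<open>\<rho> c\<close> has strict derivative 1 at \<open>p\<close>, it preserves the
  distance between \<open>orb n\<close> and its image under \<open>b\<close> up to a small relative
  error.\<close>

lemma disp_plus:
  assumes "b \<in> H" "c \<in> H" "\<epsilon> > 0"
  shows "\<forall>\<^sub>F n in sequentially. \<bar>disp n (c + b) - disp n c - disp n b\<bar> \<le> \<epsilon> * \<bar>disp n b\<bar>"
proof -
  have "\<forall>\<^sub>F n in sequentially. \<bar>\<rho> c (\<rho> b (orb n)) - \<rho> c (orb n) - 1 * (\<rho> b (orb n) - orb n)\<bar>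
      \<le> \<epsilon> * \<bar>\<rho> b (orb n) - orb n\<bar>"
    by (rule strict_deriv_sequentially[OF rho_strict_deriv[OF endpoint assms(2)] rho_orb_lim[OF assms(1)] orb_lim])
      (use assms orb_in in \<open>auto simp del: atLeastAtMost_iff\<close>)
  moreover have "disp n (c + b) - disp n c - disp n b
      = \<rho> c (\<rho> b (orb n)) - \<rho> c (orb n) - 1 * (\<rho> b (orb n) - orb n)" for n
    unfolding disp_def using rho_add[OF assms(2,1) orb_in[of n]] by simp
  ultimately show ?thesis by (simp add: disp_def)
qed

lemma disp_of_int_mult:
  assumes b: "b \<in> H" and "\<epsilon> > 0"
  shows "\<forall>\<^sub>F n in sequentially. \<bar>disp n (of_int k * b) - of_int k * disp n b\<bar> \<le> \<epsilon> * \<bar>disp n b\<bar>"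
  using \<open>\<epsilon> > 0\<close>
proof (induction k arbitrary: \<epsilon> rule: int_induct[where k = 0])
  case base
  then show ?case using orb_in by (simp add: disp_def rho_zero del: atLeastAtMost_iff)
next
  case (step1 i)
  have "\<forall>\<^sub>F n in sequentially. \<bar>disp n (of_int i * b + b) - disp n (of_int i * b) - disp n b\<bar> \<le> \<epsilon> / 2 * \<bar>disp n b\<bar>"
    by (rule disp_plus) (use b step1 in auto)
  moreover have "\<forall>\<^sub>F n in sequentially. \<bar>disp n (of_int i * b) - of_int i * disp n b\<bar> \<le> \<epsilon> / 2 * \<bar>disp n b\<bar>"
    by (rule step1.IH) (use step1 in simp)
  ultimately show ?case
  proof eventually_elim
    case (elim n)
    have "of_int i * b + b = of_int (i + 1) * b" by (simp add: algebra_simps)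
    with elim have "\<bar>disp n (of_int (i + 1) * b) - disp n (of_int i * b) - disp n b\<bar> \<le> \<epsilon> / 2 * \<bar>disp n b\<bar>"
      by simp
    then show ?case using abs_add_halves[OF _ elim(2)] by simp
  qed
next
  case (step2 i)
  have "\<forall>\<^sub>F n in sequentially. \<bar>disp n (of_int (i - 1) * b + b) - disp n (of_int (i - 1) * b) - disp n b\<bar>
      \<le> \<epsilon> / 2 * \<bar>disp n b\<bar>"
    by (rule disp_plus) (use b step2 in \<open>auto simp del: of_int_diff\<close>)
  moreover have "\<forall>\<^sub>F n in sequentially. \<bar>disp n (of_int i * b) - of_int i * disp n b\<bar> \<le> \<epsilon> / 2 * \<bar>disp n b\<bar>"
    by (rule step2.IH) (use step2 in simp)
  ultimately show ?case
  proof eventually_elim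
    case (elim n)
    have "of_int (i - 1) * b + b = of_int i * b" by (simp add: algebra_simps)
    with elim have "\<bar>disp n (of_int i * b) - disp n (of_int (i - 1) * b) - disp n b\<bar> \<le> \<epsilon> / 2 * \<bar>disp n b\<bar>"
      by simp
    then show ?case using abs_diff_halves[OF _ elim(2)] by simp
  qed
qed

text \<open>Compare the displacements of \<open>of_int Q * b\<close> and of multiples of \<open>lead n\<close>, whose signs
  are governed by the functional.\<close>

lemma disp_asymptotics:
  assumes b: "b \<in> H"
  shows "(\<lambda>n. disp n b / mxdisp n - lf n b / mx n) \<longlonglongrightarrow> 0"
proof -
  obtain C where C: "C \<ge> 0" "\<And>n. \<bar>lf n b\<bar> \<le> C * mx n" using lf_bound[OF b] by blast
  have main: "\<forall>\<^sub>F n in sequentially. \<bar>disp n b / mxdisp n - lf n b / mx n\<bar> \<le> (2 * C + 4) / real_of_int Q"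
    if Q: "Q \<ge> 2" for Q :: int
  proof -
    \<comment> \<open>Bounds the integers \<open>k1\<close> and \<open>k2\<close> below for all
      \<open>n\<close>, so that finitely many eventual estimates suffice.\<close>
    define M where "M = \<lceil>Q * C\<rceil> + 1"
    have "\<forall>\<^sub>F n in sequentially. \<forall>t\<in>gens. \<forall>k\<in>{-M..M}. \<bar>disp n (of_int k * t) - of_int k * disp n t\<bar> \<le> 1 * \<bar>disp n t\<bar>"
      using finite_gens gens_sub by (intro eventually_ball_finite ballI disp_of_int_mult) auto
    moreover have "\<forall>\<^sub>F n in sequentially. \<bar>disp n (of_int Q * b) - of_int Q * disp n b\<bar> \<le> 1 * \<bar>disp n b\<bar>"
      by (intro disp_of_int_mult b) simp
    ultimately show ?thesis
    proof eventually_elim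
      case (elim n)
      define r where "r = lf n b / mx n"
      define \<delta> where "\<delta> = disp n b / mxdisp n"
      have r: "lf n b = r * mx n" using mx_pos[of n] by (simp add: r_def)
      have \<delta>: "disp n b = \<delta> * mxdisp n" using mxdisp_pos[of n] by (simp add: \<delta>_def)
      have r_le: "\<bar>r\<bar> \<le> C" using C(2)[of n] mx_pos[of n] by (simp add: r_def abs_mult pos_divide_le_eq)
      have Qr: "\<bar>Q * r\<bar> \<le> Q * C" using r_le Q by (simp add: abs_mult mult_left_mono)
      have bound: "\<bar>disp n (of_int k * lead n) - k * mxdisp n\<bar> \<le> mxdisp n" if "k \<in> {-M..M}" for k
        using elim(1) lead(1)[of n] that mxdisp_pos[of n] unfolding mxdisp_def by fastforce
      have lfk: "lf n (of_int k * lead n) = k * mx n" for k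
        using additive_of_int_mult[OF lf_additive lead_in] lead(2) by simp
      have lfQ: "lf n (of_int Q * b) = Q * r * mx n"
        using additive_of_int_mult[OF lf_additive b] r by simp
      \<comment> \<open>The multiples \<open>k1\<close> and \<open>k2\<close> of
        \<open>lead n\<close> enclose \<open>of_int Q * b\<close> strictly as measured by
        \<open>lf n\<close>, so \<open>disp_less\<close> orders the displacements in the same
        way.\<close>
      define k1 where "k1 = \<lceil>Q * r\<rceil> - 1"
      define k2 where "k2 = \<lfloor>Q * r\<rfloor> + 1"
      have k: "k1 < Q * r" "Q * r < k2" "k1 \<ge> Q * r - 1" "k2 \<le> Q * r + 1"
        unfolding k1_def k2_def by linarith+
      have kM: "k1 \<in> {-M..M}" "k2 \<in> {-M..M}"
        using Qr unfolding k1_def k2_def M_def by (auto; linarith)+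
      have lo: "disp n (of_int k1 * lead n) < disp n (of_int Q * b)"
        using k(1) mx_pos[of n] by (intro disp_less of_int_mult_in b lead_in) (simp add: lfk lfQ)
      have hi: "disp n (of_int Q * b) < disp n (of_int k2 * lead n)"
        using k(2) mx_pos[of n] by (intro disp_less of_int_mult_in b lead_in) (simp add: lfk lfQ)
      have dQ: "\<bar>disp n (of_int Q * b) - Q * \<delta> * mxdisp n\<bar> \<le> \<bar>\<delta>\<bar> * mxdisp n"
        using elim(2) mxdisp_pos[of n] unfolding \<delta> by (simp add: abs_mult mult.assoc)
      have "k1 * mxdisp n - mxdisp n < Q * \<delta> * mxdisp n + \<bar>\<delta>\<bar> * mxdisp n"
        using bound[OF kM(1)] lo dQ by linarith
      then have "(k1 - 1) * mxdisp n < (Q * \<delta> + \<bar>\<delta>\<bar>) * mxdisp n" by (simp add: algebra_simps)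
      then have 1: "k1 - 1 < Q * \<delta> + \<bar>\<delta>\<bar>" using mxdisp_pos[of n] by simp
      have "k2 * mxdisp n + mxdisp n > Q * \<delta> * mxdisp n - \<bar>\<delta>\<bar> * mxdisp n"
        using bound[OF kM(2)] hi dQ by linarith
      then have "(Q * \<delta> - \<bar>\<delta>\<bar>) * mxdisp n < (k2 + 1) * mxdisp n" by (simp add: algebra_simps)
      then have 2: "Q * \<delta> - \<bar>\<delta>\<bar> < k2 + 1" using mxdisp_pos[of n] by simp
      have "\<bar>Q * (\<delta> - r)\<bar> \<le> 2 + \<bar>\<delta>\<bar>" using 1 2 k by (simp add: algebra_simps abs_le_iff)
      then have Qd: "Q * \<bar>\<delta> - r\<bar> \<le> 2 + \<bar>\<delta>\<bar>" using Q by (simp add: abs_mult)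
      \<comment> \<open>With \<open>Q \<ge> 2\<close> the term \<open>\<bar>\<delta>\<bar>\<close>
        on the right can be absorbed, which bounds it independently of \<open>n\<close> and
        \<open>Q\<close>.\<close>
      have "2 * \<bar>\<delta> - r\<bar> \<le> Q * \<bar>\<delta> - r\<bar>" using Q by (intro mult_right_mono) auto
      then have "2 * \<bar>\<delta> - r\<bar> \<le> 2 + \<bar>\<delta>\<bar>" using Qd by (rule order_trans)
      moreover have "\<bar>\<delta>\<bar> \<le> \<bar>r\<bar> + \<bar>\<delta> - r\<bar>" using abs_triangle_ineq[of r "\<delta> - r"] by simp
      ultimately have "2 + \<bar>\<delta>\<bar> \<le> 2 * C + 4" using r_le by simp
      with Qd have "Q * \<bar>\<delta> - r\<bar> \<le> 2 * C + 4" by (rule order_trans)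
      then show ?case using Q unfolding r_def[symmetric] \<delta>_def[symmetric]
        by (simp add: pos_le_divide_eq mult.commute)
    qed
  qed
  show ?thesis
  proof (rule tendstoI)
    fix e :: real assume "e > 0"
    obtain Q :: int where Q: "Q > (2 * C + 4) / e" "Q \<ge> 2"
    proof (rule that)
      show "real_of_int (max 2 (\<lfloor>(2 * C + 4) / e\<rfloor> + 1)) > (2 * C + 4) / e" by linarith
    qed simp
    have "(2 * C + 4) / real_of_int Q < e"
      using Q \<open>e > 0\<close> by (simp add: field_simps)
    with main[OF Q(2)] show "\<forall>\<^sub>F n in sequentially. dist (disp n b / mxdisp n - lf n b / mx n) 0 < e"
      by (auto elim!: eventually_mono)
  qed
qed

lemma disp_ratio_bounded:
  assumes b: "b \<in> H"
  obtains C where "\<forall>\<^sub>F n in sequentially. \<bar>disp n b / mxdisp n\<bar> \<le> C"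
proof -
  obtain C where C: "C \<ge> 0" "\<And>n. \<bar>lf n b\<bar> \<le> C * mx n" using lf_bound[OF b] by blast
  have "\<forall>\<^sub>F n in sequentially. \<bar>disp n b / mxdisp n\<bar> \<le> C + 1"
    using tendstoD[OF disp_asymptotics[OF b], of 1, simplified]
  proof eventually_elim
    case (elim n)
    moreover have "\<bar>lf n b / mx n\<bar> \<le> C" using C(2)[of n] mx_pos[of n] by (simp add: pos_divide_le_eq)
    ultimately show ?case by linarith
  qed
  then show thesis using that by blast
qed

text \<open>The norm \<open>mx n\<close> is the value of \<open>lf (Suc n)\<close> at
  \<open>\<alpha> (lead n)\<close>, and only finitely many elements occur here. The bound keeps
  errors small when they are divided by \<open>mx (Suc n) / mx n\<close>.\<close>

lemma mx_quotient_bounded: obtains C where "C > 0" "\<And>n. mx n \<le> C * mx (Suc n)"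
proof -
  have "\<forall>t\<in>gens. \<exists>C\<ge>0. \<forall>n. \<bar>lf n (\<alpha> t)\<bar> \<le> C * mx n"
    using lf_bound gens_sub alpha_in by (metis subsetD)
  then obtain C where C: "\<And>t. t \<in> gens \<Longrightarrow> C t \<ge> 0" "\<And>t n. t \<in> gens \<Longrightarrow> \<bar>lf n (\<alpha> t)\<bar> \<le> C t * mx n"
    by metis
  show thesis
  proof
    show "0 < (\<Sum>t\<in>gens. C t) + 1" using C(1) by (simp add: sum_nonneg add_nonneg_pos)
    fix n
    have "mx n = lf (Suc n) (\<alpha> (lead n))" using lf_alpha[OF lead_in] lead(2) by simp
    also have "\<dots> \<le> C (lead n) * mx (Suc n)" using C(2)[OF lead(1)] by (simp add: abs_le_iff)
    also have "\<dots> \<le> ((\<Sum>t\<in>gens. C t) + 1) * mx (Suc n)"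
    proof (intro mult_right_mono mx_nonneg)
      have "C (lead n) \<le> (\<Sum>t\<in>gens. C t)" by (rule member_le_sum) (use C(1) lead finite_gens in auto)
      then show "C (lead n) \<le> (\<Sum>t\<in>gens. C t) + 1" by simp
    qed
    finally show "mx n \<le> ((\<Sum>t\<in>gens. C t) + 1) * mx (Suc n)" .
  qed
qed

lemma f_strict_deriv: obtains k where "k > 0" "strict_deriv f p k"
  using f_derivative_at_endpoint[OF endpoint] C1_within_strict_deriv[OF f_C1 p_in] by metis

text \<open>Under \<open>f\<close> the displacement of \<open>\<beta> (lead (Suc n))\<close> at
  \<open>orb n\<close> becomes \<open>mxdisp (Suc n)\<close>, asymptotically scaled by
  \<open>k\<close>; relative to \<open>mxdisp n\<close> it is close to
  \<open>mx (Suc n) / mx n\<close>.\<close>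

lemma mxdisp_mx_ratio:
  assumes k: "strict_deriv f p k"
  shows "(\<lambda>n. (mxdisp (Suc n) / mxdisp n) / (mx (Suc n) / mx n)) \<longlonglongrightarrow> k"
proof -
  \<comment> \<open>Error of the asymptotic formula for the finitely many elements
    \<open>\<beta> t\<close>.\<close>
  define F where "F t n = disp n (\<beta> t) / mxdisp n - lf n (\<beta> t) / mx n" for t n
  have "(\<lambda>n. F (lead (Suc n)) n) \<longlonglongrightarrow> 0"
    by (rule tendsto_0_finite_choice[OF finite_gens])
      (use disp_asymptotics gens_sub lead in \<open>auto simp: F_def\<close>)
  moreover have "F (lead (Suc n)) n = disp n (\<beta> (lead (Suc n))) / mxdisp n - mx (Suc n) / mx n" for n
    using lead(2)[of "Suc n"] by (simp add: F_def lf_Suc)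
  ultimately have X: "(\<lambda>n. disp n (\<beta> (lead (Suc n))) / mxdisp n - mx (Suc n) / mx n) \<longlonglongrightarrow> 0"
    by simp
  \<comment> \<open>Error of linearizing \<open>f\<close>, relative to
    \<open>mxdisp n\<close>.\<close>
  define G where "G t n = (f (\<rho> (\<beta> t) (orb n)) - f (orb n) - k * disp n (\<beta> t)) / mxdisp n" for t n
  have "G t \<longlonglongrightarrow> 0" if t: "t \<in> gens" for t
  proof -
    have bt: "\<beta> t \<in> H" using t gens_sub by auto
    obtain C where C: "\<forall>\<^sub>F n in sequentially. \<bar>disp n (\<beta> t) / mxdisp n\<bar> \<le> C"
      using disp_ratio_bounded[OF bt] by blast
    show ?thesis
    proof (rule tendsto_0_of_le_bounded[OF _ C])
      fix \<epsilon> :: real assume "\<epsilon> > 0"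
      have "\<forall>\<^sub>F n in sequentially. \<bar>f (\<rho> (\<beta> t) (orb n)) - f (orb n) - k * (\<rho> (\<beta> t) (orb n) - orb n)\<bar>
          \<le> \<epsilon> * \<bar>\<rho> (\<beta> t) (orb n) - orb n\<bar>"
        by (rule strict_deriv_sequentially[OF k rho_orb_lim[OF bt] orb_lim])
          (use bt orb_in \<open>\<epsilon> > 0\<close> in \<open>auto simp del: atLeastAtMost_iff\<close>)
      then show "\<forall>\<^sub>F n in sequentially. \<bar>G t n\<bar> \<le> \<epsilon> * \<bar>disp n (\<beta> t) / mxdisp n\<bar>"
        by eventually_elim (use mxdisp_pos in \<open>auto simp: G_def disp_def divide_right_mono less_imp_le\<close>)
    qed
  qed
  then have "(\<lambda>n. G (lead (Suc n)) n) \<longlonglongrightarrow> 0"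
    by (rule tendsto_0_finite_choice[OF finite_gens]) (use lead in auto)
  moreover have "G (lead (Suc n)) n = (mxdisp (Suc n) - k * disp n (\<beta> (lead (Suc n)))) / mxdisp n" for n
  proof -
    have "f (\<rho> (\<beta> (lead (Suc n))) (orb n)) = \<rho> (lead (Suc n)) (f (orb n))"
      using f_rho[of "\<beta> (lead (Suc n))" "orb n"] orb_in lead_in by (simp add: alpha_beta beta_in)
    then show ?thesis by (simp add: G_def mxdisp_def disp_def[of "Suc n"] orb_def)
  qed
  ultimately have Y: "(\<lambda>n. (mxdisp (Suc n) - k * disp n (\<beta> (lead (Suc n)))) / mxdisp n) \<longlonglongrightarrow> 0"
    by simp
  have "(\<lambda>n. mxdisp (Suc n) / mxdisp n - k * (mx (Suc n) / mx n)) \<longlonglongrightarrow> 0 + k * 0"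
    using tendsto_add[OF Y tendsto_mult[OF tendsto_const[of k] X]]
    by (simp add: algebra_simps diff_divide_distrib)
  then have Z: "(\<lambda>n. mxdisp (Suc n) / mxdisp n - k * (mx (Suc n) / mx n)) \<longlonglongrightarrow> 0" by simp
  \<comment> \<open>Passing from the difference to the quotient costs at most the factor
    \<open>C\<close>.\<close>
  obtain C where C: "C > 0" "\<And>n. mx n \<le> C * mx (Suc n)" using mx_quotient_bounded by blast
  have "(\<lambda>n. (mxdisp (Suc n) / mxdisp n) / (mx (Suc n) / mx n) - k) \<longlonglongrightarrow> 0"
  proof (rule Lim_null_comparison)
    show "(\<lambda>n. C * \<bar>mxdisp (Suc n) / mxdisp n - k * (mx (Suc n) / mx n)\<bar>) \<longlonglongrightarrow> 0"
      using tendsto_mult[OF tendsto_const[of C] tendsto_rabs[OF Z]] by simp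
    show "\<forall>\<^sub>F n in sequentially. norm ((mxdisp (Suc n) / mxdisp n) / (mx (Suc n) / mx n) - k)
        \<le> C * \<bar>mxdisp (Suc n) / mxdisp n - k * (mx (Suc n) / mx n)\<bar>"
    proof (intro always_eventually allI)
      fix n
      define a where "a = mxdisp (Suc n) / mxdisp n"
      define q where "q = mx (Suc n) / mx n"
      have q: "q > 0" "1 \<le> C * q" using mx_pos C(2)[of n] by (auto simp: q_def pos_le_divide_eq)
      have "\<bar>a / q - k\<bar> = \<bar>a - k * q\<bar> / q"
        using q(1) by (simp add: field_simps abs_divide[symmetric])
      also have "\<dots> \<le> C * \<bar>a - k * q\<bar>"
        using q mult_right_mono[OF q(2), of "\<bar>a - k * q\<bar>"] by (simp add: pos_divide_le_eq mult_ac)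
      finally show "norm (mxdisp (Suc n) / mxdisp n / (mx (Suc n) / mx n) - k)
        \<le> C * \<bar>mxdisp (Suc n) / mxdisp n - k * (mx (Suc n) / mx n)\<bar>"
        unfolding a_def q_def by simp
    qed
  qed
  then show ?thesis by (rule LIM_zero_cancel)
qed

section \<open>Comparison of interval lengths with displacements\<close>

lemma interval_ratio:
  assumes uv: "u \<in> {0..1}" "v \<in> {0..1}" "u < v"
    and lim: "(\<lambda>n. (f ^^ n) u) \<longlonglongrightarrow> p" "(\<lambda>n. (f ^^ n) v) \<longlonglongrightarrow> p"
    and k: "strict_deriv f p k"
  shows "(\<lambda>n. ((f ^^ Suc n) v - (f ^^ Suc n) u) / ((f ^^ n) v - (f ^^ n) u)) \<longlonglongrightarrow> k"
proof -
  let ?I = "\<lambda>n. (f ^^ n) v - (f ^^ n) u"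
  have pos: "?I n > 0" for n using f_pow_less_iff[OF uv(1,2), of n] uv(3) by simp
  have "(\<lambda>n. ?I (Suc n) / ?I n - k) \<longlonglongrightarrow> 0"
  proof (rule tendsto_0_of_le_bounded)
    show "\<forall>\<^sub>F n in sequentially. \<bar>1 :: real\<bar> \<le> 1" by simp
    fix \<epsilon> :: real assume "\<epsilon> > 0"
    have "\<forall>\<^sub>F n in sequentially. \<bar>f ((f ^^ n) v) - f ((f ^^ n) u) - k * ?I n\<bar> \<le> \<epsilon> * \<bar>?I n\<bar>"
      by (rule strict_deriv_sequentially[OF k lim(2,1)])
        (use uv \<open>\<epsilon> > 0\<close> in \<open>auto simp del: atLeastAtMost_iff\<close>)
    then show "\<forall>\<^sub>F n in sequentially. \<bar>?I (Suc n) / ?I n - k\<bar> \<le> \<epsilon> * \<bar>1\<bar>"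
    proof eventually_elim
      case (elim n)
      have "?I (Suc n) / ?I n - k = (f ((f ^^ n) v) - f ((f ^^ n) u) - k * ?I n) / ?I n"
        using pos[of n] by (simp add: diff_divide_distrib)
      then have "\<bar>?I (Suc n) / ?I n - k\<bar> = \<bar>f ((f ^^ n) v) - f ((f ^^ n) u) - k * ?I n\<bar> / ?I n"
        using pos[of n] by (simp add: abs_divide)
      also have "\<dots> \<le> \<epsilon>" using elim pos[of n] by (simp add: pos_divide_le_eq)
      finally show ?case by simp
    qed
  qed
  then show ?thesis by (rule LIM_zero_cancel)
qed

text \<open>Lengths and normalized displacements \<open>mxdisp n / mx n\<close> are asymptotically
  scaled by the same factor \<open>k\<close>, which cancels in \<open>R\<close>.\<close>

lemma interval_mxdisp_ratio:
  assumes uv: "u \<in> {0..1}" "v \<in> {0..1}" "u < v"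
    and lim: "(\<lambda>n. (f ^^ n) u) \<longlonglongrightarrow> p" "(\<lambda>n. (f ^^ n) v) \<longlonglongrightarrow> p"
  defines "R \<equiv> \<lambda>n. ((f ^^ n) v - (f ^^ n) u) * mx n / mxdisp n"
  shows "R n > 0" "(\<lambda>n. R (Suc n) / R n) \<longlonglongrightarrow> 1"
proof -
  obtain k where k: "k > 0" "strict_deriv f p k" using f_strict_deriv .
  have pos: "(f ^^ n) v - (f ^^ n) u > 0" for n using f_pow_less_iff[OF uv(1,2), of n] uv(3) by simp
  then show "R n > 0" unfolding R_def using mx_pos mxdisp_pos by simp
  have "(\<lambda>n. (((f ^^ Suc n) v - (f ^^ Suc n) u) / ((f ^^ n) v - (f ^^ n) u)) /
      ((mxdisp (Suc n) / mxdisp n) / (mx (Suc n) / mx n))) \<longlonglongrightarrow> k / k"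
    using k(1) by (intro tendsto_divide interval_ratio mxdisp_mx_ratio k uv lim) auto
  then show "(\<lambda>n. R (Suc n) / R n) \<longlonglongrightarrow> 1"
    using k(1) unfolding R_def by (simp add: divide_simps mult_ac)
qed

text \<open>The \<open>H\<close>-orbit of \<open>x\<close> does not cross \<open>v\<close>, so
  \<open>mxdisp n\<close> is at most the length of the interval at time \<open>n\<close>. Hence
  \<open>mx n\<close> is bounded by the quotient, which grows subexponentially.\<close>

lemma functional_subexponential:
  assumes uv: "u \<in> {0..1}" "v \<in> {0..1}" "u < v"
    and lim: "(\<lambda>n. (f ^^ n) u) \<longlonglongrightarrow> p" "(\<lambda>n. (f ^^ n) v) \<longlonglongrightarrow> p"
    and inv: "u \<le> x" "\<And>b. b \<in> H \<Longrightarrow> \<rho> b x \<le> v"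
    and b: "b \<in> H" and \<mu>: "\<mu> > 1"
  shows "\<exists>C. \<forall>n. \<bar>l ((\<beta> ^^ n) b)\<bar> \<le> C * \<mu> ^ n"
proof -
  let ?R = "\<lambda>n. ((f ^^ n) v - (f ^^ n) u) * mx n / mxdisp n"
  obtain C where C: "\<And>n. ?R n \<le> C * \<mu> ^ n"
    using subexponential_of_ratio_tendsto_1[OF interval_mxdisp_ratio[OF uv lim] \<mu>] by blast
  have "mxdisp n \<le> (f ^^ n) v - (f ^^ n) u" for n
  proof -
    have "(f ^^ n) (\<rho> ((\<beta> ^^ n) (lead n)) x) \<le> (f ^^ n) v"
      using inv lead_in uv x_in by (subst f_pow_le_iff) (auto simp del: atLeastAtMost_iff)
    moreover have "(f ^^ n) u \<le> (f ^^ n) x"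
      using inv uv x_in by (subst f_pow_le_iff) (auto simp del: atLeastAtMost_iff)
    ultimately show ?thesis unfolding mxdisp_def by (simp add: disp_eq lead_in)
  qed
  then have "mx n \<le> ?R n" for n
    using mxdisp_pos[of n] mx_nonneg[of n] by (simp add: pos_le_divide_eq mult.commute mult_left_mono)
  then have mx: "mx n \<le> C * \<mu> ^ n" for n using C order_trans by blast
  obtain D where D: "D \<ge> 0" "\<And>n. \<bar>lf n b\<bar> \<le> D * mx n" using lf_bound[OF b] by blast
  have "\<bar>l ((\<beta> ^^ n) b)\<bar> \<le> (D * C) * \<mu> ^ n" for n
    using D(2)[of n] mult_left_mono[OF mx D(1), of n] unfolding lf_def by (simp add: mult.assoc)
  then show ?thesis by blast
qed

text \<open>The opposite inequality: positive elements jump over the interval, so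
  \<open>mxdisp n\<close> is at least its length, and the quotient is at most \<open>mx n\<close>,
  which decays like \<open>m ^ n\<close>. But a sequence with ratios tending to 1 cannot decay
  exponentially.\<close>

lemma no_wandering_interval:
  assumes v: "v \<in> {0..1}" "x < v" "(\<lambda>n. (f ^^ n) v) \<longlonglongrightarrow> p"
    and jump: "\<And>b. b \<in> H \<Longrightarrow> l b > 0 \<Longrightarrow> \<rho> b x \<ge> v"
    and contr: "\<And>b. b \<in> H \<Longrightarrow> l (\<beta> b) = m * l b" "0 < m" "m < 1"
  shows False
proof -
  let ?R = "\<lambda>n. ((f ^^ n) v - (f ^^ n) x) * mx n / mxdisp n"
  have R: "?R n > 0" "(\<lambda>n. ?R (Suc n) / ?R n) \<longlonglongrightarrow> 1" for n
    using interval_mxdisp_ratio[OF x_in v(1,2) orbit_tendsto v(3)] by auto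
  \<comment> \<open>Passing to inverses turns an upper growth bound into a lower bound for
    \<open>?R\<close>.\<close>
  have "(\<lambda>n. inverse (?R (Suc n) / ?R n)) \<longlonglongrightarrow> inverse 1"
    by (intro tendsto_inverse R) simp
  then have lim: "(\<lambda>n. inverse (?R (Suc n)) / inverse (?R n)) \<longlonglongrightarrow> 1"
    by (simp add: divide_simps)
  obtain \<mu> where \<mu>: "1 < \<mu>" "\<mu> < 1 / m" using contr dense[of 1 "1 / m"] by auto
  have Rinv: "inverse (?R n) > 0" for n using R(1)[of n] by (rule positive_imp_inverse_positive)
  obtain C where C: "\<And>n. inverse (?R n) \<le> C * \<mu> ^ n"
    using subexponential_of_ratio_tendsto_1[OF Rinv lim \<mu>(1)] by blast
  have "mxdisp n \<ge> (f ^^ n) v - (f ^^ n) x" for n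
  proof -
    have "l ((\<beta> ^^ n) (lead n)) > 0" using lead(2) mx_pos[of n] by (simp add: lf_def)
    then have "(f ^^ n) v \<le> (f ^^ n) (\<rho> ((\<beta> ^^ n) (lead n)) x)"
      using jump lead_in v x_in by (subst f_pow_le_iff) (auto simp del: atLeastAtMost_iff)
    then show ?thesis unfolding mxdisp_def by (simp add: disp_eq lead_in)
  qed
  then have "?R n \<le> mx n" for n
    using mxdisp_pos[of n] mx_nonneg[of n] by (simp add: pos_divide_le_eq mult.commute mult_left_mono)
  moreover have "mx n \<le> m ^ n * mx 0" for n
  proof -
    have "lf n b = m ^ n * l b" if "b \<in> H" for b
      using that by (induction n arbitrary: b) (auto simp: lf_def contr funpow_swap1 beta_in simp del: funpow.simps(2) simp: funpow_Suc_right)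
    then have "mx n = m ^ n * l (lead n)" using lead(2)[of n] lead_in by simp
    moreover have "l (lead n) \<le> mx 0"
      using lf_le_mx[of _ 0] additive_uminus[OF l_additive] lead(1)[of n] S_sub
      unfolding gens_def by (auto simp: lf_def abs_le_iff) 
    ultimately show ?thesis using contr by simp
  qed
  ultimately have "?R n \<le> m ^ n * mx 0" for n using order_trans by blast
  then have "1 \<le> (m ^ n * mx 0) * (C * \<mu> ^ n)" for n
    using mult_mono[OF _ C[of n], of "?R n" "m ^ n * mx 0"] R(1)[of n] Rinv[of n] contr mx_nonneg[of 0]
    by (metis less_imp_le mult_nonneg_nonneg order_less_irrefl right_inverse zero_le_power)
  then have "1 \<le> C * mx 0 * (m * \<mu>) ^ n" for n
    by (simp add: power_mult_distrib mult_ac)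
  moreover have "(\<lambda>n. C * mx 0 * (m * \<mu>) ^ n) \<longlonglongrightarrow> C * mx 0 * 0"
    using \<mu> contr by (intro tendsto_intros LIMSEQ_realpow_zero) (auto simp: field_simps)
  ultimately have "(1::real) \<le> 0"
    by (intro LIMSEQ_le_const[of "\<lambda>n. C * mx 0 * (m * \<mu>) ^ n" 0 1]) auto
  then show False by simp
qed

end

section \<open>Global fixed points of the normal subgroup\<close>

context hyperbolic_action
begin

lemma rho_in_open: "b \<in> H \<Longrightarrow> x \<in> {0<..<1} \<Longrightarrow> \<rho> b x \<in> {0<..<1}"
  using rho_less_iff[of b 0 x] rho_less_iff[of b x 1] rho_endpoint[of 0 b] rho_endpoint[of 1 b] by auto

lemma f_in_open: "x \<in> {0<..<1} \<Longrightarrow> f x \<in> {0<..<1}"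
  using f_less_iff[of 0 x] f_less_iff[of x 1] f_endpoint[of 0] f_endpoint[of 1] by auto

lemma f_pow_in_open: "x \<in> {0<..<1} \<Longrightarrow> (f ^^ n) x \<in> {0<..<1}"
  by (induction n) (auto simp: f_in_open simp del: greaterThanLessThan_iff)

lemma g_in_open: "x \<in> {0<..<1} \<Longrightarrow> g x \<in> {0<..<1}"
  by (rule hyperbolic_action.f_in_open[OF swap])

lemma f_le_iff: "x \<in> {0..1} \<Longrightarrow> y \<in> {0..1} \<Longrightarrow> f x \<le> f y \<longleftrightarrow> x \<le> y"
  using f_less_iff[of y x] by (simp add: not_less[symmetric])

text \<open>The nonnegative cone of the preorder \<open>\<rho> b x \<le> \<rho> c x\<close> on
  \<open>H\<close>.\<close>

definition nonneg_at :: "real \<Rightarrow> 'h set" where "nonneg_at x = {b \<in> H. x \<le> \<rho> b x}"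

lemma nonneg_at_zero: "x \<in> {0..1} \<Longrightarrow> 0 \<in> nonneg_at x"
  by (simp add: nonneg_at_def rho_zero del: atLeastAtMost_iff)

lemma nonneg_at_add:
  assumes x: "x \<in> {0..1}" and "b \<in> nonneg_at x" "c \<in> nonneg_at x"
  shows "b + c \<in> nonneg_at x"
proof -
  have H: "b \<in> H" "c \<in> H" "x \<le> \<rho> b x" "x \<le> \<rho> c x" using assms by (auto simp: nonneg_at_def)
  have "\<rho> b x \<le> \<rho> b (\<rho> c x)" using H x rho_in by (subst rho_le_iff) (auto simp del: atLeastAtMost_iff)
  then show ?thesis using H x rho_add[of b c x] by (auto simp: nonneg_at_def)
qed

lemma nonneg_at_total:
  assumes x: "x \<in> {0..1}" and "b \<in> H" "b \<notin> nonneg_at x"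
  shows "- b \<in> nonneg_at x"
proof -
  have "\<rho> b x \<le> x" using assms by (auto simp: nonneg_at_def)
  then have "\<rho> (- b) (\<rho> b x) \<le> \<rho> (- b) x"
    using assms by (subst rho_le_iff) (auto simp del: atLeastAtMost_iff)
  then show ?thesis using rho_uminus[of b x] assms by (auto simp: nonneg_at_def)
qed

lemma nonneg_at_of_int_mult:
  assumes x: "x \<in> {0..1}" and b: "b \<in> nonneg_at x" and "k \<ge> 0"
  shows "of_int k * b \<in> nonneg_at x"
  using \<open>k \<ge> 0\<close>
proof (induction k rule: int_ge_induct)
  case base
  then show ?case using nonneg_at_zero[OF x] by simp
next
  case (step k)
  then show ?case using nonneg_at_add[OF x step.IH b] by (simp add: algebra_simps)
qed

text \<open>Otherwise \<open>of_int (k - 1) * (- b)\<close> lies in the cone, and adding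
  \<open>of_int k * b\<close> gives \<open>b\<close>.\<close>

lemma nonneg_at_root:
  assumes x: "x \<in> {0..1}" and "b \<in> H" "k > 0" "of_int k * b \<in> nonneg_at x"
  shows "b \<in> nonneg_at x"
proof (rule ccontr)
  assume "b \<notin> nonneg_at x"
  then have "of_int (k - 1) * (- b) \<in> nonneg_at x"
    using assms by (intro nonneg_at_of_int_mult nonneg_at_total) auto
  then have "of_int k * b + of_int (k - 1) * (- b) \<in> nonneg_at x"
    using assms by (intro nonneg_at_add)
  then show False using \<open>b \<notin> nonneg_at x\<close> by (simp add: algebra_simps)
qed

lemma rho_eq_iff_nonneg_at:
  assumes "x \<in> {0..1}" "b \<in> H"
  shows "\<rho> b x = x \<longleftrightarrow> b \<in> nonneg_at x \<and> - b \<in> nonneg_at x"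
proof
  assume "\<rho> b x = x"
  then show "b \<in> nonneg_at x \<and> - b \<in> nonneg_at x"
    using rho_uminus[OF assms(2,1)] assms by (auto simp: nonneg_at_def)
next
  assume *: "b \<in> nonneg_at x \<and> - b \<in> nonneg_at x"
  then have "\<rho> b x \<le> \<rho> b (\<rho> (- b) x)" using assms by (subst rho_le_iff) (auto simp: nonneg_at_def simp del: atLeastAtMost_iff)
  then show "\<rho> b x = x" using rho_uminus'[OF assms(2,1)] * by (auto simp: nonneg_at_def)
qed

text \<open>The stabilizer of \<open>x\<close> is a subgroup, closed under roots because the cone at
  \<open>x\<close> is.\<close>

lemma fixed_by_generators:
  assumes x: "x \<in> {0..1}" and S: "\<And>s. s \<in> S \<Longrightarrow> \<rho> s x = x" and "b \<in> H"
  shows "\<rho> b x = x"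
  using \<open>b \<in> H\<close>
proof (induction rule: isolated_induct)
  case (gen s)
  then show ?case by (rule S)
next
  case zero
  then show ?case by (rule rho_zero[OF x])
next
  case (diff b c)
  have "\<rho> (b - c) x = \<rho> (b - c) (\<rho> c x)" using diff by simp
  also have "\<dots> = \<rho> b x" using rho_add[of "b - c" c x] diff x by (simp add: diff_in)
  finally show ?case using diff by simp
next
  case (root b k)
  then have "of_int k * b \<in> nonneg_at x" "- (of_int k * b) \<in> nonneg_at x"
    using rho_eq_iff_nonneg_at[OF x, of "of_int k * b"] by auto
  then have "b \<in> nonneg_at x" "- b \<in> nonneg_at x"
    using nonneg_at_root[OF x _ root(2), of b] nonneg_at_root[OF x _ root(2), of "- b"] root(1) by auto
  then show ?case using rho_eq_iff_nonneg_at[OF x root(1)] by simp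
qed

text \<open>A signed generator \<open>e\<close> moving \<open>x\<close> farthest to the right
  dominates all generators, and by finite rank some multiple of it dominates any given element. So
  \<open>e\<close> is an order unit and Hoelder's construction applies.\<close>

lemma order_functional:
  assumes x: "x \<in> {0..1}" and "\<exists>b\<in>H. \<rho> b x \<noteq> x"
  obtains l e where "additive_on H l" "e \<in> H" "l e = 1" "\<And>b. b \<in> H \<Longrightarrow> l b > 0 \<Longrightarrow> \<rho> b x > x"
proof -
  let ?G = "S \<union> uminus ` S"
  obtain s where s: "s \<in> S" "\<rho> s x \<noteq> x" using fixed_by_generators[OF x] assms(2) by blast
  have G: "finite ?G" "?G \<noteq> {}" "?G \<subseteq> H" using finite_S s S_sub by auto
  have "Max ((\<lambda>t. \<rho> t x) ` ?G) \<in> (\<lambda>t. \<rho> t x) ` ?G" using G by (intro Max_in) auto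
  then obtain e where e: "Max ((\<lambda>t. \<rho> t x) ` ?G) = \<rho> e x" "e \<in> ?G" by (rule imageE)
  have e_max: "\<rho> t x \<le> \<rho> e x" if "t \<in> ?G" for t unfolding e(1)[symmetric] using G that by (intro Max_ge) auto
  have eH: "e \<in> H" using e G by blast
  have dom: "e - t \<in> nonneg_at x" if t: "t \<in> ?G" for t
  proof -
    have tH: "t \<in> H" using t G by blast
    have "\<rho> (- t) (\<rho> t x) \<le> \<rho> (- t) (\<rho> e x)"
      using e_max[OF t] tH eH x by (subst rho_le_iff) (auto simp del: atLeastAtMost_iff)
    then show ?thesis
      using rho_uminus[OF tH x] rho_add[of "- t" e x] uminus_in[OF tH] tH eH x by (auto simp: nonneg_at_def)
  qed
  have e_neg: "- e \<notin> nonneg_at x"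
  proof
    assume "- e \<in> nonneg_at x"
    then have "e - s + - e \<in> nonneg_at x" "e - (- s) + - e \<in> nonneg_at x"
      using nonneg_at_add[OF x dom[of s]] nonneg_at_add[OF x dom[of "- s"]] s(1) by blast+
    then have "- s \<in> nonneg_at x" "s \<in> nonneg_at x" by simp_all
    then show False using s rho_eq_iff_nonneg_at[OF x, of s] S_sub by auto
  qed
  have e_pos: "e \<in> nonneg_at x" using nonneg_at_total[OF x, of "- e"] e_neg eH by auto
  \<comment> \<open>Bounds for \<open>b\<close> and \<open>- b\<close> at once, so that differences
    can be treated.\<close>
  have unit: "\<exists>K::int. K \<ge> 0 \<and> of_int K * e - b \<in> nonneg_at x \<and> of_int K * e + b \<in> nonneg_at x" if "b \<in> H" for b
    using that
  proof (induction rule: isolated_induct)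
    case (gen s)
    then show ?case using dom[of s] dom[of "- s"] by (intro exI[of _ 1]) auto
  next
    case zero
    then show ?case using nonneg_at_zero[OF x] by (intro exI[of _ 0]) auto
  next
    case (diff b c)
    then obtain K K' :: int where K: "K \<ge> 0" "of_int K * e - b \<in> nonneg_at x" "of_int K * e + b \<in> nonneg_at x"
      "K' \<ge> 0" "of_int K' * e - c \<in> nonneg_at x" "of_int K' * e + c \<in> nonneg_at x" by auto
    have "of_int (K + K') * e - (b - c) \<in> nonneg_at x" "of_int (K + K') * e + (b - c) \<in> nonneg_at x"
      using nonneg_at_add[OF x K(2,6)] nonneg_at_add[OF x K(3,5)] by (auto simp: algebra_simps)
    then show ?case using K by (intro exI[of _ "K + K'"]) auto
  next
    case (root b k)
    then obtain K :: int where K: "K \<ge> 0" "of_int K * e - of_int k * b \<in> nonneg_at x"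
      "of_int K * e + of_int k * b \<in> nonneg_at x" by auto
    \<comment> \<open>Adding this turns \<open>of_int K * e\<close> into
      \<open>of_int (k * K) * e\<close>, so that \<open>k\<close> can be cancelled.\<close>
    have *: "of_int ((k - 1) * K) * e \<in> nonneg_at x"
      using K(1) root(2) by (intro nonneg_at_of_int_mult[OF x e_pos]) auto
    have "of_int k * (of_int K * e - b) \<in> nonneg_at x" "of_int k * (of_int K * e + b) \<in> nonneg_at x"
      using nonneg_at_add[OF x K(2) *] nonneg_at_add[OF x K(3) *] by (auto simp: algebra_simps)
    then have "of_int K * e - b \<in> nonneg_at x" "of_int K * e + b \<in> nonneg_at x"
      using root(1) eH by (auto intro!: nonneg_at_root[OF x _ root(2)])
    then show ?case using K(1) by blast
  qed
  obtain l where l: "additive_on H l" "l e = 1" "\<And>b. b \<in> H \<Longrightarrow> - b \<in> nonneg_at x \<Longrightarrow> l b \<le> 0"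
  proof (rule hoelder_functional[of "\<lambda>b. b \<in> nonneg_at x" e])
    show "\<exists>K::int. of_int K * e - b \<in> nonneg_at x" if "b \<in> H" for b using unit[OF that] by blast
  qed (use x eH e_neg nonneg_at_total nonneg_at_add in auto)
  show thesis
  proof (rule that[OF l(1) eH l(2)])
    fix b assume b: "b \<in> H" "l b > 0"
    show "\<rho> b x > x"
    proof (rule ccontr)
      assume "\<not> \<rho> b x > x"
      then have "b \<notin> nonneg_at x \<or> \<rho> b x = x" using b by (auto simp: nonneg_at_def)
      then have "- b \<in> nonneg_at x" using nonneg_at_total[OF x b(1)] rho_eq_iff_nonneg_at[OF x b(1)] by auto
      then show False using l(3)[OF b(1)] b(2) by simp
    qed
  qed
qed

section \<open>Limits of orbits of \<open>f\<close>\<close>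

lemma f_pow_convergent:
  assumes x: "x \<in> {0..1}"
  obtains L where "L \<in> {0..1}" "f L = L" "(\<lambda>n. (f ^^ n) x) \<longlonglongrightarrow> L"
proof -
  have "monoseq (\<lambda>n. (f ^^ n) x)"
  proof (cases "f x \<le> x")
    case True
    then have "(f ^^ Suc n) x \<le> (f ^^ n) x" for n
      using f_pow_le_iff[of "f x" x n] x f_in by (simp add: funpow_swap1 del: atLeastAtMost_iff)
    then show ?thesis by (intro decseq_imp_monoseq decseq_SucI)
  next
    case False
    then have "(f ^^ n) x \<le> (f ^^ Suc n) x" for n
      using f_pow_le_iff[of x "f x" n] x f_in by (simp add: funpow_swap1 del: atLeastAtMost_iff)
    then show ?thesis by (intro incseq_imp_monoseq incseq_SucI)
  qed
  moreover have "Bseq (\<lambda>n. (f ^^ n) x)"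
    using f_pow_in[OF x] by (intro BseqI'[of _ 1]) auto
  ultimately have "convergent (\<lambda>n. (f ^^ n) x)" by (rule Bseq_monoseq_convergent[rotated])
  then obtain L where L: "(\<lambda>n. (f ^^ n) x) \<longlonglongrightarrow> L" unfolding convergent_def by blast
  have LI: "L \<in> {0..1}"
    using closed_sequentially[OF closed_atLeastAtMost _ L] f_pow_in[OF x] by blast
  have "(\<lambda>n. f ((f ^^ n) x)) \<longlonglongrightarrow> f L"
    by (rule C1_within_tendsto[OF f_C1 L _ LI]) (rule f_pow_in[OF x])
  moreover have "(\<lambda>n. f ((f ^^ n) x)) \<longlonglongrightarrow> L" using LIMSEQ_Suc[OF L] by simp
  ultimately have "f L = L" by (rule LIMSEQ_unique)
  then show thesis using that LI L by blast
qed

lemma f_pow_tendsto_1: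
  assumes nofix: "\<And>y. y \<in> {0<..<1} \<Longrightarrow> f y \<noteq> y" and z: "z \<in> {0<..<1}" "f z > z"
  shows "(\<lambda>n. (f ^^ n) z) \<longlonglongrightarrow> 1"
proof -
  have z': "z \<in> {0..1}" using z by auto
  obtain L where L: "L \<in> {0..1}" "f L = L" "(\<lambda>n. (f ^^ n) z) \<longlonglongrightarrow> L"
    using f_pow_convergent[OF z'] .
  have "(f ^^ n) z \<ge> z" for n
  proof (induction n)
    case (Suc n)
    then have "f z \<le> f ((f ^^ n) z)" using z' by (subst f_le_iff) (auto simp del: atLeastAtMost_iff)
    then show ?case using z by simp
  qed simp
  then have "L \<ge> z" by (intro LIMSEQ_le_const[OF L(3)]) blast
  then have "L = 1" using nofix[of L] L z by (auto simp: less_le)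
  then show ?thesis using L by simp
qed

lemma f_pow_tendsto_0:
  assumes nofix: "\<And>y. y \<in> {0<..<1} \<Longrightarrow> f y \<noteq> y" and z: "z \<in> {0<..<1}" "f z < z"
  shows "(\<lambda>n. (f ^^ n) z) \<longlonglongrightarrow> 0"
proof -
  have z': "z \<in> {0..1}" using z by auto
  obtain L where L: "L \<in> {0..1}" "f L = L" "(\<lambda>n. (f ^^ n) z) \<longlonglongrightarrow> L"
    using f_pow_convergent[OF z'] .
  have "(f ^^ n) z \<le> z" for n
  proof (induction n)
    case (Suc n)
    then have "f ((f ^^ n) z) \<le> f z" using z' by (subst f_le_iff) (auto simp del: atLeastAtMost_iff)
    then show ?case using z by simp
  qed simp
  then have "L \<le> z" by (intro LIMSEQ_le_const2[OF L(3)]) blast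
  then have "L = 0" using nofix[of L] L z by (auto simp: less_le)
  then show ?thesis using L by simp
qed

lemma g_no_fixed: "(\<And>y. y \<in> {0<..<1} \<Longrightarrow> f y \<noteq> y) \<Longrightarrow> y \<in> {0<..<1} \<Longrightarrow> g y \<noteq> y"
  using f_g[of y] by (metis atLeastAtMost_iff greaterThanLessThan_iff less_imp_le)

lemma g_greater_iff: "x \<in> {0..1} \<Longrightarrow> g x > x \<longleftrightarrow> f x < x"
  using f_less_iff[of x "g x"] f_g[of x] g_in[of x] by auto

lemma f_pow_g_pow: "x \<in> {0..1} \<Longrightarrow> (f ^^ n) ((g ^^ n) x) = x"
proof (induction n arbitrary: x)
  case (Suc n)
  have "(f ^^ Suc n) ((g ^^ Suc n) x) = f ((f ^^ n) ((g ^^ n) (g x)))" by (simp add: funpow_swap1)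
  then show ?case using Suc f_g g_in by simp
qed simp

section \<open>Common fixed points of \<open>H\<close>\<close>

definition fixed :: "real set" where "fixed = {t \<in> {0..1}. \<forall>b\<in>H. \<rho> b t = t}"

lemma closed_fixed: "closed fixed"
proof -
  have "closed {t \<in> {0..1}. \<rho> b t - t = 0}" if "b \<in> H" for b
  proof (rule continuous_closed_preimage_constant)
    have "continuous_on {0..1} (\<rho> b)"
      using rho_C1[OF that] unfolding C1_within_def by (metis DERIV_continuous_on)
    then show "continuous_on {0..1} (\<lambda>t. \<rho> b t - t)" by (intro continuous_intros)
  qed simp
  then have "closed (\<Inter>b\<in>H. {t \<in> {0..1}. \<rho> b t - t = 0})" by blast
  moreover have "fixed = (\<Inter>b\<in>H. {t \<in> {0..1}. \<rho> b t - t = 0})"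
    unfolding fixed_def using zero_in by auto
  ultimately show ?thesis by simp
qed

lemma f_fixed: "t \<in> fixed \<Longrightarrow> f t \<in> fixed"
  unfolding fixed_def using f_rho[of "\<beta> _" t] by (auto simp: alpha_beta beta_in f_in simp del: atLeastAtMost_iff)
    (metis alpha_beta beta_in f_rho)

lemma g_fixed: "t \<in> fixed \<Longrightarrow> g t \<in> fixed"
  using hyperbolic_action.f_fixed[OF swap] unfolding fixed_def hyperbolic_action.fixed_def[OF swap] .

lemma f_pow_fixed: "t \<in> fixed \<Longrightarrow> (f ^^ n) t \<in> fixed"
  by (induction n) (auto intro: f_fixed)

text \<open>If \<open>f y = y\<close>, then \<open>f\<close> and \<open>g\<close> preserve the set
  of \<open>H\<close>-fixed points on the side of \<open>y\<close> where \<open>z\<close> lies. The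
  one closest to \<open>y\<close> is then fixed by \<open>f\<close> and lies between
  \<open>z\<close> and \<open>y\<close>, so it is a global fixed point in the open interval.\<close>

lemma no_fixed_point_of_f:
  assumes noglob: "\<not> (\<exists>t\<in>{0<..<1}. t \<in> fixed \<and> f t = t)"
    and z: "z \<in> fixed" "z \<in> {0<..<1}" and y: "y \<in> {0<..<1}"
  shows "f y \<noteq> y"
proof
  assume fy: "f y = y"
  have gy: "g y = y" using g_f[of y] fy y by auto
  consider "z = y" | "z < y" | "y < z" by linarith
  then show False
  proof cases
    case 1
    then show False using noglob z fy by blast
  next
    case 2
    define T where "T = fixed \<inter> {..y}"
    have T: "closed T" "T \<noteq> {}" "bdd_above T" "T \<subseteq> {0..1}"
      using closed_fixed 2 z unfolding T_def by (blast, force, force, force simp: fixed_def)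
    define w where "w = Sup T"
    have wT: "w \<in> T" unfolding w_def using T by (intro closed_contains_Sup)
    have wz: "w \<ge> z" unfolding w_def using T z 2 by (intro cSup_upper) (auto simp: T_def)
    have wI: "w \<in> {0..1}" "w \<le> y" "w \<in> fixed" using wT T by (auto simp: T_def)
    have yI: "y \<in> {0..1}" using y by auto
    have "f w \<in> T" using wI f_le_iff[OF wI(1) yI] fy by (auto simp: T_def f_fixed)
    \<comment> \<open>Neither \<open>f\<close> nor its inverse moves the extreme point
      \<open>w\<close> closer to \<open>y\<close>, so \<open>w\<close> is fixed.\<close>
    then have 1: "f w \<le> w" unfolding w_def using T by (intro cSup_upper)
    have "g w \<in> T" using wI hyperbolic_action.f_le_iff[OF swap wI(1) yI] gy by (auto simp: T_def g_fixed)
    then have "g w \<le> w" unfolding w_def using T by (intro cSup_upper)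
    then have "f (g w) \<le> f w" using wI g_in by (subst f_le_iff) (auto simp del: atLeastAtMost_iff)
    then have "f w = w" using 1 f_g[OF wI(1)] by simp
    then show False using noglob wI wz z y by auto
  next
    case 3
    define T where "T = fixed \<inter> {y..}"
    have T: "closed T" "T \<noteq> {}" "bdd_below T" "T \<subseteq> {0..1}"
      using closed_fixed 3 z unfolding T_def by (blast, force, force, force simp: fixed_def)
    define w where "w = Inf T"
    have wT: "w \<in> T" unfolding w_def using T by (intro closed_contains_Inf)
    have wz: "w \<le> z" unfolding w_def using T z 3 by (intro cInf_lower) (auto simp: T_def)
    have wI: "w \<in> {0..1}" "y \<le> w" "w \<in> fixed" using wT T by (auto simp: T_def)
    have yI: "y \<in> {0..1}" using y by auto
    have "f w \<in> T" using wI f_le_iff[OF yI wI(1)] fy by (auto simp: T_def f_fixed)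
    then have 1: "w \<le> f w" unfolding w_def using T by (intro cInf_lower)
    have "g w \<in> T" using wI hyperbolic_action.f_le_iff[OF swap yI wI(1)] gy by (auto simp: T_def g_fixed)
    then have "w \<le> g w" unfolding w_def using T by (intro cInf_lower)
    then have "f w \<le> f (g w)" using wI g_in by (subst f_le_iff) (auto simp del: atLeastAtMost_iff)
    then have "f w = w" using 1 f_g[OF wI(1)] by simp
    then show False using noglob wI wz z y by auto
  qed
qed

lemma orbit_between_tendsto:
  assumes "u \<le> x" "x \<le> v" "x \<in> {0..1}" "u \<in> {0..1}" "v \<in> {0..1}"
    and "(\<lambda>n. (f ^^ n) u) \<longlonglongrightarrow> p" "(\<lambda>n. (f ^^ n) v) \<longlonglongrightarrow> p"
  shows "(\<lambda>n. (f ^^ n) x) \<longlonglongrightarrow> p"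
proof (rule real_tendsto_sandwich[OF _ _ assms(6,7)])
  show "\<forall>\<^sub>F n in sequentially. (f ^^ n) u \<le> (f ^^ n) x"
    "\<forall>\<^sub>F n in sequentially. (f ^^ n) x \<le> (f ^^ n) v"
    using assms by (auto simp: f_pow_le_iff simp del: atLeastAtMost_iff intro!: always_eventually)
qed

lemma orbit_shift_tendsto:
  assumes z: "z \<in> {0..1}" and lim: "(\<lambda>n. (f ^^ n) z) \<longlonglongrightarrow> p"
  shows "(\<lambda>n. (f ^^ n) ((f ^^ m) z)) \<longlonglongrightarrow> p" "(\<lambda>n. (f ^^ n) ((g ^^ m) z)) \<longlonglongrightarrow> p"
proof -
  show "(\<lambda>n. (f ^^ n) ((f ^^ m) z)) \<longlonglongrightarrow> p"
    using LIMSEQ_ignore_initial_segment[OF lim, of m] by (simp add: funpow_add)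
  have "(\<lambda>n. (f ^^ (n + m)) ((g ^^ m) z)) \<longlonglongrightarrow> p"
    using lim f_pow_g_pow[OF z, of m] by (simp add: funpow_add)
  then show "(\<lambda>n. (f ^^ n) ((g ^^ m) z)) \<longlonglongrightarrow> p" by (rule LIMSEQ_offset)
qed

text \<open>Iterates of \<open>z\<close> enclose \<open>x\<close> in an interval with
  \<open>H\<close>-fixed end points, which \<open>f\<close> carries to 0 and \<open>g\<close> to 1.
  The order functional at \<open>x\<close> is then subexponential in both directions, so
  hyperbolicity contradicts \<open>l e = 1\<close>.\<close>

lemma trivial_of_fixed_point_aux:
  assumes noglob: "\<not> (\<exists>t\<in>{0<..<1}. t \<in> fixed \<and> f t = t)"
    and z: "z \<in> fixed" "z \<in> {0<..<1}" and fz: "f z < z" and x: "x \<in> {0<..<1}"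
  shows "x \<in> fixed"
proof (rule ccontr)
  interpret sw: hyperbolic_action H S \<beta> \<alpha> \<rho> g f by (rule swap)
  assume nf: "x \<notin> fixed"
  have nofix: "\<And>y. y \<in> {0<..<1} \<Longrightarrow> f y \<noteq> y" using no_fixed_point_of_f[OF noglob z] by blast
  have zI: "z \<in> {0..1}" and xI: "x \<in> {0..1}" using z x by auto
  have gz: "g z > z" using g_greater_iff[OF zI] fz by simp
  have f0: "(\<lambda>n. (f ^^ n) z) \<longlonglongrightarrow> 0" using f_pow_tendsto_0[OF nofix z(2) fz] by blast
  have g1: "(\<lambda>n. (g ^^ n) z) \<longlonglongrightarrow> 1"
    using sw.f_pow_tendsto_1[OF g_no_fixed[OF nofix] z(2) gz] by blast
  obtain i where i: "(f ^^ i) z < x"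
    using order_tendstoD(2)[OF f0, of x] x by (auto simp: eventually_sequentially)
  obtain j where j: "(g ^^ j) z > x"
    using order_tendstoD(1)[OF g1, of x] x by (auto simp: eventually_sequentially)
  define u where "u = (f ^^ i) z"
  define v where "v = (g ^^ j) z"
  have uI: "u \<in> {0..1}" and vI: "v \<in> {0..1}"
    unfolding u_def v_def using f_pow_in[OF zI] sw.f_pow_in[OF zI] by auto
  have uv: "u < v" "u \<le> x" "x \<le> v" using i j by (auto simp: u_def v_def)
  have vfix: "v \<in> fixed" unfolding v_def using sw.f_pow_fixed z(1) unfolding sw.fixed_def fixed_def by blast
  have rho_le: "\<rho> b x \<le> v" if "b \<in> H" for b
    using rho_le_iff[OF that xI vI] uv vfix that by (auto simp: fixed_def)
  have limf: "(\<lambda>n. (f ^^ n) u) \<longlonglongrightarrow> 0" "(\<lambda>n. (f ^^ n) v) \<longlonglongrightarrow> 0"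
    unfolding u_def v_def by (intro orbit_shift_tendsto zI f0)+
  have limg: "(\<lambda>n. (g ^^ n) u) \<longlonglongrightarrow> 1" "(\<lambda>n. (g ^^ n) v) \<longlonglongrightarrow> 1"
    unfolding u_def v_def by (intro sw.orbit_shift_tendsto zI g1)+
  have limx: "(\<lambda>n. (f ^^ n) x) \<longlonglongrightarrow> 0" "(\<lambda>n. (g ^^ n) x) \<longlonglongrightarrow> 1"
    using orbit_between_tendsto[OF uv(2,3) xI uI vI limf] sw.orbit_between_tendsto[OF uv(2,3) xI uI vI limg]
    by auto
  have "\<exists>b\<in>H. \<rho> b x \<noteq> x" using nf xI by (auto simp: fixed_def)
  then obtain l e where l: "additive_on H l" "e \<in> H" "l e = 1" "\<And>b. b \<in> H \<Longrightarrow> l b > 0 \<Longrightarrow> \<rho> b x > x"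
    using order_functional[OF xI] by metis
  have nz: "\<exists>b\<in>H. l b \<noteq> 0" using l(2,3) by (intro bexI[of _ e]) auto
  \<comment> \<open>One functional serves both directions of time, since its defining property
    concerns \<open>x\<close> alone.\<close>
  interpret F: approaching_orbit H S \<alpha> \<beta> \<rho> f g x 0 l
    by unfold_locales (use xI limx l nz in auto)
  interpret B: approaching_orbit H S \<beta> \<alpha> \<rho> g f x 1 l
    by unfold_locales (use xI limx l nz in auto)
  have "l e = 0"
    by (rule hyperbolic[OF l(1,2)])
      (rule F.functional_subexponential[OF uI vI uv(1) limf uv(2) rho_le l(2)]
            B.functional_subexponential[OF uI vI uv(1) limg uv(2) rho_le l(2)]; assumption)+
  then show False using l by simp
qed

text \<open>The remaining case \<open>f z > z\<close> is the time reversal of the previous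
  one.\<close>

lemma trivial_of_fixed_point:
  assumes noglob: "\<not> (\<exists>t\<in>{0<..<1}. t \<in> fixed \<and> f t = t)"
    and z: "z \<in> fixed" "z \<in> {0<..<1}" and x: "x \<in> {0<..<1}"
  shows "x \<in> fixed"
proof -
  interpret sw: hyperbolic_action H S \<beta> \<alpha> \<rho> g f by (rule swap)
  have zI: "z \<in> {0..1}" using z by auto
  have fx: "sw.fixed = fixed" by (simp add: sw.fixed_def fixed_def)
  have "f z \<noteq> z" using noglob z by blast
  then consider "f z < z" | "f z > z" by linarith
  then show ?thesis
  proof cases
    case 1
    then show ?thesis using trivial_of_fixed_point_aux[OF noglob z _ x] by simp
  next
    case 2
    then have "g z < z" using sw.g_greater_iff[OF zI] by simp
    moreover have "\<not> (\<exists>t\<in>{0<..<1}. t \<in> fixed \<and> g t = t)"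
      using noglob f_g by (metis atLeastAtMost_iff greaterThanLessThan_iff less_imp_le)
    ultimately show ?thesis using sw.trivial_of_fixed_point_aux[of z x] z x fx by simp
  qed
qed

end

section \<open>Conjugacy to an affine action\<close>

context hyperbolic_action
begin

text \<open>The supremum and the infimum of an \<open>H\<close>-orbit are fixed by \<open>H\<close>,
  hence equal to 1 and 0.\<close>

lemma orbit_unbounded:
  assumes nofix: "\<And>t. t \<in> {0<..<1} \<Longrightarrow> t \<notin> fixed" and x: "x \<in> {0<..<1}" and y: "y \<in> {0<..<1}"
  shows "\<exists>b\<in>H. \<rho> b x > y" "\<exists>b\<in>H. \<rho> b x < y"
proof -
  define Orb where "Orb = (\<lambda>b. \<rho> b x) ` H"
  have xI: "x \<in> {0..1}" using x by auto
  have xO: "x \<in> Orb" unfolding Orb_def using rho_zero[OF xI] by force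
  have OI: "Orb \<subseteq> {0..1}" unfolding Orb_def using rho_in xI by blast
  have bdd: "bdd_above Orb" "bdd_below Orb" using OI by (meson bdd_above_Icc bdd_above_mono, meson bdd_below_Icc bdd_below_mono)
  have shift: "\<rho> c z \<in> Orb" if c: "c \<in> H" and z: "z \<in> Orb" for c z
  proof -
    obtain b where b: "b \<in> H" "z = \<rho> b x" using z unfolding Orb_def by blast
    then have "\<rho> c z = \<rho> (c + b) x" using rho_add[OF c b(1) xI] by simp
    then show ?thesis using b(1) c unfolding Orb_def by blast
  qed
  have unshift: "\<exists>z'\<in>Orb. z = \<rho> c z'" if "c \<in> H" "z \<in> Orb" for c z
    using shift[of "- c" z] rho_uminus'[of c z] that OI by (metis subsetD uminus_in)
  have "Sup Orb \<ge> x" by (intro cSup_upper xO bdd)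
  moreover have "Sup Orb \<le> 1" by (rule cSup_least) (use xO OI in auto)
  ultimately have SI: "Sup Orb \<in> {0..1}" "Sup Orb \<ge> x" using x by auto
  have "\<rho> c (Sup Orb) \<ge> Sup Orb" if c: "c \<in> H" for c
  proof (rule cSup_least)
    fix z assume "z \<in> Orb"
    then obtain z' where z': "z' \<in> Orb" "z = \<rho> c z'" using unshift[OF c] by blast
    moreover have "z' \<le> Sup Orb" by (intro cSup_upper z' bdd)
    moreover have "z' \<in> {0..1}" using z' OI by blast
    ultimately show "z \<le> \<rho> c (Sup Orb)" using SI c by (simp add: rho_le_iff del: atLeastAtMost_iff)
  qed (use xO in blast)
  \<comment> \<open>No element moves the supremum to the left, and neither does its inverse, so it
    is fixed.\<close>
  then have "Sup Orb \<in> fixed"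
    using rho_eq_iff_nonneg_at[OF SI(1)] SI(1) by (auto simp: fixed_def nonneg_at_def)
  then have "Sup Orb = 1" using nofix[of "Sup Orb"] SI x by (cases "Sup Orb = 1") auto
  then show "\<exists>b\<in>H. \<rho> b x > y"
    using less_cSup_iff[OF _ bdd(1), of y] xO y unfolding Orb_def by auto
  have "Inf Orb \<le> x" by (intro cInf_lower xO bdd)
  moreover have "0 \<le> Inf Orb" by (rule cInf_greatest) (use xO OI in auto)
  ultimately have II: "Inf Orb \<in> {0..1}" "Inf Orb \<le> x" using x by auto
  have "\<rho> c (Inf Orb) \<le> Inf Orb" if c: "c \<in> H" for c
  proof (rule cInf_greatest)
    fix z assume "z \<in> Orb"
    then obtain z' where z': "z' \<in> Orb" "z = \<rho> c z'" using unshift[OF c] by blast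
    moreover have "Inf Orb \<le> z'" by (intro cInf_lower z' bdd)
    moreover have "z' \<in> {0..1}" using z' OI by blast
    ultimately show "\<rho> c (Inf Orb) \<le> z" using II c by (simp add: rho_le_iff del: atLeastAtMost_iff)
  qed (use xO in blast)
  then have "\<rho> c (Inf Orb) = Inf Orb" if c: "c \<in> H" for c
    using rho_le_iff[OF c, of "\<rho> (- c) (Inf Orb)" "Inf Orb"] rho_uminus'[OF c II(1)] c II(1)
    by (metis antisym rho_in uminus_in)
  then have "Inf Orb \<in> fixed" using II by (simp add: fixed_def)
  then have "Inf Orb = 0" using nofix[of "Inf Orb"] II x by (cases "Inf Orb = 0") auto
  then show "\<exists>b\<in>H. \<rho> b x < y"
    using cInf_less_iff[OF _ bdd(2), of y] xO y unfolding Orb_def by auto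
qed

lemma additive_pow_scaling:
  assumes "\<And>b. b \<in> H \<Longrightarrow> l (\<alpha> b) = m * (l b :: real)" "b \<in> H"
  shows "l ((\<alpha> ^^ n) b) = m ^ n * l b"
  by (induction n) (use assms in \<open>auto simp: alpha_pow_in\<close>)

text \<open>A map semiconjugating the action to an expanding affine one is injective: an interval on
  which it is constant would wander under \<open>f\<close> towards an end point.\<close>

lemma semiconjugacy_strict_aux:
  assumes l: "additive_on H l" "e \<in> H" "l e = 1"
    and lpos: "\<And>b y. b \<in> H \<Longrightarrow> l b > 0 \<Longrightarrow> y \<in> {0<..<1} \<Longrightarrow> \<rho> b y > y"
    and alpha: "\<And>b. b \<in> H \<Longrightarrow> l (\<alpha> b) = m * l b" and m: "m > 1"
    and mono: "\<And>x y. x \<in> {0<..<1} \<Longrightarrow> y \<in> {0<..<1} \<Longrightarrow> x \<le> y \<Longrightarrow> h x \<le> h y"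
    and hrho: "\<And>b y. b \<in> H \<Longrightarrow> y \<in> {0<..<1} \<Longrightarrow> h (\<rho> b y) = h y + l b"
    and hf: "\<And>y. y \<in> {0<..<1} \<Longrightarrow> h (f y) = m * h y + t"
    and u: "u \<in> {0<..<1}" and v: "v \<in> {0<..<1}" and uv: "u < v"
  shows "h u < h v"
proof (rule ccontr)
  assume "\<not> h u < h v"
  then have huv: "h u = h v" using mono[OF u v] uv by simp
  \<comment> \<open>The fixed point of the affine map \<open>\<lambda>r. m * r + t\<close>.\<close>
  define a where "a = t / (1 - m)"
  have a: "m * a + t = a" using m by (simp add: a_def field_simps)
  \<comment> \<open>The translate of the interval by \<open>c\<close> has values of \<open>h\<close>
    below \<open>a\<close>, where expansion drives orbits towards 0.\<close>
  obtain k :: nat where k: "real k > h u - a" using reals_Archimedean2 by blast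
  define c where "c = of_int (- int k) * e"
  have c: "c \<in> H" "l c = - real k"
    using l additive_of_int_mult[OF l(1,2), of "- int k"] of_int_mult_in[of e "- int k"] by (auto simp: c_def)
  define u' where "u' = \<rho> c u"
  define v' where "v' = \<rho> c v"
  have u': "u' \<in> {0<..<1}" and v': "v' \<in> {0<..<1}" unfolding u'_def v'_def using c u v by (auto intro!: rho_in_open simp del: greaterThanLessThan_iff)
  have I: "u' \<in> {0..1}" "v' \<in> {0..1}" using u' v' by auto
  have uv': "u' < v'" unfolding u'_def v'_def using rho_less_iff[OF c(1), of u v] u v uv by auto
  have h': "h u' < a" "h v' = h u'" using hrho[OF c(1) u] hrho[OF c(1) v] huv k c by (auto simp: u'_def v'_def)
  have hpow: "h ((f ^^ n) y) = a + m ^ n * (h y - a)" if y: "y \<in> {0<..<1}" for n y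
  proof (induction n)
    case (Suc n)
    have "h ((f ^^ Suc n) y) = m * (a + m ^ n * (h y - a)) + t"
      using hf[OF f_pow_in_open[OF y, of n]] Suc by simp
    also have "\<dots> = (m * a + t) + m ^ Suc n * (h y - a)" by (simp add: algebra_simps)
    finally show ?case by (simp add: a)
  qed simp
  have lim: "(\<lambda>n. (f ^^ n) y) \<longlonglongrightarrow> 0" if y: "y \<in> {0<..<1}" "h y < a" for y
  proof (rule order_tendstoI)
    fix z :: real assume "z < 0"
    then show "\<forall>\<^sub>F n in sequentially. z < (f ^^ n) y"
      using f_pow_in_open[OF y(1)] by (intro always_eventually allI) (auto intro: less_trans)
  next
    fix z :: real assume "0 < z"
    define z' where "z' = min z (1 / 2)"
    have z': "z' \<in> {0<..<1}" "z' \<le> z" using \<open>0 < z\<close> by (auto simp: z'_def)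
    obtain N where N: "m ^ N > (a - h z') / (a - h y)" using real_arch_pow[OF m] by blast
    have "(f ^^ n) y < z" if "n \<ge> N" for n
    proof -
      have "m ^ N \<le> m ^ n" using that m by (intro power_increasing) auto
      then have "(a - h z') / (a - h y) < m ^ n" using N by linarith
      then have "a - h z' < m ^ n * (a - h y)" using y(2) by (simp add: pos_divide_less_eq)
      then have "h ((f ^^ n) y) < h z'" using hpow[OF y(1), of n] by (simp add: algebra_simps)
      then have "(f ^^ n) y < z'" using mono[OF z'(1) f_pow_in_open[OF y(1), of n]] by linarith
      then show ?thesis using z' by simp
    qed
    then show "\<forall>\<^sub>F n in sequentially. (f ^^ n) y < z" by (auto simp: eventually_sequentially)
  qed
  have nz: "\<exists>b\<in>H. l b \<noteq> 0" using l(2,3) by (intro bexI[of _ e]) auto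
  interpret approaching_orbit H S \<alpha> \<beta> \<rho> f g u' 0 l
    by unfold_locales (use I lim[OF u' h'(1)] l lpos u' nz in auto)
  show False
  proof (rule no_wandering_interval[OF I(2) uv' lim[OF v'], where m = "1 / m"])
    show "h v' < a" using h' by simp
    \<comment> \<open>Such a \<open>b\<close> increases \<open>h\<close>, which takes the same value
      at \<open>u'\<close> and \<open>v'\<close>.\<close>
    show "v' \<le> \<rho> b u'" if "b \<in> H" "l b > 0" for b
      using mono[OF rho_in_open[OF that(1) u'] v'] hrho[OF that(1) u'] that h' by linarith
    show "l (\<beta> b) = 1 / m * l b" if "b \<in> H" for b
      using alpha[of "\<beta> b"] alpha_beta that m by (simp add: beta_in field_simps)
  qed (use m in auto)
qed

text \<open>The order functional at one point governs the signs everywhere and is rescaled by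
  \<open>\<alpha>\<close> with a factor \<open>m\<close> different from 1, so its values are dense.
  The supremum of its values over the elements moving \<open>x0\<close> at most to \<open>y\<close>
  gives the conjugacy.\<close>

lemma affine_conjugacy:
  assumes nofix: "\<And>t. t \<in> {0<..<1} \<Longrightarrow> t \<notin> fixed"
  shows "\<exists>h m t l. strict_mono_on {0<..<1} h \<and> h ` {0<..<1} = (UNIV :: real set) \<and> m > 0 \<and>
    (\<forall>y\<in>{0<..<1}. h (f y) = m * h y + t) \<and> (\<forall>b\<in>H. \<forall>y\<in>{0<..<1}. h (\<rho> b y) = h y + l b)"
proof -
  define x0 :: real where "x0 = 1 / 2"
  have x0: "x0 \<in> {0<..<1}" "x0 \<in> {0..1}" by (auto simp: x0_def)
  have "\<exists>b\<in>H. \<rho> b x0 \<noteq> x0" using nofix[OF x0(1)] x0(2) by (auto simp: fixed_def)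
  then obtain l e where l: "additive_on H l" and e: "e \<in> H" "l e = 1"
    and l0: "\<And>b. b \<in> H \<Longrightarrow> l b > 0 \<Longrightarrow> \<rho> b x0 > x0"
    using order_functional[OF x0(2)] by metis
  have less0: "\<rho> b x0 < \<rho> c x0" if "b \<in> H" "c \<in> H" "l b < l c" for b c
  proof -
    have "\<rho> (c - b) x0 > x0" using that additive_diff[OF l, of c b] by (intro l0) auto
    then have "\<rho> b x0 < \<rho> b (\<rho> (c - b) x0)" using that x0 by (subst rho_less_iff) (auto simp del: atLeastAtMost_iff)
    then show ?thesis using rho_add[of b "c - b" x0] that x0 diff_in[of c b] by simp
  qed
  \<comment> \<open>If \<open>b\<close> failed to move \<open>y\<close> to the right, so would all
    its positive multiples. Yet a large multiple carries a point of the orbit of \<open>x0\<close>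
    from below \<open>y\<close> to beyond \<open>y\<close>.\<close>
  have lpos: "\<rho> b y > y" if b: "b \<in> H" "l b > 0" and y: "y \<in> {0<..<1}" for b y
  proof (rule ccontr)
    assume "\<not> \<rho> b y > y"
    have yI: "y \<in> {0..1}" using y by auto
    have "- b \<in> nonneg_at y"
      using \<open>\<not> \<rho> b y > y\<close> nonneg_at_total[OF yI b(1)] rho_eq_iff_nonneg_at[OF yI b(1)] b(1) by (cases "\<rho> b y = y") (auto simp: nonneg_at_def)
    obtain c where c: "c \<in> H" "\<rho> c x0 < y" using orbit_unbounded(2)[OF nofix x0(1) y] by blast
    obtain c' where c': "c' \<in> H" "\<rho> c' x0 > y" using orbit_unbounded(1)[OF nofix x0(1) y] by blast
    obtain k :: nat where k: "l c' - l c < real k * l b" using reals_Archimedean3[OF b(2)] by blast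
    let ?kb = "of_int (int k) * b"
    have kb: "?kb \<in> H" "l ?kb = real k * l b" using b additive_of_int_mult[OF l b(1), of "int k"] of_int_mult_in[OF b(1), of "int k"] by auto
    have "\<rho> c' x0 < \<rho> (?kb + c) x0"
      using k kb c c' additive_plus[OF l kb(1) c(1)] by (intro less0) auto
    also have "\<dots> = \<rho> ?kb (\<rho> c x0)" using kb c x0 by (intro rho_add)
    also have "\<dots> \<le> \<rho> ?kb y" using kb c x0 yI by (subst rho_le_iff) (auto simp del: atLeastAtMost_iff)
    finally have "y < \<rho> ?kb y" using c' by linarith
    moreover have "of_int (int k) * (- b) \<in> nonneg_at y"
      by (rule nonneg_at_of_int_mult[OF yI \<open>- b \<in> nonneg_at y\<close>]) simp
    then have "- ?kb \<in> nonneg_at y" by simp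
    moreover have "?kb \<in> nonneg_at y" using \<open>y < \<rho> ?kb y\<close> kb by (auto simp: nonneg_at_def)
    ultimately show False using rho_eq_iff_nonneg_at[OF yI kb(1)] by simp
  qed
  define m where "m = l (\<alpha> e)"
  have alpha_additive: "additive_on H (\<lambda>b. l (\<alpha> b))"
    using l unfolding additive_on_def by (simp add: alpha_add alpha_in)
  \<comment> \<open>Conjugation by the increasing map \<open>f\<close> preserves the direction of
    displacements.\<close>
  have alpha_nonneg: "l (\<alpha> b) \<ge> 0" if b: "b \<in> H" "l b > 0" for b
  proof (rule ccontr)
    assume "\<not> l (\<alpha> b) \<ge> 0"
    then have "l (- \<alpha> b) > 0" using additive_uminus[OF l alpha_in[OF b(1)]] by simp
    then have 1: "\<rho> (- \<alpha> b) (f x0) > f x0" using b by (intro lpos f_in_open x0) auto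
    have "f x0 < f (\<rho> b x0)" using l0[OF b] x0 b rho_in[OF b(1) x0(2)] by (subst f_less_iff) auto
    also have "\<dots> = \<rho> (\<alpha> b) (f x0)" using b x0 by (intro f_rho)
    finally have 2: "f x0 < \<rho> (\<alpha> b) (f x0)" .
    have "f x0 \<in> {0..1}" using x0 by blast
    then have "f x0 < \<rho> (\<alpha> b) (\<rho> (- \<alpha> b) (f x0))"
      using 1 2 rho_less_iff[of "\<alpha> b" "f x0" "\<rho> (- \<alpha> b) (f x0)"] b rho_in[of "- \<alpha> b" "f x0"] by (auto simp: alpha_in uminus_in)
    then show False using rho_uminus'[of "\<alpha> b" "f x0"] \<open>f x0 \<in> {0..1}\<close> b by (simp add: alpha_in)
  qed
  have alpha: "l (\<alpha> b) = m * l b" if "b \<in> H" for b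
    using functional_unique[OF l alpha_additive e alpha_nonneg that] by (simp add: m_def)
  have "m \<noteq> 0" using alpha[of "\<beta> e"] alpha_beta[of e] e by (auto simp: beta_in)
  then have m_pos: "m > 0" using alpha_nonneg[of e] e by (simp add: m_def)
  have beta: "l (\<beta> b) = (1 / m) * l b" if "b \<in> H" for b
    using alpha[of "\<beta> b"] alpha_beta that m_pos by (simp add: beta_in field_simps)
  interpret sw: hyperbolic_action H S \<beta> \<alpha> \<rho> g f by (rule swap)
  have alphan: "l ((\<alpha> ^^ n) e) = m ^ n" and betan: "l ((\<beta> ^^ n) e) = (1 / m) ^ n" for n
    using additive_pow_scaling[of l m, OF alpha e(1)] sw.additive_pow_scaling[of l "1 / m", OF beta e(1)] e by auto
  \<comment> \<open>With factor 1 the values along the orbit of \<open>e\<close> would be constant,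
    which hyperbolicity excludes.\<close>
  have m_ne: "m \<noteq> 1"
  proof
    assume "m = 1"
    have "l e = 0"
    proof (rule hyperbolic[OF l e(1)])
      fix \<mu> :: real assume \<mu>: "\<mu> > 1"
      have "\<bar>l ((\<alpha> ^^ n) e)\<bar> \<le> 1 * \<mu> ^ n" "\<bar>l ((\<beta> ^^ n) e)\<bar> \<le> 1 * \<mu> ^ n" for n
        unfolding alphan betan using \<mu> \<open>m = 1\<close> by auto
      then show "\<exists>C. \<forall>n. \<bar>l ((\<alpha> ^^ n) e)\<bar> \<le> C * \<mu> ^ n" "\<exists>C. \<forall>n. \<bar>l ((\<beta> ^^ n) e)\<bar> \<le> C * \<mu> ^ n"
        by blast+
    qed
    then show False using e by simp
  qed
  \<comment> \<open>Powers of \<open>\<alpha>\<close> or of \<open>\<beta>\<close> shrink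
    \<open>l e\<close>, according to the side of 1 on which \<open>m\<close> lies.\<close>
  have small: "\<exists>b\<in>H. 0 < l b \<and> l b < \<epsilon>" if eps: "\<epsilon> > 0" for \<epsilon>
  proof (cases "m < 1")
    case True
    then obtain n where "m ^ n < \<epsilon>" using real_arch_pow_inv[OF eps] by blast
    then show ?thesis using alphan[of n] m_pos e by (intro bexI[of _ "(\<alpha> ^^ n) e"]) auto
  next
    case False
    then have "1 / m < 1" using m_ne m_pos by simp
    then obtain n where "(1 / m) ^ n < \<epsilon>" using real_arch_pow_inv[OF eps] by blast
    then show ?thesis using betan[of n] m_pos e by (intro bexI[of _ "(\<beta> ^^ n) e"]) auto
  qed
  have dense: "\<exists>b\<in>H. r < l b \<and> l b < s" if rs: "r < s" for r s
  proof -
    obtain b where b: "b \<in> H" "0 < l b" "l b < s - r" using small[of "s - r"] rs by auto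
    define k where "k = \<lfloor>r / l b\<rfloor> + 1"
    have "r / l b < k" "k \<le> r / l b + 1" unfolding k_def by linarith+
    then have "r < k * l b" "k * l b \<le> r + l b" using b by (auto simp: field_simps)
    then show ?thesis using additive_of_int_mult[OF l b(1), of k] b of_int_mult_in[OF b(1), of k]
      by (intro bexI[of _ "of_int k * b"]) auto
  qed
  define A where "A y = {l b |b. b \<in> H \<and> \<rho> b x0 \<le> y}" for y
  define h where "h y = Sup (A y)" for y
  have A_le: "a \<le> l b" if "a \<in> A y" "b \<in> H" "y \<le> \<rho> b x0" for a b y
    using that less0 unfolding A_def by force
  have A_ne: "A y \<noteq> {}" if "y \<in> {0<..<1}" for y
    using orbit_unbounded(2)[OF nofix x0(1) that] unfolding A_def by (auto intro: less_imp_le)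
  have A_bdd: "bdd_above (A y)" if "y \<in> {0<..<1}" for y
    using orbit_unbounded(1)[OF nofix x0(1) that] A_le by (metis bdd_aboveI less_imp_le)
  have h_ge: "l b \<le> h y" if "b \<in> H" "\<rho> b x0 \<le> y" "y \<in> {0<..<1}" for b y
    unfolding h_def using that A_bdd by (intro cSup_upper) (auto simp: A_def)
  have mono: "h y \<le> h z" if "y \<in> {0<..<1}" "z \<in> {0<..<1}" "y \<le> z" for y z
    unfolding h_def using that A_ne A_bdd by (intro cSup_subset_mono) (auto simp: A_def)
  have hrho_ge: "h y + l c \<le> h (\<rho> c y)" if c: "c \<in> H" and y: "y \<in> {0<..<1}" for c y
  proof -
    have "h y \<le> h (\<rho> c y) - l c"
      unfolding h_def[of y]
    proof (rule cSup_least[OF A_ne[OF y]])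
      fix a assume "a \<in> A y"
      then obtain b where b: "b \<in> H" "\<rho> b x0 \<le> y" "a = l b" by (auto simp: A_def)
      have "\<rho> (c + b) x0 \<le> \<rho> c y"
        using rho_add[OF c b(1) x0(2)] rho_le_iff[OF c rho_in[OF b(1) x0(2)], of y] b y by auto
      then have "l (c + b) \<le> h (\<rho> c y)" using b c y by (intro h_ge rho_in_open) auto
      then show "a \<le> h (\<rho> c y) - l c" using additive_plus[OF l c b(1)] b by simp
    qed
    then show ?thesis by simp
  qed
  have hrho: "h (\<rho> c y) = h y + l c" if c: "c \<in> H" and y: "y \<in> {0<..<1}" for c y
  proof -
    have "h (\<rho> c y) + l (- c) \<le> h (\<rho> (- c) (\<rho> c y))"
      using c y by (intro hrho_ge rho_in_open) auto
    moreover have "\<rho> (- c) (\<rho> c y) = y" using c y by (intro rho_uminus) auto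
    ultimately show ?thesis using hrho_ge[OF c y] additive_uminus[OF l c] by simp
  qed
  \<comment> \<open>A second monotone function with the same equivariance under \<open>H\<close>. As
    the values of \<open>l\<close> are dense, it differs from \<open>h\<close> by a constant, which
    yields the affine law for \<open>f\<close>.\<close>
  define h1 where "h1 y = h (f y) / m" for y
  have h1_mono: "h1 y \<le> h1 z" if "y \<in> {0<..<1}" "z \<in> {0<..<1}" "y \<le> z" for y z
    unfolding h1_def using that m_pos f_le_iff[of y z]
    by (intro divide_right_mono mono f_in_open) auto
  have h1_rho: "h1 (\<rho> b y) = h1 y + l b" if "b \<in> H" "y \<in> {0<..<1}" for b y
    unfolding h1_def using that hrho[of "\<alpha> b" "f y"] f_rho[of b y] m_pos f_in_open[of y] alpha_in alpha
    by (simp add: field_simps)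
  have h1_le: "h1 x - h1 y \<le> h x - h y" if x: "x \<in> {0<..<1}" and y: "y \<in> {0<..<1}" for x y
  proof (rule field_le_epsilon)
    fix \<epsilon> :: real assume "\<epsilon> > 0"
    then obtain b where b: "b \<in> H" "h x - h y < l b" "l b < h x - h y + \<epsilon>" using dense[of "h x - h y" "h x - h y + \<epsilon>"] by auto
    have byI: "\<rho> b y \<in> {0<..<1}" using b y by (intro rho_in_open)
    have "h x < h (\<rho> b y)" using hrho[OF b(1) y] b by simp
    then have "x \<le> \<rho> b y" using mono[OF byI x] by linarith
    then have "h1 x \<le> h1 y + l b" using h1_mono[OF x byI] h1_rho[OF b(1) y] by simp
    then show "h1 x - h1 y \<le> h x - h y + \<epsilon>" using b by simp
  qed
  define t where "t = m * (h1 x0 - h x0)"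
  have hf: "h (f y) = m * h y + t" if y: "y \<in> {0<..<1}" for y
  proof -
    have "h1 x0 - h x0 = h1 y - h y" using h1_le[OF y x0(1)] h1_le[OF x0(1) y] by simp
    moreover have "h (f y) = m * h1 y" using m_pos by (simp add: h1_def)
    ultimately show ?thesis unfolding t_def by (simp add: right_diff_distrib)
  qed
  have hg: "h (g y) = (1 / m) * h y + (- t / m)" if y: "y \<in> {0<..<1}" for y
    using hf[OF g_in_open[OF y]] f_g[of y] y m_pos by (simp add: field_simps)
  \<comment> \<open>For \<open>m < 1\<close> the inverse \<open>g\<close> is the expanding
    map.\<close>
  have strict: "h u < h v" if uv: "u \<in> {0<..<1}" "v \<in> {0<..<1}" "u < v" for u v
  proof (cases "m > 1")
    case True
    show ?thesis
      by (rule semiconjugacy_strict_aux[OF l e lpos alpha True mono hrho hf uv])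
  next
    case False
    then have "1 / m > 1" using m_ne m_pos by simp
    from sw.semiconjugacy_strict_aux[OF l e lpos beta this mono hrho hg uv] show ?thesis .
  qed
  have surj: "\<exists>y\<in>{0<..<1}. h y = r" for r
  proof -
    define T where "T = {y \<in> {0<..<1}. h y \<le> r}"
    obtain b1 where b1: "b1 \<in> H" "l b1 < r - h x0" using dense[of "r - h x0 - 1" "r - h x0"] by auto
    obtain b2 where b2: "b2 \<in> H" "r - h x0 < l b2" using dense[of "r - h x0" "r - h x0 + 1"] by auto
    define y1 where "y1 = \<rho> b1 x0"
    define y2 where "y2 = \<rho> b2 x0"
    have y: "y1 \<in> {0<..<1}" "y2 \<in> {0<..<1}" "h y1 < r" "r < h y2"
      using b1 b2 x0 hrho[OF _ x0(1)] rho_in_open[OF _ x0(1)] by (auto simp: y1_def y2_def simp del: greaterThanLessThan_iff)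
    have T: "y1 \<in> T" "\<And>z. z \<in> T \<Longrightarrow> z \<le> y2" using y mono[of y2] by (auto simp: T_def) (meson linorder_not_le less_imp_le order_trans greaterThanLessThan_iff)
    have bdd: "bdd_above T" using T(2) by (rule bdd_aboveI)
    define w where "w = Sup T"
    have w: "y1 \<le> w" "w \<le> y2" unfolding w_def using T bdd by (auto intro: cSup_upper cSup_least)
    then have wI: "w \<in> {0<..<1}" using y by auto
    \<comment> \<open>A jump of \<open>h\<close> at \<open>w\<close> is excluded because elements
      with small \<open>l\<close> move \<open>w\<close> while changing \<open>h\<close> by less than
      the gap.\<close>
    have "\<not> h w < r"
    proof
      assume "h w < r"
      then obtain b where b: "b \<in> H" "0 < l b" "l b < r - h w" using dense[of 0 "r - h w"] by auto
      then have "\<rho> b w \<in> T" using hrho[OF b(1) wI] rho_in_open[OF b(1) wI] by (auto simp: T_def)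
      then have "\<rho> b w \<le> w" unfolding w_def using bdd by (intro cSup_upper)
      then show False using lpos[OF b(1,2) wI] by simp
    qed
    moreover have "\<not> h w > r"
    proof
      assume "h w > r"
      then obtain b where b: "b \<in> H" "0 < l b" "l b < h w - r" using dense[of 0 "h w - r"] by auto
      let ?z = "\<rho> (- b) w"
      have z: "?z \<in> {0<..<1}" using b wI by (intro rho_in_open) auto
      have hz: "h ?z > r" using hrho[of "- b" w] b wI additive_uminus[OF l b(1)] by (auto simp: uminus_in)
      have "?z < w" using lpos[OF b(1,2) z] rho_uminus'[OF b(1), of w] wI by auto
      then obtain z' where z': "z' \<in> T" "?z < z'" unfolding w_def using less_cSup_iff[OF _ bdd] T(1) by blast
      then have "h ?z \<le> h z'" using z by (intro mono) (auto simp: T_def)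
      then show False using z' hz by (auto simp: T_def)
    qed
    ultimately show ?thesis using wI by (intro bexI[of _ w]) auto
  qed
  show ?thesis
  proof (intro exI conjI ballI)
    show "strict_mono_on {0<..<1} h" using strict by (intro strict_mono_onI)
    show "h ` {0<..<1} = UNIV" using surj by (auto simp: image_def) (metis greaterThanLessThan_iff)
  qed (use m_pos hf hrho in auto)
qed

section \<open>Conjugacy to a translation\<close>

lemma g_pow_in_open: "x \<in> {0<..<1} \<Longrightarrow> (g ^^ n) x \<in> {0<..<1}"
  by (rule hyperbolic_action.f_pow_in_open[OF swap])

text \<open>The orbit of \<open>y\<close> is sandwiched between that of an iterate of
  \<open>x0\<close> and an end point.\<close>

lemma orbits_tendsto_endpoints:
  assumes nofix: "\<And>y. y \<in> {0<..<1} \<Longrightarrow> f y \<noteq> y" and x0: "x0 \<in> {0<..<1}" "f x0 > x0"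
    and y: "y \<in> {0<..<1}"
  shows "(\<lambda>n. (f ^^ n) y) \<longlonglongrightarrow> 1" "(\<lambda>n. (g ^^ n) y) \<longlonglongrightarrow> 0"
proof -
  interpret sw: hyperbolic_action H S \<beta> \<alpha> \<rho> g f by (rule swap)
  have I: "x0 \<in> {0..1}" "y \<in> {0..1}" using x0 y by auto
  have gx0: "g x0 < x0" using x0(2) sw.g_greater_iff[OF I(1)] by simp
  have f1: "(\<lambda>n. (f ^^ n) x0) \<longlonglongrightarrow> 1" using f_pow_tendsto_1[OF nofix x0] by blast
  have g0: "(\<lambda>n. (g ^^ n) x0) \<longlonglongrightarrow> 0" using sw.f_pow_tendsto_0[OF g_no_fixed[OF nofix] x0(1) gx0] by blast
  obtain i where i: "(g ^^ i) x0 < y"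
    using order_tendstoD(2)[OF g0, of y] y by (auto simp: eventually_sequentially)
  obtain j where j: "(f ^^ j) x0 > y"
    using order_tendstoD(1)[OF f1, of y] y by (auto simp: eventually_sequentially)
  show "(\<lambda>n. (f ^^ n) y) \<longlonglongrightarrow> 1"
  proof (rule orbit_between_tendsto[of "(g ^^ i) x0" y 1])
    have "(f ^^ n) 1 = 1" for n by (induction n) (simp_all add: f_endpoint)
    then show "(\<lambda>n. (f ^^ n) 1) \<longlonglongrightarrow> 1" by simp
  qed (use i I y sw.f_pow_in[OF I(1)] orbit_shift_tendsto(2)[OF I(1) f1] in auto)
  show "(\<lambda>n. (g ^^ n) y) \<longlonglongrightarrow> 0"
  proof (rule sw.orbit_between_tendsto[of 0 y "(f ^^ j) x0"])
    have "(g ^^ n) 0 = 0" for n by (induction n) (simp_all add: sw.f_endpoint)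
    then show "(\<lambda>n. (g ^^ n) 0) \<longlonglongrightarrow> 0" by simp
  qed (use j I y f_pow_in[OF I(1)] sw.orbit_shift_tendsto(2)[OF I(1) g0] in auto)
qed

text \<open>The interval from \<open>x0\<close> to \<open>f x0\<close> is a fundamental domain.
  Summing the iterates of a ramp rising from 0 to 1 across it gives a function that increases by 1
  under \<open>f\<close>.\<close>

lemma translation_conjugacy_aux:
  assumes nofix: "\<And>y. y \<in> {0<..<1} \<Longrightarrow> f y \<noteq> y" and x0: "x0 \<in> {0<..<1}" "f x0 > x0"
  shows "\<exists>h. strict_mono_on {0<..<1} h \<and> h ` {0<..<1} = (UNIV :: real set) \<and>
    (\<forall>y\<in>{0<..<1}. h (f y) = h y + 1)"
proof -
  interpret sw: hyperbolic_action H S \<beta> \<alpha> \<rho> g f by (rule swap)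
  let ?U = "{0<..<1} :: real set"
  define c where "c y = max 0 (min 1 ((y - x0) / (f x0 - x0)))" for y
  have c_mono: "c y \<le> c z" if "y \<le> z" for y z
    using that x0 divide_right_mono[of "y - x0" "z - x0" "f x0 - x0"] unfolding c_def
    by (intro max.mono min.mono) auto
  have c0: "c y = 0" if "y \<le> x0" for y
    using that x0(2) unfolding c_def by (simp add: divide_nonpos_pos min.coboundedI2)
  have c1: "c y = 1" if "y \<ge> f x0" for y
    using that x0(2) unfolding c_def by (simp add: pos_le_divide_eq)
  have cmid: "c y = (y - x0) / (f x0 - x0)" if "x0 \<le> y" "y \<le> f x0" for y
    using that x0(2) unfolding c_def by (simp add: pos_divide_le_eq)
  have I: "y \<in> {0..1}" if "y \<in> ?U" for y using that by auto
  have lims: "(\<lambda>n. (f ^^ n) y) \<longlonglongrightarrow> 1" "(\<lambda>n. (g ^^ n) y) \<longlonglongrightarrow> 0" if "y \<in> ?U" for y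
    using orbits_tendsto_endpoints[OF _ x0 that] nofix by blast+
  have fx0: "f x0 \<in> ?U" using x0 by (intro f_in_open)
  \<comment> \<open>The ramp is eventually 1 along forward orbits and 0 along backward orbits, so
    after subtracting 1 in \<open>P\<close> both series are finite sums. \<open>Q\<close> starts at
    exponent 1 so that each iterate is counted once.\<close>
  define P where "P y n = c ((f ^^ n) y) - 1" for y n
  define Q where "Q y n = c ((g ^^ Suc n) y)" for y n
  define h where "h y = suminf (P y) + suminf (Q y)" for y
  have sumP: "summable (P y)" if y: "y \<in> ?U" for y
  proof -
    obtain N where N: "\<And>n. n \<ge> N \<Longrightarrow> (f ^^ n) y > f x0"
      using order_tendstoD(1)[OF lims(1)[OF y], of "f x0"] fx0 by (auto simp: eventually_sequentially)
    show ?thesis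
      by (rule summable_finite[of "{..<N}"]) (use N c1 in \<open>auto simp: P_def not_less less_imp_le\<close>)
  qed
  have sumQ: "summable (Q y)" if y: "y \<in> ?U" for y
  proof -
    obtain N where N: "\<And>n. n \<ge> N \<Longrightarrow> (g ^^ n) y < x0"
      using order_tendstoD(2)[OF lims(2)[OF y], of x0] x0 by (auto simp: eventually_sequentially)
    have "(g ^^ Suc n) y \<le> x0" if "\<not> n < N" for n using N[of "Suc n"] that by simp
    then show ?thesis
      by (intro summable_finite[of "{..<N}"]) (use c0 in \<open>auto simp: Q_def simp del: funpow.simps\<close>)
  qed
  \<comment> \<open>Passing to \<open>f y\<close> moves the term \<open>c y\<close> from
    \<open>P\<close>, where 1 is subtracted, to \<open>Q\<close>, where it is not.\<close>
  have hf: "h (f y) = h y + 1" if y: "y \<in> ?U" for y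
  proof -
    have fy: "f y \<in> ?U" by (intro f_in_open y)
    have Peq: "P (f y) = (\<lambda>n. P y (Suc n))" by (simp add: fun_eq_iff P_def funpow_swap1)
    have "P y 0 = c y - 1" by (simp add: P_def)
    then have 1: "suminf (P (f y)) = suminf (P y) - (c y - 1)"
      using suminf_split_head[OF sumP[OF y]] by (simp add: Peq)
    have "(g ^^ Suc (Suc n)) (f y) = (g ^^ Suc n) y" for n
      using g_f[OF I[OF y]] by (simp add: funpow_swap1)
    then have Qeq: "Q y = (\<lambda>n. Q (f y) (Suc n))" by (simp add: fun_eq_iff Q_def del: funpow.simps)
    have "Q (f y) 0 = c y" using g_f[OF I[OF y]] by (simp add: Q_def)
    then have 2: "suminf (Q y) = suminf (Q (f y)) - c y"
      using suminf_split_head[OF sumQ[OF fy]] by (simp add: Qeq)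
    show ?thesis using 1 2 by (simp add: h_def)
  qed
  have mono: "h y \<le> h z" if "y \<in> ?U" "z \<in> ?U" "y \<le> z" for y z
    unfolding h_def using that I sumP sumQ
    by (intro add_mono suminf_le)
      (auto simp: P_def Q_def f_pow_le_iff sw.f_pow_le_iff simp del: funpow.simps atLeastAtMost_iff intro!: c_mono)
  have h_mid: "h y = c y - 1" if y: "x0 \<le> y" "y \<le> f x0" for y
  proof -
    have yU: "y \<in> ?U" using y x0 fx0 by auto
    have "f x0 \<le> (f ^^ n) y" if "n > 0" for n
      using that
    proof (induction n)
      case (Suc n)
      have "x0 \<le> (f ^^ n) y" using Suc y x0(2) by (cases "n = 0") auto
      then show ?case using f_pow_in_open[OF yU, of n] x0(1) I f_le_iff[of x0 "(f ^^ n) y"] by auto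
    qed simp
    then have "suminf (P y) = (\<Sum>n\<in>{0}. P y n)"
      by (intro suminf_finite) (auto simp: P_def c1)
    moreover have "(g ^^ Suc n) y \<le> x0" for n
    proof (induction n)
      case 0
      have "g y \<le> g (f x0)" using y yU fx0 I by (subst sw.f_le_iff) auto
      then show ?case using g_f[OF I[OF x0(1)]] by simp
    next
      case (Suc n)
      have "g ((g ^^ Suc n) y) \<le> g x0"
        using Suc g_pow_in_open[OF yU, of "Suc n"] x0 I by (subst sw.f_le_iff) (auto simp del: funpow.simps)
      also have "g x0 \<le> x0" using x0(2) sw.g_greater_iff[OF I[OF x0(1)]] by simp
      finally show ?case by simp
    qed
    then have "Q y = (\<lambda>_. 0)"
      by (simp add: fun_eq_iff Q_def c0 del: funpow.simps)
    then have "suminf (Q y) = 0" by simp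
    ultimately show ?thesis by (simp add: h_def P_def)
  qed
  have hfn: "h ((f ^^ n) y) = h y + real n" if y: "y \<in> ?U" for y n
    by (induction n) (use f_pow_in_open[OF y] hf in \<open>auto simp del: greaterThanLessThan_iff\<close>)
  have hgn: "h ((g ^^ n) y) = h y - real n" if y: "y \<in> ?U" for y n
    using hfn[OF g_pow_in_open[OF y, of n], of n] f_pow_g_pow[OF I[OF y], of n] by simp
  have strict_mid: "h z < h v" if z: "x0 \<le> z" "z < f x0" and v: "v \<in> ?U" "z < v" for z v
  proof -
    define v' where "v' = min v (f x0)"
    have v': "z < v'" "v' \<le> f x0" "v' \<le> v" using z v by (auto simp: v'_def)
    have "c z < c v'" using z v' x0(2) by (simp add: cmid divide_strict_right_mono)
    then have "h z < h v'" using z v' by (simp add: h_mid)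
    also have "\<dots> \<le> h v" using v' z x0 fx0 v by (intro mono) auto
    finally show ?thesis .
  qed
  \<comment> \<open>The first time at which the orbit of \<open>x0\<close> passes \<open>y\<close>
    tells which iterate of the fundamental domain contains \<open>y\<close>.\<close>
  have reduce: "\<exists>n z. x0 \<le> z \<and> z < f x0 \<and> (y = (f ^^ n) z \<or> y = (g ^^ n) z)" if y: "y \<in> ?U" for y
  proof (cases "x0 \<le> y")
    case True
    obtain N where "(f ^^ N) x0 > y"
      using order_tendstoD(1)[OF lims(1)[OF x0(1)], of y] y by (auto simp: eventually_sequentially)
    then obtain k where k: "(f ^^ k) x0 \<le> y" "y < (f ^^ Suc k) x0"
      using ex_least_nat_less[of "\<lambda>n. (f ^^ n) x0 > y" N] True by (auto simp: not_less)
    define z where "z = (g ^^ k) y"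
    have yz: "y = (f ^^ k) z" using f_pow_g_pow[OF I[OF y]] by (simp add: z_def)
    have zI: "z \<in> {0..1}" using g_pow_in_open[OF y] I unfolding z_def by blast
    have "x0 \<le> z" using k(1) f_pow_le_iff[OF I[OF x0(1)] zI, of k] yz by simp
    moreover have "z < f x0"
      using k(2) f_pow_less_iff[OF zI I[OF fx0], of k] yz by (simp add: funpow_swap1)
    ultimately show ?thesis using yz by blast
  next
    case False
    obtain N where "(g ^^ N) x0 < y"
      using order_tendstoD(2)[OF lims(2)[OF x0(1)], of y] y by (auto simp: eventually_sequentially)
    then obtain k where k: "(g ^^ k) x0 > y" "y \<ge> (g ^^ Suc k) x0"
      using ex_least_nat_less[of "\<lambda>n. (g ^^ n) x0 \<le> y" N] False by (auto simp: not_le less_imp_le)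
    define z where "z = (f ^^ Suc k) y"
    have yz: "y = (g ^^ Suc k) z" using sw.f_pow_g_pow[OF I[OF y]] unfolding z_def by metis
    have zI: "z \<in> {0..1}" using f_pow_in_open[OF y] I unfolding z_def by blast
    have "x0 \<le> z" using k(2) sw.f_pow_le_iff[OF I[OF x0(1)] zI, of "Suc k"] yz by simp
    moreover have "(g ^^ Suc k) (f x0) = (g ^^ k) x0"
      using g_f[OF I[OF x0(1)]] by (simp add: funpow_swap1)
    then have "z < f x0"
      using k(1) sw.f_pow_less_iff[OF zI I[OF fx0], of "Suc k"] yz by simp
    ultimately show ?thesis using yz by blast
  qed
  have strict: "h u < h v" if uv: "u \<in> ?U" "v \<in> ?U" "u < v" for u v
  proof -
    obtain n z where z: "x0 \<le> z" "z < f x0" "u = (f ^^ n) z \<or> u = (g ^^ n) z"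
      using reduce[OF uv(1)] by blast
    have zU: "z \<in> ?U" using z x0 fx0 by auto
    from z(3) show ?thesis
    proof
      assume u: "u = (f ^^ n) z"
      define v' where "v' = (g ^^ n) v"
      have v: "v = (f ^^ n) v'" "v' \<in> ?U" using f_pow_g_pow[OF I[OF uv(2)]] g_pow_in_open[OF uv(2)] by (simp_all add: v'_def)
      then have "z < v'" using uv(3) f_pow_less_iff[OF I[OF zU] I[OF v(2)], of n] u by simp
      then show ?thesis using strict_mid[OF z(1,2) v(2)] hfn[OF zU, of n] hfn[OF v(2), of n] u v by simp
    next
      assume u: "u = (g ^^ n) z"
      define v' where "v' = (f ^^ n) v"
      have v: "v = (g ^^ n) v'" "v' \<in> ?U" using sw.f_pow_g_pow[OF I[OF uv(2)]] f_pow_in_open[OF uv(2)] by (simp_all add: v'_def)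
      then have "z < v'" using uv(3) sw.f_pow_less_iff[OF I[OF zU] I[OF v(2)], of n] u by simp
      then show ?thesis using strict_mid[OF z(1,2) v(2)] hgn[OF zU, of n] hgn[OF v(2), of n] u v by simp
    qed
  qed
  have surj: "\<exists>y\<in>?U. h y = r" for r
  proof -
    \<comment> \<open>On the fundamental domain without its right end point, \<open>h\<close> lies
      in \<open>[-1, 0)\<close>, hence the shift by 1.\<close>
    define k where "k = \<lfloor>r\<rfloor> + 1"
    define z where "z = x0 + frac r * (f x0 - x0)"
    have "frac r * (f x0 - x0) < 1 * (f x0 - x0)"
      using x0(2) frac_lt_1 by (intro mult_strict_right_mono) auto
    then have "x0 + frac r * (f x0 - x0) < x0 + 1 * (f x0 - x0)" by (rule add_strict_left_mono)
    also have "x0 + 1 * (f x0 - x0) = f x0" by simp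
    finally have "z < f x0" by (simp only: z_def)
    moreover have "x0 \<le> z" using x0(2) by (simp add: z_def)
    ultimately have z: "x0 \<le> z" "z < f x0" by auto
    have zU: "z \<in> ?U" using z x0 fx0 by auto
    have "h z = frac r - 1" using z h_mid[of z] cmid[of z] x0(2) by (simp add: z_def)
    then have hz: "h z = r - k" by (simp add: frac_def k_def)
    show ?thesis
    proof (cases "k \<ge> 0")
      case True
      then show ?thesis using hfn[OF zU, of "nat k"] hz f_pow_in_open[OF zU] by (intro bexI[of _ "(f ^^ nat k) z"]) auto
    next
      case False
      then show ?thesis using hgn[OF zU, of "nat (- k)"] hz g_pow_in_open[OF zU]
        by (intro bexI[of _ "(g ^^ nat (- k)) z"]) auto
    qed
  qed
  show ?thesis
  proof (intro exI conjI ballI)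
    show "strict_mono_on ?U h" using strict by (intro strict_mono_onI)
    show "h ` ?U = UNIV" using surj by (auto simp: image_def) (metis greaterThanLessThan_iff)
  qed (use hf in auto)
qed

text \<open>If \<open>f\<close> moves the midpoint to the left, \<open>g\<close> is conjugated to
  the translation by 1, and so \<open>f\<close> to that by -1.\<close>

lemma translation_conjugacy:
  assumes nofix: "\<And>y. y \<in> {0<..<1} \<Longrightarrow> f y \<noteq> y"
  shows "\<exists>h t. strict_mono_on {0<..<1} h \<and> h ` {0<..<1} = (UNIV :: real set) \<and>
    (\<forall>y\<in>{0<..<1}. h (f y) = h y + t)"
proof -
  interpret sw: hyperbolic_action H S \<beta> \<alpha> \<rho> g f by (rule swap)
  let ?x0 = "1 / 2 :: real"
  have x0: "?x0 \<in> {0<..<1}" "?x0 \<in> {0..1}" by auto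
  consider "f ?x0 > ?x0" | "f ?x0 < ?x0" using nofix[OF x0(1)] by linarith
  then show ?thesis
  proof cases
    case 1
    then show ?thesis using translation_conjugacy_aux[OF nofix x0(1)] by blast
  next
    case 2
    then have "g ?x0 > ?x0" using g_greater_iff[OF x0(2)] by simp
    then obtain h where h: "strict_mono_on {0<..<1} h" "h ` {0<..<1} = (UNIV :: real set)"
      "\<forall>y\<in>{0<..<1}. h (g y) = h y + 1"
      using sw.translation_conjugacy_aux[OF g_no_fixed[OF nofix] x0(1)] by blast
    have "h (f y) = h y + - 1" if "y \<in> {0<..<1}" for y
    proof -
      have "h (g (f y)) = h (f y) + 1" using h(3) f_in_open[OF that] by blast
      then show ?thesis using g_f[of y] that by simp
    qed
    then show ?thesis using h by blast
  qed
qed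

text \<open>Either \<open>H\<close> has no fixed point in the open interval, or it acts trivially
  and only \<open>f\<close> remains to be conjugated, with \<open>m = 1\<close> and
  \<open>l = 0\<close>.\<close>

theorem conjugate_to_affine:
  assumes noglob: "\<not> (\<exists>t\<in>{0<..<1}. f t = t \<and> (\<forall>b\<in>H. \<rho> b t = t))"
  shows "\<exists>h m t l. strict_mono_on {0<..<1} h \<and> h ` {0<..<1} = (UNIV :: real set) \<and> m > 0 \<and>
    (\<forall>y\<in>{0<..<1}. h (f y) = m * h y + t) \<and> (\<forall>b\<in>H. \<forall>y\<in>{0<..<1}. h (\<rho> b y) = h y + l b)"
proof (cases "\<exists>t\<in>{0<..<1}. t \<in> fixed")
  case False
  then show ?thesis by (intro affine_conjugacy) blast
next
  case True
  then obtain z where z: "z \<in> fixed" "z \<in> {0<..<1}" by blast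
  have noglob': "\<not> (\<exists>t\<in>{0<..<1}. t \<in> fixed \<and> f t = t)" using noglob by (auto simp: fixed_def)
  have triv: "\<rho> b y = y" if "b \<in> H" "y \<in> {0<..<1}" for b y
    using trivial_of_fixed_point[OF noglob' z that(2)] that by (auto simp: fixed_def)
  obtain h t where h: "strict_mono_on {0<..<1} h" "h ` {0<..<1} = (UNIV :: real set)"
    "\<forall>y\<in>{0<..<1}. h (f y) = h y + t"
    using translation_conjugacy no_fixed_point_of_f[OF noglob' z] by metis
  show ?thesis
    by (rule exI[of _ h], rule exI[of _ 1], rule exI[of _ t], rule exI[of _ "\<lambda>_. 0"])
      (use h triv in auto)
qed

end

section \<open>Subgroups of rational vector spaces\<close>

text \<open>Rational vectors become functions with pointwise operations, a ring in which integer
  multiples take the form used above.\<close>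

lemma of_int_fun_apply [simp]: "(of_int k :: 'a \<Rightarrow> 'b::comm_ring_1) x = of_int k"
  by (cases k rule: int_cases2) simp_all

lemma sum_fun_apply:
  fixes F :: "'c \<Rightarrow> 'a \<Rightarrow> 'b::comm_ring_1"
  shows "sum F I x = (\<Sum>i\<in>I. F i x)"
  by (induction I rule: infinite_finite_induct) auto

text \<open>Induction on the number of coordinates that may be nonzero. One element \<open>c\<close>
  with nonzero coordinate \<open>k\<close> suffices as a new generator: subtracting an integer
  multiple of \<open>c\<close> from a positive multiple of any \<open>b\<close> kills that
  coordinate.\<close>

lemma finite_rank_subgroup_of_rational_vectors:
  fixes H :: "(nat \<Rightarrow> rat) set"
  assumes H: "add_subgroup H"
  shows "\<exists>S. finite_rank_group {b \<in> H. \<forall>i\<ge>k. b i = 0} S"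
proof (induction k)
  case 0
  interpret add_subgroup H by (rule H)
  have "{b \<in> H. \<forall>i\<ge>0. b i = 0} = {0}" by (auto simp: fun_eq_iff)
  moreover have "finite_rank_group {0 :: nat \<Rightarrow> rat} {}"
    by unfold_locales (auto simp: add_subgroup_def)
  ultimately show ?case by metis
next
  case (Suc k)
  interpret add_subgroup H by (rule H)
  define K where "K j = {b \<in> H. \<forall>i\<ge>j. b i = 0}" for j
  have K: "add_subgroup (K j)" for j
    by unfold_locales (auto simp: K_def diff_in)
  obtain S where "finite_rank_group (K k) S" using Suc unfolding K_def by blast
  then interpret S: finite_rank_group "K k" S .
  have Kk: "b \<in> K k" if "b \<in> K (Suc k)" "b k = 0" for b
    using that unfolding K_def by (auto simp: le_Suc_eq) (metis not_less_eq_eq le_antisym)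
  have K_mono: "K k \<subseteq> K (Suc k)" unfolding K_def by auto
  show ?case
  proof (cases "\<exists>c\<in>K (Suc k). c k \<noteq> 0")
    case False
    then have "K (Suc k) = K k" using Kk K_mono by blast
    then show ?thesis using S.finite_rank_group_axioms unfolding K_def by auto
  next
    case True
    then obtain c where c: "c \<in> K (Suc k)" "c k \<noteq> 0" by blast
    interpret K': add_subgroup "K (Suc k)" by (rule K)
    have "finite_rank_group (K (Suc k)) (insert c S)"
    proof unfold_locales
      show "finite (insert c S)" using S.finite_S by simp
      show "insert c S \<subseteq> K (Suc k)" using c S.S_sub K_mono by auto
      fix T assume T: "T \<subseteq> K (Suc k)" "insert c S \<subseteq> T" "add_subgroup T"
        "\<And>b j. b \<in> K (Suc k) \<Longrightarrow> j > 0 \<Longrightarrow> of_int j * b \<in> T \<Longrightarrow> b \<in> T"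
      interpret T: add_subgroup T by (rule T(3))
      have "K k \<subseteq> T \<inter> K k"
      proof (rule S.isolated)
        show "add_subgroup (T \<inter> K k)" by unfold_locales auto
        show "b \<in> T \<inter> K k" if "b \<in> K k" "j > 0" "of_int j * b \<in> T \<inter> K k" for b j
          using that K_mono T(4)[of b j] by auto
      qed (use T(2) S.S_sub in auto)
      then have KT: "K k \<subseteq> T" by blast
      show "K (Suc k) \<subseteq> T"
      proof
        fix b assume b: "b \<in> K (Suc k)"
        obtain p q where pq: "quotient_of (b k / c k) = (p, q)" by fastforce
        have q: "q > 0" by (rule quotient_of_denom_pos[OF pq])
        have eq: "b k / c k = of_int p / of_int q" by (rule quotient_of_div[OF pq])
        let ?x = "of_int q * b - of_int p * c"
        have "?x \<in> K k"
        proof (rule Kk)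
          show "?x \<in> K (Suc k)" using b c by (intro K'.diff_in K'.of_int_mult_in)
          show "?x k = 0" using eq q c(2) by (simp add: field_simps)
        qed
        then have "?x + of_int p * c \<in> T" using T(2) KT by (intro T.plus_in T.of_int_mult_in) auto
        then have "of_int q * b \<in> T" by simp
        then show "b \<in> T" using T(4)[OF b q] by blast
      qed
    qed
    then show ?thesis unfolding K_def by blast
  qed
qed

section \<open>Additive functionals and hyperbolic rational matrices\<close>

lemma (in add_subgroup) additive_sum:
  assumes l: "additive_on H l" and "\<And>i. i \<in> I \<Longrightarrow> F i \<in> H"
  shows "l (\<Sum>i\<in>I. F i) = (\<Sum>i\<in>I. l (F i)) \<and> (\<Sum>i\<in>I. F i) \<in> H"
  using assms(2)
  by (induction I rule: infinite_finite_induct)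
    (auto simp: additive_zero[OF l] additive_plus[OF l] plus_in)

lemma common_denominator:
  fixes c :: "'i \<Rightarrow> rat"
  assumes "finite I"
  obtains N z where "N > (0::int)" "\<And>i. i \<in> I \<Longrightarrow> of_int N * c i = of_int (z i)"
proof -
  have "\<exists>N>(0::int). \<forall>i\<in>I. of_int N * c i \<in> \<int>"
    using assms
  proof (induction I rule: finite_induct)
    case empty
    then show ?case by (intro exI[of _ 1]) auto
  next
    case (insert i I)
    then obtain N :: int where N: "N > 0" "\<And>j. j \<in> I \<Longrightarrow> of_int N * c j \<in> \<int>" by blast
    obtain p q where pq: "quotient_of (c i) = (p, q)" by fastforce
    have q: "q > 0" by (rule quotient_of_denom_pos[OF pq])
    have ci: "c i = of_int p / of_int q" by (rule quotient_of_div[OF pq])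
    have "of_int (N * q) * c i = of_int (N * p)" using q by (simp add: ci)
    then have "of_int (N * q) * c i \<in> \<int>" by (metis Ints_of_int)
    moreover have "of_int (N * q) * c j \<in> \<int>" if "j \<in> I" for j
    proof -
      have "of_int (N * q) * c j = of_int q * (of_int N * c j)" by simp
      then show ?thesis using N(2)[OF that] by (metis Ints_mult Ints_of_int)
    qed
    ultimately show ?case using N(1) q by (intro exI[of _ "N * q"]) auto
  qed
  then obtain N :: int where N: "N > 0" "\<And>i. i \<in> I \<Longrightarrow> of_int N * c i \<in> \<int>" by blast
  have "\<forall>i\<in>I. \<exists>z. of_int N * c i = of_int z" using N(2) by (auto elim: Ints_cases)
  then show thesis using that N(1) by metis
qed

text \<open>Cayley--Hamilton gives a recurrence for the orbit of \<open>b\<close>. An additive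
  functional on a subgroup respects integer coefficients, so denominators are cleared first; the
  values of \<open>l\<close> then satisfy a hyperbolic recurrence and vanish by subexponential
  growth.\<close>

lemma functional_eq_0_of_hyperbolic_matrix:
  fixes A :: "rat mat" and H :: "(nat \<Rightarrow> rat) set"
  assumes H: "add_subgroup H" and A: "A \<in> carrier_mat d d"
    and hyp: "\<And>k :: complex. eigenvalue (map_mat of_rat A) k \<Longrightarrow> cmod k \<noteq> 1"
    and supp: "\<And>b i. b \<in> H \<Longrightarrow> i \<ge> d \<Longrightarrow> b i = 0"
    and \<alpha>_in: "\<And>b. b \<in> H \<Longrightarrow> \<alpha> b \<in> H" and \<beta>_in: "\<And>b. b \<in> H \<Longrightarrow> \<beta> b \<in> H"
    and \<alpha>_\<beta>: "\<And>b. b \<in> H \<Longrightarrow> \<alpha> (\<beta> b) = b"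
    and \<alpha>: "\<And>b i. b \<in> H \<Longrightarrow> i < d \<Longrightarrow> \<alpha> b i = (\<Sum>j<d. A $$ (i, j) * b j)"
    and l: "additive_on H l" and b: "b \<in> H"
    and grow_\<alpha>: "\<And>\<mu>. \<mu> > 1 \<Longrightarrow> \<exists>C. \<forall>n. \<bar>l ((\<alpha> ^^ n) b)\<bar> \<le> C * \<mu> ^ n"
    and grow_\<beta>: "\<And>\<mu>. \<mu> > 1 \<Longrightarrow> \<exists>C. \<forall>n. \<bar>l ((\<beta> ^^ n) b)\<bar> \<le> C * \<mu> ^ n"
  shows "l b = 0"
proof -
  interpret add_subgroup H by (rule H)
  \<comment> \<open>The two-sided orbit of \<open>\<alpha>\<close>, with \<open>\<beta>\<close>
    supplying the past.\<close>
  define orb where "orb n = (if n \<ge> 0 then (\<alpha> ^^ nat n) b else (\<beta> ^^ nat (- n)) b)" for n :: int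
  define s where "s n = complex_of_real (l (orb n))" for n
  have pow_in: "(\<alpha> ^^ n) c \<in> H" "(\<beta> ^^ n) c \<in> H" if "c \<in> H" for n c
    by (induction n) (use that \<alpha>_in \<beta>_in in auto)
  have orb_in: "orb n \<in> H" for n unfolding orb_def using pow_in b by auto
  have orb_Suc: "orb (n + 1) = \<alpha> (orb n)" for n
  proof (cases "n \<ge> 0")
    case True
    then show ?thesis by (simp add: orb_def nat_add_distrib)
  next
    case False
    then obtain j where j: "n = - int (Suc j)" by (metis int_cases not_le of_nat_0_le_iff)
    have "nat (- n) = Suc j" using j by simp
    with False have "orb n = \<beta> ((\<beta> ^^ j) b)" unfolding orb_def by simp
    then have "\<alpha> (orb n) = (\<beta> ^^ j) b" using \<alpha>_\<beta> pow_in b by simp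
    then show ?thesis unfolding j by (auto simp: orb_def)
  qed
  have orb_add: "orb (n + int i) = (\<alpha> ^^ i) (orb n)" for n i
  proof (induction i)
    case (Suc i)
    have "orb (n + int (Suc i)) = orb ((n + int i) + 1)" by (simp add: ac_simps)
    then show ?case using Suc by (simp only: orb_Suc) simp
  qed simp
  let ?p = "char_poly A"
  obtain N z where N: "N > 0" and z: "\<And>i. i \<in> {..degree ?p} \<Longrightarrow> of_int N * coeff ?p i = of_int (z i)"
    using common_denominator[of "{..degree ?p}" "coeff ?p"] by blast
  have rel: "(\<Sum>i\<le>degree ?p. of_int (z i) * orb (n + int i)) = 0" for n
  proof
    fix k
    show "(\<Sum>i\<le>degree ?p. of_int (z i) * orb (n + int i)) k = 0 k"
    proof (cases "k < d")
      case False
      then show ?thesis using supp[OF orb_in] by (simp add: sum_fun_apply)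
    next
      case True
      have "shift_op ?p (\<lambda>m. (\<alpha> ^^ m) (orb n) k) 0 = 0"
        by (rule cayley_hamilton_sequence[OF A _ True, of "\<lambda>k m. (\<alpha> ^^ m) (orb n) k"])
          (simp add: \<alpha> pow_in orb_in)
      then have "(\<Sum>i\<le>degree ?p. coeff ?p i * orb (n + int i) k) = 0"
        by (simp add: shift_op_def orb_add)
      moreover have "(\<Sum>i\<le>degree ?p. of_int (z i) * orb (n + int i) k)
          = of_int N * (\<Sum>i\<le>degree ?p. coeff ?p i * orb (n + int i) k)"
        unfolding sum_distrib_left by (intro sum.cong) (simp_all add: z[symmetric])
      ultimately have "(\<Sum>i\<le>degree ?p. of_int (z i) * orb (n + int i) k) = 0" by simp
      then show ?thesis by (simp add: sum_fun_apply)
    qed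
  qed
  have lrel: "(\<Sum>i\<le>degree ?p. of_int (z i) * l (orb (n + int i))) = 0" for n
  proof -
    have "l (\<Sum>i\<le>degree ?p. of_int (z i) * orb (n + int i)) = (\<Sum>i\<le>degree ?p. l (of_int (z i) * orb (n + int i)))"
      using additive_sum[OF l, of "{..degree ?p}" "\<lambda>i. of_int (z i) * orb (n + int i)"] orb_in by blast
    then show ?thesis
      unfolding rel additive_zero[OF l] by (simp add: additive_of_int_mult[OF l orb_in])
  qed
  let ?q = "map_poly of_rat ?p :: complex poly"
  \<comment> \<open>The complex roots of this polynomial are the eigenvalues, none of which has norm
    1.\<close>
  have q: "char_poly (map_mat of_rat A) = ?q" by (rule of_rat_hom.char_poly_hom[OF A])
  have "s 0 = 0"
  proof (rule subexp_hyperbolic_recurrence_eq_0)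
    have "coeff ?q (degree ?p) = 1"
      using degree_monic_char_poly[OF A] by (simp add: coeff_map_poly)
    then show "?q \<noteq> 0" by auto
    show "cmod k \<noteq> 1" if "poly ?q k = 0" for k
      using hyp[of k] that eigenvalue_root_char_poly[of "map_mat of_rat A" d k] A q by auto
    show "subexp s" unfolding subexp_def
    proof (intro allI impI)
      fix \<mu> :: real assume \<mu>: "\<mu> > 1"
      obtain C where C: "\<And>n. \<bar>l ((\<alpha> ^^ n) b)\<bar> \<le> C * \<mu> ^ n" using grow_\<alpha>[OF \<mu>] by blast
      obtain D where D: "\<And>n. \<bar>l ((\<beta> ^^ n) b)\<bar> \<le> D * \<mu> ^ n" using grow_\<beta>[OF \<mu>] by blast
      have "cmod (s n) \<le> max C D * \<mu> ^ nat \<bar>n\<bar>" for n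
      proof (cases "n \<ge> 0")
        case True
        then have "cmod (s n) \<le> C * \<mu> ^ nat \<bar>n\<bar>" using C[of "nat n"] by (simp add: s_def orb_def)
        also have "\<dots> \<le> max C D * \<mu> ^ nat \<bar>n\<bar>" using \<mu> by (intro mult_right_mono) auto
        finally show ?thesis .
      next
        case False
        then have "cmod (s n) \<le> D * \<mu> ^ nat \<bar>n\<bar>" using D[of "nat (- n)"] by (simp add: s_def orb_def)
        also have "\<dots> \<le> max C D * \<mu> ^ nat \<bar>n\<bar>" using \<mu> by (intro mult_right_mono) auto
        finally show ?thesis .
      qed
      then show "\<exists>C. \<forall>n. cmod (s n) \<le> C * \<mu> ^ nat \<bar>n\<bar>" by blast
    qed
    show "shift_op ?q s n = 0" for n
    proof -
      have "of_int N * (of_rat (coeff ?p i) :: complex) = of_int (z i)" if "i \<le> degree ?p" for i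
        using arg_cong[OF z[of i], of "of_rat :: rat \<Rightarrow> complex"] that by (simp add: of_rat_mult)
      then have "of_int N * shift_op ?q s n = (\<Sum>i\<le>degree ?p. of_int (z i) * s (n + int i))"
        unfolding shift_op_def sum_distrib_left
        by (intro sum.cong) (simp_all add: coeff_map_poly mult.assoc[symmetric])
      also have "\<dots> = complex_of_real (\<Sum>i\<le>degree ?p. of_int (z i) * l (orb (n + int i)))"
        by (simp add: s_def)
      also have "\<dots> = 0" by (simp only: lrel) simp
      finally show ?thesis using N by simp
    qed
  qed
  then show ?thesis by (simp add: s_def orb_def)
qed

text \<open>A monotone function with open image is continuous, which applies to \<open>h\<close> and
  to its inverse.\<close>

lemma homeomorphism_of_strict_mono_surj:
  fixes h :: "real \<Rightarrow> real"
  assumes mono: "strict_mono_on {0<..<1} h" and surj: "h ` {0<..<1} = UNIV"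
  shows "homeomorphism {0<..<1} UNIV h (inv_into {0<..<1} h)"
proof -
  let ?U = "{0<..<1} :: real set"
  let ?k = "inv_into ?U h"
  have inj: "inj_on h ?U" using mono by (rule strict_mono_on_imp_inj_on)
  have k: "?k r \<in> ?U" "h (?k r) = r" for r
    using surj inv_into_into[of r h ?U] f_inv_into_f[of r h ?U] by auto
  have hk: "?k (h y) = y" if "y \<in> ?U" for y using inj that by simp
  have im: "?k ` UNIV = ?U"
  proof
    show "?k ` UNIV \<subseteq> ?U" using k by blast
    show "?U \<subseteq> ?k ` UNIV" using hk by (metis rangeI subsetI)
  qed
  have "continuous_on ?U h"
    by (rule continuous_onI_mono) (use surj strict_mono_on_leD[OF mono] in auto)
  moreover have "continuous_on UNIV ?k"
  proof (rule continuous_onI_mono)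
    show "open (range ?k)" unfolding im by simp
    show "?k r \<le> ?k s" if "r \<le> s" for r s
      using strict_mono_onD[OF mono k(1)[of s] k(1)[of r]] k(2)[of r] k(2)[of s] that by force
  qed
  ultimately show ?thesis unfolding homeomorphism_def using surj im k(2) hk by auto
qed

text \<open>The coordinate function is extended by zero, since the junk values of \<open>v $ i\<close> for
  \<open>i \<ge> d\<close> are unspecified.\<close>

definition coords :: "nat \<Rightarrow> rat Matrix.vec \<Rightarrow> nat \<Rightarrow> rat" where
  "coords d v = (\<lambda>i. if i < d then vec_index v i else 0)"

lemma coords_vec: "v \<in> carrier_vec d \<Longrightarrow> Matrix.vec d (coords d v) = v"
  by (auto simp: coords_def intro!: eq_vecI)

section \<open>Representations of the semidirect product\<close>

theorem theorem1p3:
  fixes d :: nat and A :: "rat mat" and H :: "rat Matrix.vec set"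
    and \<phi> :: "int \<times> rat Matrix.vec \<Rightarrow> real \<Rightarrow> real"
  defines "G \<equiv> Z_semidirect d A H"
  assumes "d \<ge> 1"
    and "A \<in> carrier (GL_Q d)"
    and "\<And>k :: complex. eigenvalue (map_mat of_rat A) k \<Longrightarrow> cmod k \<noteq> 1"
    and "subgroup H (Q_vec d)"
    and "(\<lambda>v. A *\<^sub>v v) ` H = H"
    and "Q_rank ((Q_vec d)\<lparr>carrier := H\<rparr>) = d"
    and "\<phi> \<in> hom G (Diff1_plus {0..1})"
    and "\<not> (\<exists>x\<in>{0<..<1}. \<forall>g\<in>carrier G. \<phi> g x = x)"
  shows "\<exists>\<psi> h h'. \<psi> \<in> hom G Aff_plus \<and>
           homeomorphism {0<..<1} (UNIV :: real set) h h' \<and>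
           (\<forall>g\<in>carrier G. \<forall>x\<in>{0<..<1}. h (\<phi> g x) = \<psi> g (h x))"
proof -
  note A_GL = assms(3) and hyp = assms(4) and H_sub = assms(5) and AH = assms(6)
    and hom = assms(8) and noglob = assms(9)
  let ?U = "{0<..<1} :: real set"

  interpret GL: group "GL_Q d"
    unfolding GL_Q_def by (intro monoid.units_group ring.is_monoid ring_mat)
  have GL_carrier: "B \<in> carrier_mat d d" if "B \<in> carrier (GL_Q d)" for B
    using that unfolding GL_Q_def units_of_def Units_def ring_mat_def by auto
  have A: "A \<in> carrier_mat d d" by (rule GL_carrier[OF A_GL])
  have pow: "A [^]\<^bsub>GL_Q d\<^esub> (m :: int) \<in> carrier_mat d d" for m
    by (intro GL_carrier GL.int_pow_closed A_GL)
  have pow0: "\<one>\<^bsub>GL_Q d\<^esub> = 1\<^sub>m d"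
    by (simp add: GL_Q_def units_of_def ring_mat_def)
  have pow1: "A [^]\<^bsub>GL_Q d\<^esub> (1 :: int) = A"
    using A_GL by simp
  \<comment> \<open>A left inverse, from which \<open>A\<close> is seen to be injective on
    \<open>H\<close>.\<close>
  obtain B where B: "B \<in> carrier_mat d d" "B * A = 1\<^sub>m d"
    using A_GL unfolding GL_Q_def units_of_def Units_def ring_mat_def by auto
  have mult0: "C *\<^sub>v 0\<^sub>v d = 0\<^sub>v d" if "C \<in> carrier_mat d d" for C :: "rat mat"
    using that by (auto intro!: eq_vecI)

  have H_carrier: "v \<in> carrier_vec d" if "v \<in> H" for v
    using subgroup.subset[OF H_sub] that by (auto simp: monoid_vec_def)
  have H0: "0\<^sub>v d \<in> H" using subgroup.one_closed[OF H_sub] by (simp add: monoid_vec_def)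
  have H_add: "v + w \<in> H" if "v \<in> H" "w \<in> H" for v w
    using subgroup.m_closed[OF H_sub that] by (simp add: monoid_vec_def)
  interpret Q: comm_group "Q_vec d" by (rule comm_group_vec)
  have H_uminus: "- v \<in> H" if v: "v \<in> H" for v
  proof -
    have "inv\<^bsub>Q_vec d\<^esub> v = - v"
      by (rule Q.inv_equality) (use H_carrier[OF v] in \<open>auto simp: monoid_vec_def\<close>)
    then show ?thesis using subgroup.m_inv_closed[OF H_sub v] by simp
  qed

  have mult_G: "(m, b) \<otimes>\<^bsub>G\<^esub> (n, b') = (m + n, b + (A [^]\<^bsub>GL_Q d\<^esub> m) *\<^sub>v b')" for m b n b'
    by (simp add: G_def Z_semidirect_def)
  have carrier_G: "carrier G = UNIV \<times> H" by (simp add: G_def Z_semidirect_def)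
  have phi_carrier: "\<phi> x \<in> Bij {0..1}" "C1_within (\<phi> x) {0..1}" "strict_mono_on {0..1} (\<phi> x)"
    if "x \<in> carrier G" for x
    using hom that unfolding hom_def Diff1_plus_def by auto
  have phi_in: "\<phi> x y \<in> {0..1}" if "x \<in> carrier G" "y \<in> {0..1}" for x y
    using Bij_imp_funcset[OF phi_carrier(1)[OF that(1)]] that(2) by blast
  \<comment> \<open>The product \<open>compose\<close> agrees with the composite only on the
    interval, hence the condition on \<open>y\<close>.\<close>
  have phi_mult: "\<phi> (x \<otimes>\<^bsub>G\<^esub> x') y = \<phi> x (\<phi> x' y)"
    if "x \<in> carrier G" "x' \<in> carrier G" "y \<in> {0..1}" for x x' y
  proof -
    have "\<phi> (x \<otimes>\<^bsub>G\<^esub> x') = \<phi> x \<otimes>\<^bsub>Diff1_plus {0..1}\<^esub> \<phi> x'"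
      using hom that by (simp add: hom_def)
    also have "\<dots> = compose {0..1} (\<phi> x) (\<phi> x')"
      using phi_carrier(1) that by (simp add: Diff1_plus_def BijGroup_def)
    finally show ?thesis using that(3) by (simp add: compose_def)
  qed
  have b_add: "\<phi> (0, b + c) y = \<phi> (0, b) (\<phi> (0, c) y)" if "b \<in> H" "c \<in> H" "y \<in> {0..1}" for b c y
    using phi_mult[of "(0, b)" "(0, c)" y] that H_carrier by (simp add: carrier_G mult_G pow0)
  \<comment> \<open>An injective idempotent map is the identity.\<close>
  have b_zero: "\<phi> (0, 0\<^sub>v d) y = y" if "y \<in> {0..1}" for y
  proof -
    have "inj_on (\<phi> (0, 0\<^sub>v d)) {0..1}"
      using phi_carrier(3)[of "(0, 0\<^sub>v d)"] H0 by (intro strict_mono_on_imp_inj_on) (simp add: carrier_G)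
    moreover have "\<phi> (0, 0\<^sub>v d) (\<phi> (0, 0\<^sub>v d) y) = \<phi> (0, 0\<^sub>v d) y"
      using b_add[OF H0 H0 that] by simp
    moreover have "\<phi> (0, 0\<^sub>v d) y \<in> {0..1}" using H0 by (intro phi_in that) (simp add: carrier_G)
    ultimately show ?thesis using that by (rule inj_onD)
  qed
  \<comment> \<open>The pair \<open>(m, b)\<close> is the product of \<open>(0, b)\<close> and
    \<open>(m, 0\<^sub>v d)\<close>, in this order.\<close>
  have split: "\<phi> (m, b) y = \<phi> (0, b) (\<phi> (m, 0\<^sub>v d) y)" if "b \<in> H" "y \<in> {0..1}" for m b y
    using phi_mult[of "(0, b)" "(m, 0\<^sub>v d)" y] that H_carrier H0 by (simp add: carrier_G mult_G pow0)
  have m_add: "\<phi> (m + n, 0\<^sub>v d) y = \<phi> (m, 0\<^sub>v d) (\<phi> (n, 0\<^sub>v d) y)" if "y \<in> {0..1}" for m n y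
    using phi_mult[of "(m, 0\<^sub>v d)" "(n, 0\<^sub>v d)" y] that H0
    by (simp add: carrier_G mult_G mult0[OF pow])

  \<comment> \<open>Passing to functions with pointwise operations provides the ring type that the
    abstract setting asks for.\<close>
  define K where "K = coords d ` H"
  define \<rho> where "\<rho> b = \<phi> (0, Matrix.vec d b)" for b
  define f where "f = \<phi> (1, 0\<^sub>v d)"
  define g where "g = \<phi> (- 1, 0\<^sub>v d)"
  define \<alpha> where "\<alpha> b = coords d (A *\<^sub>v Matrix.vec d b)" for b
  define \<beta> where "\<beta> = inv_into K \<alpha>"
  have vec_H: "Matrix.vec d b \<in> H" if "b \<in> K" for b
    using that H_carrier unfolding K_def by (auto simp: coords_vec)
  have coords_add: "coords d (v + w) = coords d v + coords d w" if "v \<in> H" "w \<in> H" for v w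
    using H_carrier[OF that(1)] H_carrier[OF that(2)] by (auto simp: coords_def fun_eq_iff)
  have coords_uminus: "coords d (- v) = - coords d v" if "v \<in> H" for v
    using H_carrier[OF that] by (auto simp: coords_def fun_eq_iff)
  have vec_add: "Matrix.vec d (b + c) = Matrix.vec d b + Matrix.vec d c" for b c :: "nat \<Rightarrow> rat"
    by (auto intro!: eq_vecI)
  have K: "add_subgroup K"
  proof
    show "0 \<in> K" unfolding K_def by (rule image_eqI[OF _ H0]) (auto simp: coords_def fun_eq_iff)
    fix b c assume "b \<in> K" "c \<in> K"
    then obtain v w where vw: "v \<in> H" "w \<in> H" "b = coords d v" "c = coords d w" unfolding K_def by blast
    then have "b - c = coords d (v + - w)" by (simp add: coords_add coords_uminus H_uminus)
    then show "b - c \<in> K" unfolding K_def using vw H_add H_uminus by blast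
  qed
  have supp: "b i = 0" if "b \<in> K" "i \<ge> d" for b i
    using that by (auto simp: K_def coords_def)
  then have "{b \<in> K. \<forall>i\<ge>d. b i = 0} = K" by blast
  then obtain S where "finite_rank_group K S"
    using finite_rank_subgroup_of_rational_vectors[OF K, of d] by metis
  then interpret S: finite_rank_group K S .
  have alpha_coords: "\<alpha> (coords d v) = coords d (A *\<^sub>v v)" if "v \<in> H" for v
    using H_carrier[OF that] by (simp add: \<alpha>_def coords_vec)
  have alpha_image: "\<alpha> ` K = K"
  proof -
    have "\<alpha> ` K = (\<lambda>v. coords d (A *\<^sub>v v)) ` H"
      unfolding K_def image_image by (intro image_cong) (auto simp: alpha_coords)
    also have "\<dots> = coords d ` ((\<lambda>v. A *\<^sub>v v) ` H)" by (simp add: image_image)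
    finally show ?thesis by (simp add: AH K_def)
  qed
  have alpha_inj: "inj_on \<alpha> K"
  proof (rule inj_onI)
    fix b c assume bc: "b \<in> K" "c \<in> K" "\<alpha> b = \<alpha> c"
    then obtain v w where vw: "v \<in> H" "w \<in> H" "b = coords d v" "c = coords d w" unfolding K_def by blast
    then have "coords d (A *\<^sub>v v) = coords d (A *\<^sub>v w)" using bc alpha_coords by simp
    then have "A *\<^sub>v v = A *\<^sub>v w"
      using coords_vec[of "A *\<^sub>v v" d] coords_vec[of "A *\<^sub>v w" d] A by (metis mult_mat_vec_carrier H_carrier vw(1,2))
    then have "B *\<^sub>v (A *\<^sub>v v) = B *\<^sub>v (A *\<^sub>v w)" by simp
    then have "v = w"
      using assoc_mult_mat_vec[OF B(1) A H_carrier[OF vw(1)]] assoc_mult_mat_vec[OF B(1) A H_carrier[OF vw(2)]]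
        B(2) H_carrier vw(1,2) by simp
    then show "b = c" using vw by simp
  qed
  have alpha_in: "\<alpha> b \<in> K" and beta_in: "\<beta> b \<in> K" and alpha_beta: "\<alpha> (\<beta> b) = b" and beta_alpha: "\<beta> (\<alpha> b) = b"
    if "b \<in> K" for b
    using that alpha_image alpha_inj unfolding \<beta>_def
    by (auto simp: inv_into_into f_inv_into_f)
  have alpha_entry: "\<alpha> b i = (\<Sum>j<d. A $$ (i, j) * b j)" if "i < d" for b i
    using that A by (auto simp: \<alpha>_def coords_def scalar_prod_def lessThan_atLeast0 intro!: sum.cong)

  interpret hyperbolic_action K S \<alpha> \<beta> \<rho> f g
  proof
    show "\<alpha> (b + c) = \<alpha> b + \<alpha> c" for b c
      using A by (auto simp: \<alpha>_def coords_def vec_add mult_add_distrib_mat_vec[OF A])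
    show "l b = 0" if "additive_on K l" "b \<in> K"
      "\<And>\<mu>. \<mu> > 1 \<Longrightarrow> \<exists>C. \<forall>n. \<bar>l ((\<alpha> ^^ n) b)\<bar> \<le> C * \<mu> ^ n"
      "\<And>\<mu>. \<mu> > 1 \<Longrightarrow> \<exists>C. \<forall>n. \<bar>l ((\<beta> ^^ n) b)\<bar> \<le> C * \<mu> ^ n" for l b
      by (rule functional_eq_0_of_hyperbolic_matrix[where \<alpha> = \<alpha> and \<beta> = \<beta>, OF K A])
        (fact hyp supp alpha_in beta_in alpha_beta that | rule alpha_entry, assumption)+
    show "\<rho> b y \<in> {0..1}" if "b \<in> K" "y \<in> {0..1}" for b y
      unfolding \<rho>_def using vec_H[OF that(1)] that(2) by (intro phi_in) (simp_all add: carrier_G)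
    show "strict_mono_on {0..1} (\<rho> b)" "C1_within (\<rho> b) {0..1}" if "b \<in> K" for b
      unfolding \<rho>_def using phi_carrier vec_H[OF that] by (simp_all add: carrier_G)
    show "\<rho> (b + c) y = \<rho> b (\<rho> c y)" if "b \<in> K" "c \<in> K" "y \<in> {0..1}" for b c y
      unfolding \<rho>_def vec_add using that vec_H by (intro b_add)
    show "\<rho> 0 y = y" if "y \<in> {0..1}" for y
    proof -
      have "Matrix.vec d 0 = (0\<^sub>v d :: rat Matrix.vec)" by (auto intro!: eq_vecI)
      then show ?thesis using b_zero[OF that] by (simp add: \<rho>_def)
    qed
    show "f y \<in> {0..1}" "g y \<in> {0..1}" if "y \<in> {0..1}" for y
      unfolding f_def g_def using that H0 by (intro phi_in; simp add: carrier_G)+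
    show "f (g y) = y" "g (f y) = y" if "y \<in> {0..1}" for y
      using m_add[OF that, of 1 "- 1"] m_add[OF that, of "- 1" 1] b_zero[OF that] by (simp_all add: f_def g_def)
    show "strict_mono_on {0..1} f" "strict_mono_on {0..1} g" "C1_within f {0..1}" "C1_within g {0..1}"
      unfolding f_def g_def using H0 by (intro phi_carrier; simp add: carrier_G)+
    \<comment> \<open>The relation between the generator of the integers and \<open>H\<close> in the
      semidirect product.\<close>
    show "f (\<rho> b y) = \<rho> (\<alpha> b) (f y)" if "b \<in> K" "y \<in> {0..1}" for b y
    proof -
      let ?v = "Matrix.vec d b"
      have v: "?v \<in> H" by (rule vec_H[OF that(1)])
      have Av: "A *\<^sub>v ?v \<in> H" using AH v by blast
      have "f (\<rho> b y) = \<phi> (1, A *\<^sub>v ?v) y"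
        using phi_mult[of "(1, 0\<^sub>v d)" "(0, ?v)" y] v that(2) H0 H_carrier[OF Av]
        by (simp add: f_def \<rho>_def carrier_G mult_G pow1)
      also have "\<dots> = \<phi> (0, A *\<^sub>v ?v) (f y)" unfolding f_def by (rule split[OF Av that(2)])
      finally show ?thesis using H_carrier[OF Av] by (simp add: \<rho>_def \<alpha>_def coords_vec)
    qed
  qed (use alpha_in beta_in alpha_beta beta_alpha in auto)

  have rho_coords: "\<rho> (coords d v) = \<phi> (0, v)" if "v \<in> H" for v
    using H_carrier[OF that] by (simp add: \<rho>_def coords_vec)
  have UI: "y \<in> {0..1}" if "y \<in> ?U" for y using that by auto
  have phi_Suc: "\<phi> (m + 1, 0\<^sub>v d) y = \<phi> (m, 0\<^sub>v d) (f y)" and phi_pred: "\<phi> (m - 1, 0\<^sub>v d) y = \<phi> (m, 0\<^sub>v d) (g y)"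
    if "y \<in> {0..1}" for m y
    using m_add[OF that, of m 1] m_add[OF that, of m "- 1"] by (simp_all add: f_def g_def)
  \<comment> \<open>The maps \<open>f\<close> and \<open>\<rho> b\<close> generate the action, so
    their common fixed points are global ones.\<close>
  have "\<not> (\<exists>t\<in>?U. f t = t \<and> (\<forall>b\<in>K. \<rho> b t = t))"
  proof
    assume "\<exists>t\<in>?U. f t = t \<and> (\<forall>b\<in>K. \<rho> b t = t)"
    then obtain t where t: "t \<in> ?U" "f t = t" "\<And>b. b \<in> K \<Longrightarrow> \<rho> b t = t" by blast
    have gt: "g t = t" using g_f[OF UI[OF t(1)]] t(2) by simp
    have "\<phi> (m, 0\<^sub>v d) t = t" for m
      by (induction m rule: int_induct[where k = 0])
        (use b_zero phi_Suc phi_pred UI[OF t(1)] t(2) gt in auto)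
    moreover have "\<phi> (0, v) t = t" if "v \<in> H" for v
      using t(3)[of "coords d v"] rho_coords[OF that] that by (auto simp: K_def)
    ultimately have "\<phi> (m, v) t = t" if "v \<in> H" for m v
      using split[OF that UI[OF t(1)], of m] that by simp
    then have "\<forall>x\<in>carrier G. \<phi> x t = t" by (auto simp: carrier_G)
    then show False using noglob t(1) by blast
  qed
  then obtain h m t l where h: "strict_mono_on ?U h" "h ` ?U = (UNIV :: real set)" and m: "m > 0"
    and hf: "\<And>y. y \<in> ?U \<Longrightarrow> h (f y) = m * h y + t"
    and hrho: "\<And>b y. b \<in> K \<Longrightarrow> y \<in> ?U \<Longrightarrow> h (\<rho> b y) = h y + l b"
    using conjugate_to_affine by metis
  define h' where "h' = inv_into ?U h"
  have homeo: "homeomorphism ?U UNIV h h'"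
    unfolding h'_def by (rule homeomorphism_of_strict_mono_surj[OF h])
  have h'_U: "h' r \<in> ?U" and h_h': "h (h' r) = r" for r
    using homeo unfolding homeomorphism_def by auto
  have h'_h: "h' (h y) = y" if "y \<in> ?U" for y
    using homeo that unfolding homeomorphism_def by auto
  have hg: "h (g y) = (1 / m) * h y + (- t / m)" if "y \<in> ?U" for y
    using hf[OF g_in_open[OF that]] f_g[OF UI[OF that]] m by (simp add: field_simps)
  \<comment> \<open>Invariance of the open interval is carried along, since \<open>h\<close> is
    controlled only there.\<close>
  have affine_m: "\<exists>k \<tau>. k > 0 \<and> (\<forall>y\<in>?U. \<phi> (n, 0\<^sub>v d) y \<in> ?U \<and> h (\<phi> (n, 0\<^sub>v d) y) = k * h y + \<tau>)" for n
  proof (induction n rule: int_induct[where k = 0])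
    case base
    show ?case by (rule exI[of _ 1], rule exI[of _ 0]) (use b_zero UI in auto)
  next
    case (step1 n)
    then obtain k \<tau> where IH: "k > 0"
      "\<And>y. y \<in> ?U \<Longrightarrow> \<phi> (n, 0\<^sub>v d) y \<in> ?U \<and> h (\<phi> (n, 0\<^sub>v d) y) = k * h y + \<tau>" by blast
    show ?case
    proof (intro exI conjI ballI)
      show "k * m > 0" using IH m by simp
      fix y assume y: "y \<in> ?U"
      show "\<phi> (n + 1, 0\<^sub>v d) y \<in> ?U" "h (\<phi> (n + 1, 0\<^sub>v d) y) = (k * m) * h y + (k * t + \<tau>)"
        unfolding phi_Suc[OF UI[OF y]] using IH(2)[OF f_in_open[OF y]] hf[OF y] by (simp_all add: algebra_simps)
    qed
  next
    case (step2 n)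
    then obtain k \<tau> where IH: "k > 0"
      "\<And>y. y \<in> ?U \<Longrightarrow> \<phi> (n, 0\<^sub>v d) y \<in> ?U \<and> h (\<phi> (n, 0\<^sub>v d) y) = k * h y + \<tau>" by blast
    show ?case
    proof (intro exI conjI ballI)
      show "k * (1 / m) > 0" using IH m by simp
      fix y assume y: "y \<in> ?U"
      show "\<phi> (n - 1, 0\<^sub>v d) y \<in> ?U" "h (\<phi> (n - 1, 0\<^sub>v d) y) = (k * (1 / m)) * h y + (k * (- t / m) + \<tau>)"
        unfolding phi_pred[OF UI[OF y]] using IH(2)[OF g_in_open[OF y]] hg[OF y] by (simp_all add: algebra_simps)
    qed
  qed
  have affine: "\<exists>k \<tau>. k > 0 \<and> (\<forall>y\<in>?U. \<phi> x y \<in> ?U \<and> h (\<phi> x y) = k * h y + \<tau>)" if x: "x \<in> carrier G" for x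
  proof -
    obtain n v where nv: "x = (n, v)" "v \<in> H" using x by (auto simp: carrier_G)
    obtain k \<tau> where n: "k > 0"
      "\<And>y. y \<in> ?U \<Longrightarrow> \<phi> (n, 0\<^sub>v d) y \<in> ?U \<and> h (\<phi> (n, 0\<^sub>v d) y) = k * h y + \<tau>"
      using affine_m by metis
    have cK: "coords d v \<in> K" using nv by (simp add: K_def)
    show ?thesis
    proof (intro exI conjI ballI)
      show "k > 0" by (rule n)
      fix y assume y: "y \<in> ?U"
      have *: "\<phi> x y = \<rho> (coords d v) (\<phi> (n, 0\<^sub>v d) y)"
        using split[OF nv(2) UI[OF y], of n] rho_coords[OF nv(2)] nv by simp
      show "\<phi> x y \<in> ?U" unfolding * using n(2)[OF y] by (intro rho_in_open[OF cK]) blast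
      show "h (\<phi> x y) = k * h y + (\<tau> + l (coords d v))"
        unfolding * using n(2)[OF y] hrho[OF cK, of "\<phi> (n, 0\<^sub>v d) y"] by simp
    qed
  qed
  have phi_U: "\<phi> x y \<in> ?U" if "x \<in> carrier G" "y \<in> ?U" for x y
    using affine[OF that(1)] that(2) by blast
  \<comment> \<open>Conjugation makes \<open>\<psi>\<close> multiplicative at once; that its values
    are affine maps is the content of \<open>affine\<close>.\<close>
  define \<psi> where "\<psi> x r = h (\<phi> x (h' r))" for x r
  have psi_Aff: "\<psi> x \<in> carrier Aff_plus" if x: "x \<in> carrier G" for x
  proof -
    obtain k \<tau> where "k > 0" "\<And>y. y \<in> ?U \<Longrightarrow> h (\<phi> x y) = k * h y + \<tau>" using affine[OF x] by blast
    then have "\<psi> x = (\<lambda>r. k * r + \<tau>)" using h'_U h_h' by (auto simp: \<psi>_def)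
    then show ?thesis using \<open>k > 0\<close> unfolding Aff_plus_def by auto
  qed
  \<comment> \<open>The product of \<open>Aff_plus\<close> is inherited from
    \<open>BijGroup\<close>, where it is composition only for bijections.\<close>
  have Aff_Bij: "F \<in> Bij UNIV" if F: "F \<in> carrier Aff_plus" for F
  proof -
    obtain k \<tau> where F: "k > 0" "F = (\<lambda>r. k * r + \<tau>)" using F unfolding Aff_plus_def by auto
    have "bij F" by (rule bij_betw_byWitness[where f' = "\<lambda>r. (r - \<tau>) / k"]) (use F in auto)
    then show ?thesis by (simp add: Bij_def)
  qed
  have "\<psi> \<in> hom G Aff_plus"
  proof (rule homI)
    fix x x' assume x: "x \<in> carrier G" "x' \<in> carrier G"
    have "\<psi> (x \<otimes>\<^bsub>G\<^esub> x') r = \<psi> x (\<psi> x' r)" for r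
      unfolding \<psi>_def using phi_mult[OF x UI[OF h'_U]] h'_h[OF phi_U[OF x(2) h'_U]] by simp
    then show "\<psi> (x \<otimes>\<^bsub>G\<^esub> x') = \<psi> x \<otimes>\<^bsub>Aff_plus\<^esub> \<psi> x'"
      using Aff_Bij[OF psi_Aff[OF x(1)]] Aff_Bij[OF psi_Aff[OF x(2)]]
      by (simp add: Aff_plus_def BijGroup_def compose_def fun_eq_iff)
  qed (rule psi_Aff)
  moreover have "\<forall>x\<in>carrier G. \<forall>y\<in>?U. h (\<phi> x y) = \<psi> x (h y)"
    using h'_h by (auto simp: \<psi>_def)
  ultimately show ?thesis using homeo by blast
qed

end
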